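(* Let $G$ be a group and let $\psi$ be a character of $G$. If $H \leq G$ is a weakly q-$\psi$-normal subgroup, then \[ \bar{b}_1^\psi(G) \leq \bar{b}_1^{\psi}(H). \]
   Context: A character of a group $G$ is a function $\psi\colon G \to \mathbb{C}$ of positive type (i.e. $\sum_{i,j} c_i \overline{c_j}\,\psi(g_j^{-1}g_i) \geq 0$ for all finite families $c_i \in \mathbb{C}$, $g_i \in G$) that is constant on conjugacy classes and satisfies $\psi(1_G)=1$. It defines a positive semi-definite inner product on $\mathbb{C}[G]$ by $\langle g,h\rangle_\psi = \psi(h^{-1}g)$; the Hilbert space obtained by dividing out null vectors and completing is $\ell^\psi(G)$, with unitary left and right $G$-actions. For a closed left-$G$-invariant subspace $V \subseteq \ell^\psi(G)^n$ with orthogonal projection $P$ onto $V$, put $\dim_\psi(V) = \sum_{i=1}^n \langle P e_i, e_i\rangle_\psi$, where $e_i$ has $i$-th entry $1_G$ and all other entries $0$. For a group $G$ with finite generating set $S$, let $\partial_1\colon \ell^\psi(G)^S\to\ell^\psi(G)$ be the bounded left-$G$-equivariant operator with $\partial_1(g e_s) = gs-g$, and let $Z_{G,S}$ be the kernel of its restriction $\mathbb{C}[G]^S\to\mathbb{C}[G]$ to the group ring level. The first $\psi$-Betti number is $b_1^\psi(G) = \dim_\psi(\ker\partial_1)-\dim_\psi(\overline{Z_{G,S}})$, where $\overline{Z_{G,S}}$ is the closure of the image of $Z_{G,S}$ in $\ell^\psi(G)^S$ (independent of $S$). For a subgroup $H\leq G$, $b_1^\psi(H)$ means $b_1^{\psi|_H}(H)$,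 and similarly for $\bar b_1^\psi(H)$. For an arbitrary group $G$, \[\bar{b}_1^\psi(G) := \liminf_{H\leq G} b_1^\psi(H)\in[0,\infty],\] the limit inferior over the directed system of all finitely generated subgroups $H\leq G$ ordered by inclusion (so $\bar b_1^\psi(G)=b_1^\psi(G)$ if $G$ is finitely generated). A subgroup $K\leq G$ is $\psi$-regular if $\psi(k)=0$ for all $k\in K\setminus\{1\}$. A subgroup $H\leq G$ is q-$\psi$-normal (in $G$) if there is a set $A\subseteq G$ such that $G=\langle H\cup A\rangle$ and $H\cap aHa^{-1}$ contains an infinite $\psi$-regular subgroup for all $a\in A$. A subgroup $H\leq G$ is weakly q-$\psi$-normal if there are an ordinal number $\alpha$ and an increasing chain of subgroups $(H_\gamma)_{\gamma\leq\alpha}$ with $H_0=H$ and $H_\alpha=G$ such that $\bigcup_{\beta<\gamma}H_\beta$ is q-$\psi$-normal in $H_\gamma$ for all $0<\gamma\leq\alpha$. *)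

theory Defs
  imports "HOL-Analysis.Analysis" "HOL-Algebra.Generated_Groups"
begin

section \<open>Complex vector spaces with a positive semi-definite inner product\<close>

text \<open>
  The spaces below depend on a group and on a character, hence they are carrier-based.
  The inner product is linear in its first argument and may have null vectors.
\<close>

record 'v ips = "'v partial_object" +
  vzero :: 'v
  vadd :: "'v \<Rightarrow> 'v \<Rightarrow> 'v"
  vscale :: "complex \<Rightarrow> 'v \<Rightarrow> 'v"
  ip :: "'v \<Rightarrow> 'v \<Rightarrow> complex"

definition vdiff :: "('v, 'c) ips_scheme \<Rightarrow> 'v \<Rightarrow> 'v \<Rightarrow> 'v" where
  "vdiff V x y = vadd V x (vscale V (-1) y)"

definition vnorm :: "('v, 'c) ips_scheme \<Rightarrow> 'v \<Rightarrow> real" where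
  "vnorm V x = sqrt (Re (ip V x x))"

text \<open>
  Dividing out null vectors and completing, in one step: vectors are classes of Cauchy
  sequences (with respect to the seminorm) modulo sequences of seminorm tending to 0.
\<close>

definition cauchy_seqs :: "('v, 'c) ips_scheme \<Rightarrow> (nat \<Rightarrow> 'v) set" where
  "cauchy_seqs V = {X. (\<forall>n. X n \<in> carrier V) \<and>
     (\<forall>e>0. \<exists>N. \<forall>m\<ge>N. \<forall>n\<ge>N. vnorm V (vdiff V (X m) (X n)) < e)}"

definition null_rel :: "('v, 'c) ips_scheme \<Rightarrow> (nat \<Rightarrow> 'v) rel" where
  "null_rel V = {(X, Y). X \<in> cauchy_seqs V \<and> Y \<in> cauchy_seqs V \<and>
     (\<lambda>n. vnorm V (vdiff V (X n) (Y n))) \<longlonglongrightarrow> 0}"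

definition completion :: "('v, 'c) ips_scheme \<Rightarrow> (nat \<Rightarrow> 'v) set ips" where
  "completion V =
    \<lparr>carrier = cauchy_seqs V // null_rel V,
     vzero = null_rel V `` {\<lambda>_. vzero V},
     vadd = (\<lambda>u v. \<Union>X\<in>u. \<Union>Y\<in>v. null_rel V `` {\<lambda>n. vadd V (X n) (Y n)}),
     vscale = (\<lambda>c u. \<Union>X\<in>u. null_rel V `` {\<lambda>n. vscale V c (X n)}),
     ip = (\<lambda>u v. THE c. \<exists>X\<in>u. \<exists>Y\<in>v. (\<lambda>n. ip V (X n) (Y n)) \<longlonglongrightarrow> c)\<rparr>"

definition embed :: "('v, 'c) ips_scheme \<Rightarrow> 'v \<Rightarrow> (nat \<Rightarrow> 'v) set" where
  "embed V x = null_rel V `` {\<lambda>_. x}"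

definition ips_power :: "'i set \<Rightarrow> ('v, 'c) ips_scheme \<Rightarrow> ('i \<Rightarrow> 'v) ips" where
  "ips_power I V =
    \<lparr>carrier = I \<rightarrow>\<^sub>E carrier V,
     vzero = (\<lambda>i\<in>I. vzero V),
     vadd = (\<lambda>x y. \<lambda>i\<in>I. vadd V (x i) (y i)),
     vscale = (\<lambda>c x. \<lambda>i\<in>I. vscale V c (x i)),
     ip = (\<lambda>x y. \<Sum>i\<in>I. ip V (x i) (y i))\<rparr>"

definition ips_closure :: "('v, 'c) ips_scheme \<Rightarrow> 'v set \<Rightarrow> 'v set" where
  "ips_closure V A = {x \<in> carrier V. \<forall>e>0. \<exists>y\<in>A. vnorm V (vdiff V x y) < e}"

text \<open>Orthogonal projection onto a closed subspace \<open>A\<close> of a Hilbert space \<open>V\<close>.\<close>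

definition ips_proj :: "('v, 'c) ips_scheme \<Rightarrow> 'v set \<Rightarrow> 'v \<Rightarrow> 'v" where
  "ips_proj V A x = (THE p. p \<in> A \<and> (\<forall>a\<in>A. ip V (vdiff V x p) a = 0))"


section \<open>Characters and the Hilbert space of a character\<close>

text \<open>
  A character is a total function on the type, but only its values on \<open>carrier G\<close> are ever
  used. Hence its restriction to a subgroup \<open>H\<close> is obtained just by replacing \<open>G\<close> with
  \<open>G\<lparr>carrier := H\<rparr>\<close>.
\<close>

definition character :: "('a, 'b) monoid_scheme \<Rightarrow> ('a \<Rightarrow> complex) \<Rightarrow> bool" where
  "character G \<psi> \<longleftrightarrow>
     (\<forall>(n::nat) (c::nat \<Rightarrow> complex) (g::nat \<Rightarrow> 'a). (\<forall>i<n. g i \<in> carrier G) \<longrightarrow>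
        (\<Sum>i<n. \<Sum>j<n. c i * cnj (c j) * \<psi> (inv\<^bsub>G\<^esub> (g j) \<otimes>\<^bsub>G\<^esub> g i)) \<in> \<real>\<^sub>\<ge>\<^sub>0) \<and>
     (\<forall>g\<in>carrier G. \<forall>h\<in>carrier G. \<psi> (h \<otimes>\<^bsub>G\<^esub> g \<otimes>\<^bsub>G\<^esub> inv\<^bsub>G\<^esub> h) = \<psi> g) \<and>
     \<psi> \<one>\<^bsub>G\<^esub> = 1"

text \<open>
  The group ring: finitely supported functions, extended by 0 outside \<open>carrier G\<close>, with the
  sesquilinear extension of \<open>\<langle>g, h\<rangle> = \<psi> (h\<^sup>-\<^sup>1 g)\<close>.
\<close>

definition group_ring :: "('a, 'b) monoid_scheme \<Rightarrow> ('a \<Rightarrow> complex) \<Rightarrow> ('a \<Rightarrow> complex) ips" where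
  "group_ring G \<psi> =
    \<lparr>carrier = {f. finite {g. f g \<noteq> 0} \<and> {g. f g \<noteq> 0} \<subseteq> carrier G},
     vzero = (\<lambda>_. 0),
     vadd = (\<lambda>f h x. f x + h x),
     vscale = (\<lambda>c f x. c * f x),
     ip = (\<lambda>f h. \<Sum>g | f g \<noteq> 0. \<Sum>k | h k \<noteq> 0.
              f g * cnj (h k) * \<psi> (inv\<^bsub>G\<^esub> k \<otimes>\<^bsub>G\<^esub> g))\<rparr>"

definition gr_basis :: "'a \<Rightarrow> 'a \<Rightarrow> complex" where
  "gr_basis g = (\<lambda>x. if x = g then 1 else 0)"

definition ell :: "('a, 'b) monoid_scheme \<Rightarrow> ('a \<Rightarrow> complex) \<Rightarrow> (nat \<Rightarrow> 'a \<Rightarrow> complex) set ips" where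
  "ell G \<psi> = completion (group_ring G \<psi>)"

abbreviation ell_pow ::
    "('a, 'b) monoid_scheme \<Rightarrow> ('a \<Rightarrow> complex) \<Rightarrow> 'i set \<Rightarrow> ('i \<Rightarrow> (nat \<Rightarrow> 'a \<Rightarrow> complex) set) ips" where
  "ell_pow G \<psi> I \<equiv> ips_power I (ell G \<psi>)"

definition unit_vec ::
    "('a, 'b) monoid_scheme \<Rightarrow> ('a \<Rightarrow> complex) \<Rightarrow> 'i set \<Rightarrow> 'i \<Rightarrow> 'i \<Rightarrow> (nat \<Rightarrow> 'a \<Rightarrow> complex) set" where
  "unit_vec G \<psi> I i =
     (\<lambda>j\<in>I. if j = i then embed (group_ring G \<psi>) (gr_basis \<one>\<^bsub>G\<^esub>) else vzero (ell G \<psi>))"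

definition dim_psi ::
    "('a, 'b) monoid_scheme \<Rightarrow> ('a \<Rightarrow> complex) \<Rightarrow> 'i set \<Rightarrow> ('i \<Rightarrow> (nat \<Rightarrow> 'a \<Rightarrow> complex) set) set \<Rightarrow> real" where
  "dim_psi G \<psi> I V =
     Re (\<Sum>i\<in>I. ip (ell_pow G \<psi> I) (ips_proj (ell_pow G \<psi> I) V (unit_vec G \<psi> I i)) (unit_vec G \<psi> I i))"


section \<open>The first Betti number\<close>

text \<open>
  \<open>(f s)(x \<otimes> inv s)\<close> is the coefficient at \<open>x\<close> of the right translate of \<open>f s\<close> by \<open>s\<close>, so
  this is \<open>f \<mapsto> (\<Sum>s\<in>S. f s \<cdot> s - f s)\<close>; see \<open>gr_boundary_basis\<close> below for basis vectors.
\<close>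

definition gr_boundary :: "('a, 'b) monoid_scheme \<Rightarrow> 'a set \<Rightarrow> ('a \<Rightarrow> 'a \<Rightarrow> complex) \<Rightarrow> 'a \<Rightarrow> complex" where
  "gr_boundary G S f =
     (\<lambda>x. if x \<in> carrier G then \<Sum>s\<in>S. f s (x \<otimes>\<^bsub>G\<^esub> inv\<^bsub>G\<^esub> s) - f s x else 0)"

text \<open>The continuous extension of \<open>gr_boundary\<close>, computed on representing Cauchy sequences.\<close>

definition boundary ::
    "('a, 'b) monoid_scheme \<Rightarrow> ('a \<Rightarrow> complex) \<Rightarrow> 'a set \<Rightarrow>
     ('a \<Rightarrow> (nat \<Rightarrow> 'a \<Rightarrow> complex) set) \<Rightarrow> (nat \<Rightarrow> 'a \<Rightarrow> complex) set" where
  "boundary G \<psi> S u =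
     (\<Union>X \<in> Pi S u. null_rel (group_ring G \<psi>) `` {\<lambda>n. gr_boundary G S (\<lambda>s. X s n)})"

definition ker_boundary ::
    "('a, 'b) monoid_scheme \<Rightarrow> ('a \<Rightarrow> complex) \<Rightarrow> 'a set \<Rightarrow> ('a \<Rightarrow> (nat \<Rightarrow> 'a \<Rightarrow> complex) set) set" where
  "ker_boundary G \<psi> S = {u \<in> carrier (ell_pow G \<psi> S). boundary G \<psi> S u = vzero (ell G \<psi>)}"

definition gr_cycles ::
    "('a, 'b) monoid_scheme \<Rightarrow> ('a \<Rightarrow> complex) \<Rightarrow> 'a set \<Rightarrow> ('a \<Rightarrow> 'a \<Rightarrow> complex) set" where
  "gr_cycles G \<psi> S = {f \<in> S \<rightarrow>\<^sub>E carrier (group_ring G \<psi>). gr_boundary G S f = (\<lambda>_. 0)}"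

definition b1_wrt :: "('a, 'b) monoid_scheme \<Rightarrow> ('a \<Rightarrow> complex) \<Rightarrow> 'a set \<Rightarrow> real" where
  "b1_wrt G \<psi> S =
     dim_psi G \<psi> S (ker_boundary G \<psi> S) -
     dim_psi G \<psi> S (ips_closure (ell_pow G \<psi> S)
        ((\<lambda>f. \<lambda>s\<in>S. embed (group_ring G \<psi>) (f s)) ` gr_cycles G \<psi> S))"

definition finite_generating_set :: "('a, 'b) monoid_scheme \<Rightarrow> 'a set \<Rightarrow> bool" where
  "finite_generating_set G S \<longleftrightarrow> finite S \<and> S \<subseteq> carrier G \<and> generate G S = carrier G"

text \<open>Meaningful for finitely generated \<open>G\<close>; the value does not depend on the chosen \<open>S\<close>.\<close>

definition b1 :: "('a, 'b) monoid_scheme \<Rightarrow> ('a \<Rightarrow> complex) \<Rightarrow> real" where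
  "b1 G \<psi> = b1_wrt G \<psi> (SOME S. finite_generating_set G S)"

definition fg_subgroups :: "('a, 'b) monoid_scheme \<Rightarrow> 'a set set" where
  "fg_subgroups G = {H. subgroup H G \<and> (\<exists>S. finite_generating_set (G\<lparr>carrier := H\<rparr>) S)}"

text \<open>The filter of tails of the directed set of finitely generated subgroups.\<close>

definition fg_filter :: "('a, 'b) monoid_scheme \<Rightarrow> 'a set filter" where
  "fg_filter G = (INF K\<in>fg_subgroups G. principal {H \<in> fg_subgroups G. K \<subseteq> H})"

definition bar_b1 :: "('a, 'b) monoid_scheme \<Rightarrow> ('a \<Rightarrow> complex) \<Rightarrow> ereal" where
  "bar_b1 G \<psi> = Liminf (fg_filter G) (\<lambda>H. ereal (b1 (G\<lparr>carrier := H\<rparr>) \<psi>))"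


section \<open>Weakly q-normal subgroups\<close>

definition psi_regular :: "('a, 'b) monoid_scheme \<Rightarrow> ('a \<Rightarrow> complex) \<Rightarrow> 'a set \<Rightarrow> bool" where
  "psi_regular G \<psi> K \<longleftrightarrow> subgroup K G \<and> (\<forall>k\<in>K - {\<one>\<^bsub>G\<^esub>}. \<psi> k = 0)"

definition q_psi_normal :: "('a, 'b) monoid_scheme \<Rightarrow> ('a \<Rightarrow> complex) \<Rightarrow> 'a set \<Rightarrow> bool" where
  "q_psi_normal G \<psi> H \<longleftrightarrow> subgroup H G \<and>
     (\<exists>A \<subseteq> carrier G. generate G (H \<union> A) = carrier G \<and>
        (\<forall>a\<in>A. \<exists>K. psi_regular G \<psi> K \<and> infinite K \<and>
           K \<subseteq> H \<inter> (a <#\<^bsub>G\<^esub> H #>\<^bsub>G\<^esub> inv\<^bsub>G\<^esub> a)))"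

text \<open>
  The ordinals \<open>\<gamma> \<le> \<alpha>\<close> are represented by a well-order \<open>r\<close> on a subset of \<open>'i\<close> with least
  element \<open>z\<close> (the ordinal 0) and greatest element \<open>\<alpha>\<close>; \<open>underS r \<gamma>\<close> is the set of
  \<open>\<beta> < \<gamma>\<close>. HOL cannot quantify over types, so \<open>'i\<close> is a parameter; a theorem with this
  predicate as a hypothesis and \<open>'i\<close> arbitrary covers all ordinals.
\<close>

definition weakly_q_psi_normal ::
    "'i itself \<Rightarrow> ('a, 'b) monoid_scheme \<Rightarrow> ('a \<Rightarrow> complex) \<Rightarrow> 'a set \<Rightarrow> bool" where
  "weakly_q_psi_normal (_ :: 'i itself) G \<psi> H \<longleftrightarrow> subgroup H G \<and>
     (\<exists>(r :: 'i rel) z \<alpha> C. Well_order r \<and> z \<in> Field r \<and> \<alpha> \<in> Field r \<and>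
        (\<forall>\<gamma>\<in>Field r. (z, \<gamma>) \<in> r \<and> (\<gamma>, \<alpha>) \<in> r) \<and>
        (\<forall>\<gamma>\<in>Field r. subgroup (C \<gamma>) G) \<and>
        (\<forall>\<beta> \<gamma>. (\<beta>, \<gamma>) \<in> r \<longrightarrow> C \<beta> \<subseteq> C \<gamma>) \<and>
        C z = H \<and> C \<alpha> = carrier G \<and>
        (\<forall>\<gamma>\<in>Field r - {z}.
           q_psi_normal (G\<lparr>carrier := C \<gamma>\<rparr>) \<psi> (\<Union>\<beta>\<in>underS r \<gamma>. C \<beta>)))"


section \<open>Consistency checks\<close>

lemma group_ring_ip_basis:
  "ip (group_ring G \<psi>) (gr_basis g) (gr_basis h) = \<psi> (inv\<^bsub>G\<^esub> h \<otimes>\<^bsub>G\<^esub> g)"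
  by (simp add: group_ring_def gr_basis_def)

lemma gr_boundary_basis:
  assumes "group G" "finite S" "S \<subseteq> carrier G" "s \<in> S" "g \<in> carrier G"
  shows "gr_boundary G S (\<lambda>t\<in>S. if t = s then gr_basis g else (\<lambda>_. 0)) =
         (\<lambda>x. gr_basis (g \<otimes>\<^bsub>G\<^esub> s) x - gr_basis g x)"
proof
  fix x
  interpret group G by fact
  have s: "s \<in> carrier G" using assms by blast
  have *: "x \<otimes>\<^bsub>G\<^esub> inv\<^bsub>G\<^esub> s = g \<longleftrightarrow> x = g \<otimes>\<^bsub>G\<^esub> s" if "x \<in> carrier G"
    using that s \<open>g \<in> carrier G\<close> by (metis inv_closed inv_solve_right)
  let ?f = "\<lambda>t\<in>S. if t = s then gr_basis g else (\<lambda>_. 0 :: complex)"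
  have "(\<Sum>t\<in>S. ?f t (x \<otimes>\<^bsub>G\<^esub> inv\<^bsub>G\<^esub> t) - ?f t x) =
        (\<Sum>t\<in>S. if t = s then gr_basis g (x \<otimes>\<^bsub>G\<^esub> inv\<^bsub>G\<^esub> s) - gr_basis g x else 0)"
    by (intro sum.cong) auto
  also have "\<dots> = gr_basis g (x \<otimes>\<^bsub>G\<^esub> inv\<^bsub>G\<^esub> s) - gr_basis g x"
    using assms by simp
  finally show "gr_boundary G S ?f x = gr_basis (g \<otimes>\<^bsub>G\<^esub> s) x - gr_basis g x"
    using * s \<open>g \<in> carrier G\<close> by (auto simp: gr_boundary_def gr_basis_def)
qed

lemma fg_subgroups_directed:
  assumes "group G" "H \<in> fg_subgroups G" "K \<in> fg_subgroups G"
  shows "\<exists>L\<in>fg_subgroups G. H \<subseteq> L \<and> K \<subseteq> L"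
proof -
  interpret group G by fact
  obtain S T where S: "subgroup H G" "finite S" "S \<subseteq> H" "generate (G\<lparr>carrier := H\<rparr>) S = H"
    and T: "subgroup K G" "finite T" "T \<subseteq> K" "generate (G\<lparr>carrier := K\<rparr>) T = K"
    using assms(2,3) unfolding fg_subgroups_def finite_generating_set_def by force
  define L where "L = generate G (S \<union> T)"
  have ST: "S \<union> T \<subseteq> carrier G" using S T subgroup.subset by blast
  have sub: "subgroup L G" unfolding L_def by (rule generate_is_subgroup[OF ST])
  have inc: "S \<union> T \<subseteq> L" unfolding L_def by (rule subsetI) (rule generate.incl)
  have "generate (G\<lparr>carrier := L\<rparr>) (S \<union> T) = L"
    using generate_consistent[OF inc sub] by (simp add: L_def)
  then have "finite_generating_set (G\<lparr>carrier := L\<rparr>) (S \<union> T)"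
    using inc S(2) T(2) by (simp add: finite_generating_set_def)
  then have "L \<in> fg_subgroups G"
    using sub unfolding fg_subgroups_def by blast
  moreover have "H \<subseteq> L"
    using generate_consistent[OF S(3,1)] S(4) mono_generate[of S "S \<union> T"] by (simp add: L_def)
  moreover have "K \<subseteq> L"
    using generate_consistent[OF T(3,1)] T(4) mono_generate[of T "S \<union> T"] by (simp add: L_def)
  ultimately show ?thesis by blast
qed

lemma eventually_fg_filter:
  assumes "group G"
  shows "eventually P (fg_filter G) \<longleftrightarrow> (\<exists>K\<in>fg_subgroups G. \<forall>H\<in>fg_subgroups G. K \<subseteq> H \<longrightarrow> P H)"
proof -
  interpret group G by fact
  have "{\<one>\<^bsub>G\<^esub>} \<in> fg_subgroups G"
    using triv_subgroup generate_consistent[OF _ triv_subgroup, of "{}"] generate_empty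
    by (auto simp: fg_subgroups_def finite_generating_set_def intro!: exI[of _ "{}"])
  then have ne: "fg_subgroups G \<noteq> {}" by blast
  have dir: "\<exists>L\<in>fg_subgroups G. principal {H \<in> fg_subgroups G. L \<subseteq> H} \<le>
      inf (principal {H \<in> fg_subgroups G. K1 \<subseteq> H}) (principal {H \<in> fg_subgroups G. K2 \<subseteq> H})"
    if K: "K1 \<in> fg_subgroups G" "K2 \<in> fg_subgroups G" for K1 K2
  proof -
    obtain L where L: "L \<in> fg_subgroups G" "K1 \<subseteq> L" "K2 \<subseteq> L"
      using fg_subgroups_directed[OF assms K] by blast
    show ?thesis
      by (rule bexI[OF _ L(1)]) (use L(2,3) in auto)
  qed
  have "eventually P (fg_filter G) \<longleftrightarrow>
      (\<exists>K\<in>fg_subgroups G. eventually P (principal {H \<in> fg_subgroups G. K \<subseteq> H}))"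
    unfolding fg_filter_def by (rule eventually_INF_base[OF ne dir])
  then show ?thesis
    unfolding eventually_principal by blast
qed

lemma bar_b1_eq_SUP_INF:
  assumes "group G"
  shows "bar_b1 G \<psi> = (SUP K\<in>fg_subgroups G. INF H\<in>{H \<in> fg_subgroups G. K \<subseteq> H}.
           ereal (b1 (G\<lparr>carrier := H\<rparr>) \<psi>))"
  unfolding bar_b1_def Liminf_def
proof (rule antisym; rule SUP_least)
  fix P assume "P \<in> {P. eventually P (fg_filter G)}"
  then obtain K where "K \<in> fg_subgroups G" "\<forall>H\<in>fg_subgroups G. K \<subseteq> H \<longrightarrow> P H"
    using eventually_fg_filter[OF assms] by auto
  then show "(INF H\<in>{x. P x}. ereal (b1 (G\<lparr>carrier := H\<rparr>) \<psi>)) \<le>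
    (SUP K\<in>fg_subgroups G. INF H\<in>{H \<in> fg_subgroups G. K \<subseteq> H}. ereal (b1 (G\<lparr>carrier := H\<rparr>) \<psi>))"
    by (intro SUP_upper2[of K] INF_superset_mono) auto
next
  fix K assume "K \<in> fg_subgroups G"
  then have "eventually (\<lambda>H. H \<in> fg_subgroups G \<and> K \<subseteq> H) (fg_filter G)"
    using eventually_fg_filter[OF assms] by auto
  then show "(INF H\<in>{H \<in> fg_subgroups G. K \<subseteq> H}. ereal (b1 (G\<lparr>carrier := H\<rparr>) \<psi>)) \<le>
    (SUP P\<in>{P. eventually P (fg_filter G)}. INF H\<in>{x. P x}. ereal (b1 (G\<lparr>carrier := H\<rparr>) \<psi>))"
    by (intro SUP_upper2[of "\<lambda>H. H \<in> fg_subgroups G \<and> K \<subseteq> H"]) auto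
qed

lemma bar_b1_finitely_generated:
  assumes "group G" "finite_generating_set G S"
  shows "bar_b1 G \<psi> = ereal (b1 G \<psi>)"
proof -
  interpret group G by fact
  let ?f = "\<lambda>H. ereal (b1 (G\<lparr>carrier := H\<rparr>) \<psi>)"
  have G: "carrier G \<in> fg_subgroups G"
    using assms(2) subgroup_self by (auto simp: fg_subgroups_def)
  have sub: "H \<subseteq> carrier G" if "H \<in> fg_subgroups G" for H
    using that subgroup.subset by (auto simp: fg_subgroups_def)
  have top: "{H \<in> fg_subgroups G. carrier G \<subseteq> H} = {carrier G}"
    using G sub by auto
  have "bar_b1 G \<psi> = ?f (carrier G)"
    unfolding bar_b1_eq_SUP_INF[OF assms(1)]
  proof (rule antisym)
    show "(SUP K\<in>fg_subgroups G. INF H\<in>{H \<in> fg_subgroups G. K \<subseteq> H}. ?f H) \<le> ?f (carrier G)"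
      using G sub by (intro SUP_least INF_lower) auto
    show "?f (carrier G) \<le> (SUP K\<in>fg_subgroups G. INF H\<in>{H \<in> fg_subgroups G. K \<subseteq> H}. ?f H)"
      using top by (intro SUP_upper2[OF G]) simp
  qed
  then show ?thesis by simp
qed

end

(*
  For a subspace M of C[G]^n one has <P e_i, e_i> = 1 - dist(e_i, M)^2, where P is the orthogonal
  projection onto the closure of M. Hence all dimensions can be computed in the group ring, from
  distances with respect to a semi-inner product. The key fact is that for an invariant M the sum
  of dist_w(e_i, M)^2 / w_i does not depend on the weights w_i > 0 of the coordinates: it is n
  minus the trace of an idempotent with the closure of M as its image. Letting some of the weights
  tend to 0 or to infinity replaces the usual calculus of von Neumann dimensions (rank and nullity,
  additivity along block triangular maps).

  In this way b_1(G) = z(S) - 1 + b_0(G) for a finite generating set S, where z(S) is the sum of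
  dist(e_s, Z)^2 for the space Z of cycles and b_0(G) = dist(1, im d)^2; both terms do not depend
  on S. If a new generator a is added and F is a finite set of elements k with k, a^-1 k a in the
  old group H, then b_0 does not increase, and the cycles coming from k a = a h increase z(S) by
  at most the squared norm of the mean of F. This is 1/|F| if F lies in a psi-regular subgroup, and
  F can be taken arbitrarily large. The rest is approximation by finitely generated subgroups and
  well-founded induction along the chain.
*)
theory Submission
  imports Defs "HOL-Library.Function_Algebras"
begin

section \<open>Real semi-inner products and distances to subspaces\<close>

text \<open>The kernel of the boundary on the completion, unlike the closure of the cycles, is not
  given as the closure of a subspace of the group ring. It is reached through its orthogonal
  complement, the closure of the image of the adjoint map \<open>cobd\<close>; for the projection P
  onto the kernel, <P e_i, e_i> is the squared distance of e_i to that image. Orthogonal projections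
  are replaced by minimizing sequences, so that an identity between operators becomes a limit of
  inner products in the group ring. Distances and orthogonality use only the real part of the inner
  product; complex orthogonality is recovered by testing against a vector and against i times that
  vector. The independence of the weights is the trace property in disguise. The projections for two
  systems of weights have the same image, and the trace of their product is computed in two ways.
  Invariance of psi under conjugation makes the involution f* antiunitary, and this is what
  exchanges the two matrix indices.\<close>

instantiation "fun" :: (type, real_vector) real_vector
begin

definition scaleR_fun :: "real \<Rightarrow> ('a \<Rightarrow> 'b) \<Rightarrow> 'a \<Rightarrow> 'b" where
  "scaleR_fun r f = (\<lambda>x. r *\<^sub>R f x)"

instance
  by standard (auto simp: scaleR_fun_def fun_eq_iff algebra_simps)

end

lemma square_le_mult_if_quadratic_nonneg:
  fixes a b c :: real
  assumes "\<And>s. 0 \<le> a - 2 * s * b + s\<^sup>2 * c" "0 \<le> c"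
  shows "b\<^sup>2 \<le> a * c"
proof (cases "c = 0")
  case True
  have "b = 0"
  proof (rule ccontr)
    assume "b \<noteq> 0"
    then show False
      \<comment> \<open>For \<open>c = 0\<close> this \<open>s\<close> gives the value
        \<open>-1\<close>.\<close>
      using assms(1)[of "(a + 1) / (2 * b)"] True by (simp add: field_simps)
  qed
  then show ?thesis using True by simp
next
  case False
  then show ?thesis
    using assms(1)[of "b / c"] assms(2) by (simp add: field_simps power2_eq_square)
qed

text \<open>Null vectors are allowed and completeness is not assumed, since the model in mind is the
  group ring with the real part of its inner product. The carrier \<open>C\<close> is a subspace of
  a type, so that functions on a group and tuples of such functions fit the same locale.\<close>

locale semi_inner =
  fixes C :: "'v::real_vector set" and B :: "'v \<Rightarrow> 'v \<Rightarrow> real"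
  assumes subspace_C: "subspace C"
    and add_left: "\<lbrakk>x \<in> C; y \<in> C; z \<in> C\<rbrakk> \<Longrightarrow> B (x + y) z = B x z + B y z"
    and scale_left: "\<lbrakk>x \<in> C; y \<in> C\<rbrakk> \<Longrightarrow> B (r *\<^sub>R x) y = r * B x y"
    and sym: "\<lbrakk>x \<in> C; y \<in> C\<rbrakk> \<Longrightarrow> B x y = B y x"
    and nonneg: "x \<in> C \<Longrightarrow> 0 \<le> B x x"
begin

lemma C_zero [simp]: "0 \<in> C" by (rule subspace_0[OF subspace_C])
lemma C_add [simp]: "x \<in> C \<Longrightarrow> y \<in> C \<Longrightarrow> x + y \<in> C" by (rule subspace_add[OF subspace_C])
lemma C_diff [simp]: "x \<in> C \<Longrightarrow> y \<in> C \<Longrightarrow> x - y \<in> C" by (rule subspace_diff[OF subspace_C])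
lemma C_scale [simp]: "x \<in> C \<Longrightarrow> r *\<^sub>R x \<in> C" by (rule subspace_scale[OF subspace_C])
lemma C_minus [simp]: "x \<in> C \<Longrightarrow> - x \<in> C" by (rule subspace_neg[OF subspace_C])

lemma add_right: "\<lbrakk>x \<in> C; y \<in> C; z \<in> C\<rbrakk> \<Longrightarrow> B z (x + y) = B z x + B z y"
  using add_left sym by simp

lemma scale_right: "\<lbrakk>x \<in> C; y \<in> C\<rbrakk> \<Longrightarrow> B y (r *\<^sub>R x) = r * B y x"
  using scale_left sym by simp

lemma zero_left [simp]: "x \<in> C \<Longrightarrow> B 0 x = 0"
  using scale_left[of x x 0] by simp

lemma zero_right [simp]: "x \<in> C \<Longrightarrow> B x 0 = 0"
  using sym[of x 0] by simp

lemma minus_left: "\<lbrakk>x \<in> C; y \<in> C\<rbrakk> \<Longrightarrow> B (- x) y = - B x y"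
  using scale_left[of x y "-1"] by simp

lemma minus_right: "\<lbrakk>x \<in> C; y \<in> C\<rbrakk> \<Longrightarrow> B y (- x) = - B y x"
  using scale_right[of x y "-1"] by simp

lemma diff_left: "\<lbrakk>x \<in> C; y \<in> C; z \<in> C\<rbrakk> \<Longrightarrow> B (x - y) z = B x z - B y z"
  using add_left[of x "- y" z] minus_left[of y z] by simp

lemma diff_right: "\<lbrakk>x \<in> C; y \<in> C; z \<in> C\<rbrakk> \<Longrightarrow> B z (x - y) = B z x - B z y"
  using add_right[of x "- y" z] minus_right[of y z] by simp

lemmas bilinear = add_left add_right diff_left diff_right scale_left scale_right minus_left minus_right

definition q :: "'v \<Rightarrow> real" where "q x = B x x"

definition nrm :: "'v \<Rightarrow> real" where "nrm x = sqrt (q x)"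

lemma q_nonneg [simp]: "x \<in> C \<Longrightarrow> 0 \<le> q x" by (simp add: q_def nonneg)
lemma nrm_nonneg [simp]: "x \<in> C \<Longrightarrow> 0 \<le> nrm x" by (simp add: nrm_def)
lemma nrm_sq: "x \<in> C \<Longrightarrow> (nrm x)\<^sup>2 = q x" by (simp add: nrm_def)
lemma q_zero [simp]: "q 0 = 0" by (simp add: q_def)
lemma nrm_zero [simp]: "nrm 0 = 0" by (simp add: nrm_def)

lemma q_add: "\<lbrakk>x \<in> C; y \<in> C\<rbrakk> \<Longrightarrow> q (x + y) = q x + 2 * B x y + q y"
  by (simp add: q_def bilinear sym[of y x])

lemma q_diff: "\<lbrakk>x \<in> C; y \<in> C\<rbrakk> \<Longrightarrow> q (x - y) = q x - 2 * B x y + q y"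
  by (simp add: q_def bilinear sym[of y x])

lemma q_scale: "x \<in> C \<Longrightarrow> q (r *\<^sub>R x) = r\<^sup>2 * q x"
  by (simp add: q_def bilinear power2_eq_square)

lemma nrm_scale: "x \<in> C \<Longrightarrow> nrm (r *\<^sub>R x) = \<bar>r\<bar> * nrm x"
  by (simp add: nrm_def q_scale real_sqrt_mult)

lemma nrm_minus: "x \<in> C \<Longrightarrow> nrm (- x) = nrm x"
  using nrm_scale[of x "-1"] by simp

lemma cauchy_schwarz_sq:
  assumes "x \<in> C" "y \<in> C"
  shows "(B x y)\<^sup>2 \<le> q x * q y"
proof (rule square_le_mult_if_quadratic_nonneg)
  fix s :: real
  show "0 \<le> q x - 2 * s * B x y + s\<^sup>2 * q y"
    using q_nonneg[of "x - s *\<^sub>R y"] assms by (simp add: q_diff q_scale scale_right algebra_simps)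
qed (use assms in simp)

lemma cauchy_schwarz:
  assumes "x \<in> C" "y \<in> C"
  shows "\<bar>B x y\<bar> \<le> nrm x * nrm y"
  using real_sqrt_le_mono[OF cauchy_schwarz_sq[OF assms]] by (simp add: nrm_def real_sqrt_mult)

lemma nrm_triangle:
  assumes "x \<in> C" "y \<in> C"
  shows "nrm (x + y) \<le> nrm x + nrm y"
proof (rule power2_le_imp_le)
  show "(nrm (x + y))\<^sup>2 \<le> (nrm x + nrm y)\<^sup>2"
    using assms cauchy_schwarz[OF assms] by (simp add: nrm_sq q_add power2_sum)
qed (use assms in simp)

lemma nrm_triangle_diff:
  assumes "x \<in> C" "y \<in> C"
  shows "nrm (x - y) \<le> nrm x + nrm y"
  using nrm_triangle[of x "- y"] assms by (simp add: nrm_minus)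

lemma nrm_diff_commute: "\<lbrakk>x \<in> C; y \<in> C\<rbrakk> \<Longrightarrow> nrm (x - y) = nrm (y - x)"
  using nrm_minus[of "x - y"] by simp

lemma nrm_triangle_via:
  assumes "x \<in> C" "y \<in> C" "z \<in> C"
  shows "nrm (x - z) \<le> nrm (x - y) + nrm (y - z)"
  using nrm_triangle[of "x - y" "y - z"] assms by simp

section \<open>Cauchy sequences as stand-ins for vectors of the completion\<close>

definition cauchy :: "(nat \<Rightarrow> 'v) \<Rightarrow> bool" where
  "cauchy X \<longleftrightarrow> (\<forall>n. X n \<in> C) \<and> (\<forall>e>0. \<exists>N. \<forall>m\<ge>N. \<forall>n\<ge>N. nrm (X m - X n) < e)"

lemma cauchy_C [simp]: "cauchy X \<Longrightarrow> X n \<in> C" by (simp add: cauchy_def)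

lemma cauchy_const: "x \<in> C \<Longrightarrow> cauchy (\<lambda>_. x)" by (auto simp: cauchy_def)

definition nrm_bounded :: "(nat \<Rightarrow> 'v) \<Rightarrow> bool" where
  "nrm_bounded X \<longleftrightarrow> (\<forall>n. X n \<in> C) \<and> (\<exists>K. \<forall>n. nrm (X n) \<le> K)"

lemma nrm_boundedI: "(\<And>n. X n \<in> C) \<Longrightarrow> (\<And>n. nrm (X n) \<le> K) \<Longrightarrow> nrm_bounded X"
  by (auto simp: nrm_bounded_def)

lemma nrm_bounded_pos:
  assumes "nrm_bounded X"
  obtains K where "K > 0" "\<And>n. nrm (X n) \<le> K"
proof -
  obtain K where "\<And>n. nrm (X n) \<le> K" using assms by (auto simp: nrm_bounded_def)
  then have "\<And>n. nrm (X n) \<le> max K 1" by (simp add: le_max_iff_disj)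
  then show ?thesis by (intro that[of "max K 1"]) auto
qed

lemma cauchy_bounded:
  assumes "cauchy X"
  shows "nrm_bounded X"
proof -
  obtain N where N: "\<And>m n. m \<ge> N \<Longrightarrow> n \<ge> N \<Longrightarrow> nrm (X m - X n) < 1"
    using assms unfolding cauchy_def by (metis zero_less_one)
  define K where "K = Max ((\<lambda>n. nrm (X n)) ` {..N}) + 1"
  have K: "nrm (X n) \<le> K - 1" if "n \<le> N" for n
    using that by (auto simp: K_def intro!: Max_ge)
  have "nrm (X n) \<le> K" for n
  proof (cases "n \<le> N")
    case True
    then show ?thesis using K[of n] by simp
  next
    case False
    have "nrm (X n) \<le> nrm (X n - X N) + nrm (X N)"
      using nrm_triangle[of "X n - X N" "X N"] assms by simp
    then show ?thesis using N[of n N] False K[of N] by simp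
  qed
  then show ?thesis using assms by (auto simp: nrm_bounded_def)
qed

text \<open>\<open>nrm'\<close> and the type of \<open>Y\<close> are free: the Lipschitz bound may
  compare two different spaces, as it does for the coordinates of tuples and for the
  boundary.\<close>

lemma cauchy_of_bound:
  assumes "cauchy X" "\<And>m n. nrm' (Y m - Y n) \<le> K * nrm (X m - X n)"
  shows "\<forall>e>0. \<exists>N. \<forall>m\<ge>N. \<forall>n\<ge>N. (nrm' (Y m - Y n) :: real) < e"
proof (intro allI impI)
  fix e :: real
  assume "e > 0"
  \<comment> \<open>\<open>K\<close> may be zero or negative, while \<open>e\<close> gets divided by
    \<open>K'\<close>.\<close>
  define K' where "K' = max K 1"
  have "e / K' > 0" using \<open>e > 0\<close> by (simp add: K'_def)
  then obtain N where N: "\<And>m n. m \<ge> N \<Longrightarrow> n \<ge> N \<Longrightarrow> nrm (X m - X n) < e / K'"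
    using assms(1) unfolding cauchy_def by metis
  have "nrm' (Y m - Y n) < e" if "m \<ge> N" "n \<ge> N" for m n
  proof -
    have "nrm' (Y m - Y n) \<le> K' * nrm (X m - X n)"
      using assms(2)[of m n] assms(1) unfolding K'_def
      by (smt (verit) C_diff cauchy_C max.cobounded1 mult_right_mono nrm_nonneg)
    also have "\<dots> < e" using N[OF that] by (simp add: K'_def field_simps)
    finally show ?thesis .
  qed
  then show "\<exists>N. \<forall>m\<ge>N. \<forall>n\<ge>N. nrm' (Y m - Y n) < e" by blast
qed

lemma cauchy_diff:
  assumes "cauchy X" "cauchy Y"
  shows "cauchy (\<lambda>n. X n - Y n)"
  unfolding cauchy_def
proof (intro conjI allI impI)
  fix e :: real
  assume "e > 0"
  then obtain N N' where
    N: "\<And>m n. m \<ge> N \<Longrightarrow> n \<ge> N \<Longrightarrow> nrm (X m - X n) < e / 2" and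
    N': "\<And>m n. m \<ge> N' \<Longrightarrow> n \<ge> N' \<Longrightarrow> nrm (Y m - Y n) < e / 2"
    using assms unfolding cauchy_def by (metis half_gt_zero)
  have "nrm (X m - Y m - (X n - Y n)) < e" if "m \<ge> max N N'" "n \<ge> max N N'" for m n
  proof -
    have "nrm (X m - Y m - (X n - Y n)) = nrm ((X m - X n) - (Y m - Y n))"
      by (simp add: algebra_simps)
    also have "\<dots> \<le> nrm (X m - X n) + nrm (Y m - Y n)"
      using assms by (intro nrm_triangle_diff) auto
    also have "\<dots> < e" using N[of m n] N'[of m n] that by simp
    finally show ?thesis .
  qed
  then show "\<exists>N. \<forall>m\<ge>N. \<forall>n\<ge>N. nrm (X m - Y m - (X n - Y n)) < e" by blast
qed (use assms in auto)

lemma tendsto_B_null: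
  assumes "(\<lambda>n. nrm (X n)) \<longlonglongrightarrow> 0" "\<And>n. X n \<in> C" "nrm_bounded Y"
  shows "(\<lambda>n. B (X n) (Y n)) \<longlonglongrightarrow> 0"
proof -
  obtain K where K: "K > 0" "\<And>n. nrm (Y n) \<le> K" using nrm_bounded_pos[OF assms(3)] by blast
  have Y: "Y n \<in> C" for n using assms(3) by (simp add: nrm_bounded_def)
  show ?thesis
  proof (rule Lim_null_comparison)
    show "\<forall>\<^sub>F n in sequentially. norm (B (X n) (Y n)) \<le> nrm (X n) * K"
      using cauchy_schwarz assms(2) Y K(2) by (intro always_eventually allI)
        (smt (verit) mult_left_mono nrm_nonneg real_norm_def)
    show "(\<lambda>n. nrm (X n) * K) \<longlonglongrightarrow> 0"
      using tendsto_mult_right[OF assms(1), of K] by simp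
  qed
qed

text \<open>The Cauchy property replaces \<open>Z n\<close> by one fixed \<open>Z N\<close>, at a
  cost uniform in \<open>n\<close> because \<open>A\<close> is bounded. Hence it is enough to pair
  \<open>A\<close> with each fixed term.\<close>

lemma cauchy_pairing_null:
  assumes "cauchy Z" "nrm_bounded A" "\<And>N. (\<lambda>n. B (A n) (Z N)) \<longlonglongrightarrow> 0"
  shows "(\<lambda>n. B (A n) (Z n)) \<longlonglongrightarrow> 0"
proof (rule LIMSEQ_I)
  obtain K where K: "K > 0" "\<And>n. nrm (A n) \<le> K"
    using nrm_bounded_pos[OF assms(2)] by blast
  have A: "A n \<in> C" for n using assms(2) by (simp add: nrm_bounded_def)
  fix e :: real
  assume "e > 0"
  then have "e / (2 * K) > 0" using K by simp
  then obtain N where N: "\<And>m n. m \<ge> N \<Longrightarrow> n \<ge> N \<Longrightarrow> nrm (Z m - Z n) < e / (2 * K)"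
    using assms(1) unfolding cauchy_def by metis
  obtain M where M: "\<And>n. n \<ge> M \<Longrightarrow> \<bar>B (A n) (Z N)\<bar> < e / 2"
    using LIMSEQ_D[OF assms(3)[of N], of "e / 2"] \<open>e > 0\<close> by auto
  have "\<bar>B (A n) (Z n)\<bar> < e" if n: "n \<ge> max M N" for n
  proof -
    have "B (A n) (Z n) = B (A n) (Z n - Z N) + B (A n) (Z N)"
      using assms(1) A by (simp add: diff_right)
    moreover have "\<bar>B (A n) (Z n - Z N)\<bar> \<le> K * (e / (2 * K))"
      using cauchy_schwarz[of "A n" "Z n - Z N"] K(2)[of n] N[of n N] n assms(1) A
      by (smt (verit) C_diff cauchy_C max.bounded_iff mult_mono nrm_nonneg order_refl)
    ultimately show ?thesis using M[of n] n K by simp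
  qed
  then show "\<exists>no. \<forall>n\<ge>no. norm (B (A n) (Z n) - 0) < e"
    by (intro exI[of _ "max M N"]) auto
qed

text \<open>Completeness-free form of: a vector orthogonal to everything is null.\<close>

lemma cauchy_weakly_null:
  assumes "cauchy X" "\<And>N. (\<lambda>n. B (X n) (X N)) \<longlonglongrightarrow> 0"
  shows "(\<lambda>n. nrm (X n)) \<longlonglongrightarrow> 0"
proof -
  have "(\<lambda>n. q (X n)) \<longlonglongrightarrow> 0"
    unfolding q_def by (rule cauchy_pairing_null[OF assms(1) cauchy_bounded[OF assms(1)] assms(2)])
  then have "(\<lambda>n. sqrt (q (X n))) \<longlonglongrightarrow> sqrt 0" by (rule tendsto_real_sqrt)
  then show ?thesis by (simp add: nrm_def)
qed

section \<open>Squared distances and minimizing sequences\<close>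

definition d2 :: "'v \<Rightarrow> 'v set \<Rightarrow> real" where
  "d2 e M = (INF m\<in>M. q (e - m))"

lemma d2_le: "\<lbrakk>m \<in> M; M \<subseteq> C; e \<in> C\<rbrakk> \<Longrightarrow> d2 e M \<le> q (e - m)"
  unfolding d2_def by (intro cINF_lower bdd_belowI2[where m = 0]) (auto intro!: q_nonneg)

lemma d2_ge: "\<lbrakk>M \<noteq> {}; \<And>m. m \<in> M \<Longrightarrow> c \<le> q (e - m)\<rbrakk> \<Longrightarrow> c \<le> d2 e M"
  unfolding d2_def by (intro cINF_greatest) auto

lemma d2_nonneg: "\<lbrakk>M \<noteq> {}; M \<subseteq> C; e \<in> C\<rbrakk> \<Longrightarrow> 0 \<le> d2 e M"
  by (intro d2_ge q_nonneg) auto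

lemma d2_less_witness:
  assumes "M \<noteq> {}" "d2 e M < c"
  shows "\<exists>m\<in>M. q (e - m) < c"
  using d2_ge[OF assms(1), of c e] assms(2) by force

text \<open>Moving \<open>z\<close> along the line through \<open>m\<close> cannot bring it closer
  to \<open>e\<close> than the infimum, so a quadratic in \<open>s\<close> is nonnegative and its
  discriminant gives the bound. The defect \<open>q (e - z) - d2 e M\<close> measures how far
  \<open>e - z\<close> is from being orthogonal to \<open>M\<close>.\<close>

lemma near_minimizer_orthogonal:
  assumes "subspace M" "M \<subseteq> C" "e \<in> C" "z \<in> M" "m \<in> M"
  shows "(B (e - z) m)\<^sup>2 \<le> (q (e - z) - d2 e M) * q m"
proof (rule square_le_mult_if_quadratic_nonneg)
  fix s :: real
  have "z + s *\<^sub>R m \<in> M" using assms by (simp add: subspace_add subspace_scale)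
  then have "d2 e M \<le> q (e - (z + s *\<^sub>R m))" using assms by (intro d2_le) auto
  also have "e - (z + s *\<^sub>R m) = (e - z) - s *\<^sub>R m" by simp
  also have "q \<dots> = q (e - z) - 2 * s * B (e - z) m + s\<^sup>2 * q m"
    using assms by (subst q_diff) (auto simp: scale_right q_scale subset_iff)
  finally show "0 \<le> q (e - z) - d2 e M - 2 * s * B (e - z) m + s\<^sup>2 * q m" by simp
qed (use assms in auto)

text \<open>Plays the role of the orthogonal projection of \<open>e\<close> onto the closure of \<open>M\<close>.\<close>

definition proj_seq :: "'v \<Rightarrow> 'v set \<Rightarrow> (nat \<Rightarrow> 'v) \<Rightarrow> bool" where
  "proj_seq e M z \<longleftrightarrow> (\<forall>n. z n \<in> M) \<and> (\<lambda>n. q (e - z n)) \<longlonglongrightarrow> d2 e M"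

lemma proj_seq_exists:
  assumes "M \<noteq> {}" "M \<subseteq> C" "e \<in> C"
  shows "\<exists>z. proj_seq e M z"
proof -
  have "\<exists>m\<in>M. q (e - m) < d2 e M + 1 / real (Suc n)" for n
    by (intro d2_less_witness) (use assms in auto)
  then obtain z where z: "\<And>n. z n \<in> M" "\<And>n. q (e - z n) < d2 e M + 1 / real (Suc n)"
    by metis
  have "(\<lambda>n. q (e - z n)) \<longlonglongrightarrow> d2 e M"
  proof (rule tendsto_sandwich)
    show "\<forall>\<^sub>F n in sequentially. d2 e M \<le> q (e - z n)"
      using z(1) assms by (auto intro!: always_eventually d2_le)
    show "\<forall>\<^sub>F n in sequentially. q (e - z n) \<le> d2 e M + 1 / real (Suc n)"
      using z(2) by (auto intro!: always_eventually less_imp_le)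
    show "(\<lambda>n. d2 e M + 1 / real (Suc n)) \<longlonglongrightarrow> d2 e M"
      using tendsto_add[OF tendsto_const LIMSEQ_Suc[OF lim_1_over_n], of "d2 e M"] by simp
  qed simp
  then show ?thesis using z(1) by (auto simp: proj_seq_def)
qed

context
  fixes e M z
  assumes M: "subspace M" "M \<subseteq> C" and e: "e \<in> C" and z: "proj_seq e M z"
begin

lemma proj_seq_in_M: "z n \<in> M" using z by (simp add: proj_seq_def)

lemma proj_seq_in_C: "z n \<in> C" using proj_seq_in_M M by blast

lemma proj_seq_orthogonal:
  assumes "\<And>n. y n \<in> M" "nrm_bounded y"
  shows "(\<lambda>n. B (e - z n) (y n)) \<longlonglongrightarrow> 0"
proof -
  obtain K where K: "K > 0" "\<And>n. nrm (y n) \<le> K" using nrm_bounded_pos[OF assms(2)] by blast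
  have y: "y n \<in> C" for n using assms(1) M by blast
  have "(\<lambda>n. (B (e - z n) (y n))\<^sup>2) \<longlonglongrightarrow> 0"
  proof (rule Lim_null_comparison)
    show "\<forall>\<^sub>F n in sequentially. norm ((B (e - z n) (y n))\<^sup>2) \<le> (q (e - z n) - d2 e M) * K\<^sup>2"
    proof (intro always_eventually allI)
      fix n
      have "(B (e - z n) (y n))\<^sup>2 \<le> (q (e - z n) - d2 e M) * q (y n)"
        using M e proj_seq_in_M assms(1) by (intro near_minimizer_orthogonal) auto
      also have "\<dots> \<le> (q (e - z n) - d2 e M) * K\<^sup>2"
        using K y d2_le[OF proj_seq_in_M M(2) e, of n] by (intro mult_left_mono)
          (auto simp: nrm_sq[symmetric] intro!: power_mono)
      finally show "norm ((B (e - z n) (y n))\<^sup>2) \<le> (q (e - z n) - d2 e M) * K\<^sup>2" by simp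
    qed
    have "(\<lambda>n. (q (e - z n) - d2 e M) * K\<^sup>2) \<longlonglongrightarrow> (d2 e M - d2 e M) * K\<^sup>2"
      using z by (intro tendsto_intros) (simp add: proj_seq_def)
    then show "(\<lambda>n. (q (e - z n) - d2 e M) * K\<^sup>2) \<longlonglongrightarrow> 0" by simp
  qed
  then show ?thesis by (simp add: tendsto_power_zero[of _ _ 2] power_tendsto_0_iff)
qed

lemma proj_seq_cauchy: "cauchy z"
  unfolding cauchy_def
proof (intro conjI allI impI)
  fix \<epsilon> :: real
  assume "\<epsilon> > 0"
  define \<delta> where "\<delta> n = sqrt (q (e - z n) - d2 e M)" for n
  have nn: "0 \<le> q (e - z n) - d2 e M" for n using d2_le[OF proj_seq_in_M M(2) e] by simp
  have "\<delta> \<longlonglongrightarrow> sqrt (d2 e M - d2 e M)"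
    unfolding \<delta>_def using z by (intro tendsto_intros) (simp add: proj_seq_def)
  then have "\<delta> \<longlonglongrightarrow> 0" by simp
  then obtain N where N: "\<And>n. n \<ge> N \<Longrightarrow> \<bar>\<delta> n\<bar> < \<epsilon> / 2"
    using LIMSEQ_D[of \<delta> 0 "\<epsilon> / 2"] \<open>\<epsilon> > 0\<close> by auto
  have bd: "\<bar>B (e - z n) m\<bar> \<le> \<delta> n * nrm m" if "m \<in> M" for n m
    using real_sqrt_le_mono[OF near_minimizer_orthogonal[OF M e proj_seq_in_M that, of n]]
    by (simp add: \<delta>_def nrm_def real_sqrt_mult)
  have "nrm (z m - z n) < \<epsilon>" if "m \<ge> N" "n \<ge> N" for m n
  proof -
    let ?d = "z m - z n"
    have d: "?d \<in> M" "?d \<in> C" using proj_seq_in_M M by (auto simp: subspace_diff)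
    \<comment> \<open>\<open>?d\<close> lies in \<open>M\<close> and is the difference of the
      residuals \<open>e - z n\<close> and \<open>e - z m\<close>, both of which are nearly
      orthogonal to it.\<close>
    have "q ?d = B (e - z n) ?d - B (e - z m) ?d"
      using proj_seq_in_C e by (simp add: q_def bilinear)
    also have "\<dots> \<le> \<delta> n * nrm ?d + \<delta> m * nrm ?d"
      using bd[OF d(1), of n] bd[OF d(1), of m] by simp
    finally have "nrm ?d * nrm ?d \<le> (\<delta> n + \<delta> m) * nrm ?d"
      using d(2) nrm_sq[of ?d] by (simp add: power2_eq_square algebra_simps)
    then have "nrm ?d \<le> \<bar>\<delta> n\<bar> + \<bar>\<delta> m\<bar>"
      using nrm_nonneg[OF d(2)] by (cases "nrm ?d = 0") auto
    then show ?thesis using N[OF that(1)] N[OF that(2)] by simp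
  qed
  then show "\<exists>N. \<forall>m\<ge>N. \<forall>n\<ge>N. nrm (z m - z n) < \<epsilon>" by blast
qed (rule proj_seq_in_C)

text \<open>For the projection p of \<open>e\<close> these are the identities <p, e> = |p|^2 = |e|^2
  - dist^2. They come from the asymptotic orthogonality of \<open>e - z n\<close> and
  \<open>z n\<close>.\<close>

lemma proj_seq_B_e: "(\<lambda>n. B (z n) e) \<longlonglongrightarrow> q e - d2 e M"
  and proj_seq_q: "(\<lambda>n. q (z n)) \<longlonglongrightarrow> q e - d2 e M"
proof -
  have 1: "(\<lambda>n. B (e - z n) (z n)) \<longlonglongrightarrow> 0"
    by (rule proj_seq_orthogonal[OF proj_seq_in_M cauchy_bounded[OF proj_seq_cauchy]])
  have 2: "(\<lambda>n. q (e - z n)) \<longlonglongrightarrow> d2 e M" using z by (simp add: proj_seq_def)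
  have "(\<lambda>n. q e - q (e - z n) - B (e - z n) (z n)) \<longlonglongrightarrow> q e - d2 e M - 0"
    by (intro tendsto_intros 1 2)
  moreover have "q e - q (e - z n) - B (e - z n) (z n) = B (z n) e" for n
    using e proj_seq_in_C[of n] by (simp add: q_def bilinear sym[of e "z n"])
  ultimately show *: "(\<lambda>n. B (z n) e) \<longlonglongrightarrow> q e - d2 e M" by simp
  have "(\<lambda>n. B (z n) e - B (e - z n) (z n)) \<longlonglongrightarrow> q e - d2 e M - 0"
    by (intro tendsto_intros 1 *)
  moreover have "B (z n) e - B (e - z n) (z n) = q (z n)" for n
    using e proj_seq_in_C[of n] by (simp add: q_def bilinear sym[of e "z n"])
  ultimately show "(\<lambda>n. q (z n)) \<longlonglongrightarrow> q e - d2 e M" by simp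
qed

end

end

lemma scaleR_fun_apply [simp]: "(r *\<^sub>R f) x = r *\<^sub>R f x"
  by (simp add: scaleR_fun_def)

section \<open>Weighted powers\<close>

text \<open>Values outside \<open>I\<close> are unconstrained, and \<open>wip\<close> ignores them.
  The set is then a subspace of the function type, and one function such as \<open>unit i\<close> or
  \<open>cobd h\<close> serves for every index set.\<close>

definition tuples :: "'i set \<Rightarrow> 'v set \<Rightarrow> ('i \<Rightarrow> 'v) set" where
  "tuples I C = {f. \<forall>i\<in>I. f i \<in> C}"

definition wip :: "'i set \<Rightarrow> ('i \<Rightarrow> real) \<Rightarrow> ('v \<Rightarrow> 'v \<Rightarrow> real) \<Rightarrow> ('i \<Rightarrow> 'v) \<Rightarrow> ('i \<Rightarrow> 'v) \<Rightarrow> real" where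
  "wip I w B f h = (\<Sum>i\<in>I. w i * B (f i) (h i))"

context semi_inner
begin

lemma semi_inner_wip:
  fixes I :: "'i set" and w :: "'i \<Rightarrow> real"
  assumes "\<And>i. i \<in> I \<Longrightarrow> 0 \<le> w i"
  shows "semi_inner (tuples I C) (wip I w B)"
proof
  show "subspace (tuples I C)" by (auto simp: subspace_def tuples_def)
next
  fix x y z :: "'i \<Rightarrow> 'v"
  assume "x \<in> tuples I C" "y \<in> tuples I C" "z \<in> tuples I C"
  then show "wip I w B (x + y) z = wip I w B x z + wip I w B y z"
    by (simp add: wip_def tuples_def add_left algebra_simps flip: sum.distrib)
next
  fix x y :: "'i \<Rightarrow> 'v" and r :: real
  assume "x \<in> tuples I C" "y \<in> tuples I C"
  then show "wip I w B (r *\<^sub>R x) y = r * wip I w B x y"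
    by (simp add: wip_def tuples_def scale_left sum_distrib_left mult.left_commute)
next
  fix x y :: "'i \<Rightarrow> 'v"
  assume "x \<in> tuples I C" "y \<in> tuples I C"
  then show "wip I w B x y = wip I w B y x"
    unfolding wip_def tuples_def by (intro sum.cong refl) (simp add: sym)
next
  fix x :: "'i \<Rightarrow> 'v"
  assume "x \<in> tuples I C"
  then show "0 \<le> wip I w B x x"
    unfolding wip_def tuples_def by (intro sum_nonneg mult_nonneg_nonneg assms) (auto simp: nonneg)
qed

lemma q_wip: "semi_inner.q (wip I w B) f = (\<Sum>i\<in>I. w i * q (f i))"
  if "\<And>i. i \<in> I \<Longrightarrow> 0 \<le> w i"
  by (simp add: semi_inner.q_def[OF semi_inner_wip[OF that]] q_def wip_def)

context
  fixes I :: "'i set" and w :: "'i \<Rightarrow> real"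
  assumes I: "finite I" and w: "\<And>i. i \<in> I \<Longrightarrow> 0 < w i"
begin

interpretation W: semi_inner "tuples I C" "wip I w B"
  by (rule semi_inner_wip) (use w in \<open>simp add: less_imp_le\<close>)

lemma nrm_component_le:
  assumes "x \<in> tuples I C" "i \<in> I"
  shows "nrm (x i) \<le> 1 / sqrt (w i) * W.nrm x"
proof -
  have "w i * q (x i) \<le> (\<Sum>i\<in>I. w i * q (x i))"
    using assms w I by (intro member_le_sum) (auto simp: tuples_def less_imp_le)
  also have "\<dots> = W.q x" by (simp add: q_wip w less_imp_le)
  finally have "sqrt (w i * q (x i)) \<le> W.nrm x" by (simp add: W.nrm_def)
  then show ?thesis using w[OF assms(2)] by (simp add: real_sqrt_mult nrm_def field_simps)
qed

lemma cauchy_component: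
  assumes "W.cauchy X" "i \<in> I"
  shows "cauchy (\<lambda>n. X n i)"
  unfolding cauchy_def
proof
  have X: "X n \<in> tuples I C" for n using assms(1) by simp
  show "\<forall>n. X n i \<in> C" using X assms(2) by (simp add: tuples_def)
  show "\<forall>e>0. \<exists>N. \<forall>m\<ge>N. \<forall>n\<ge>N. nrm (X m i - X n i) < e"
  proof (rule W.cauchy_of_bound[OF assms(1)])
    show "nrm (X m i - X n i) \<le> 1 / sqrt (w i) * W.nrm (X m - X n)" for m n
      using nrm_component_le[of "X m - X n" i] X assms(2) W.C_diff by simp
  qed
qed

text \<open>Together with \<open>cauchy_component\<close> this shows that being Cauchy does not
  depend on the positive weights: a minimizing sequence for one choice of weights may be used with
  another.\<close>

lemma cauchy_tuples:
  assumes "\<And>i. i \<in> I \<Longrightarrow> cauchy (\<lambda>n. X n i)"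
  shows "W.cauchy X"
  unfolding W.cauchy_def
proof (intro conjI allI impI)
  show X: "X n \<in> tuples I C" for n using assms by (auto simp: tuples_def cauchy_def)
  fix e :: real
  assume "e > 0"
  \<comment> \<open>The summand 1 keeps \<open>K\<close> positive for empty \<open>I\<close> and
    makes the final estimate strict.\<close>
  define K where "K = (\<Sum>i\<in>I. w i) + 1"
  have "0 \<le> (\<Sum>i\<in>I. w i)" using w by (intro sum_nonneg less_imp_le)
  then have K: "K > 0" "(\<Sum>i\<in>I. w i) < K" by (auto simp: K_def)
  define d where "d = e / sqrt K"
  have "d > 0" using \<open>e > 0\<close> K by (simp add: d_def)
  then have "\<forall>i\<in>I. \<exists>N. \<forall>m\<ge>N. \<forall>n\<ge>N. nrm (X m i - X n i) < d"
    using assms unfolding cauchy_def by simp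
  then obtain N where N: "\<And>i m n. i \<in> I \<Longrightarrow> m \<ge> N i \<Longrightarrow> n \<ge> N i \<Longrightarrow> nrm (X m i - X n i) < d"
    by metis
  define N0 where "N0 = Max (insert 0 (N ` I))"
  have N0: "N i \<le> N0" if "i \<in> I" for i unfolding N0_def using I that by (intro Max_ge) auto
  have "W.nrm (X m - X n) < e" if "m \<ge> N0" "n \<ge> N0" for m n
  proof -
    have "W.q (X m - X n) = (\<Sum>i\<in>I. w i * q (X m i - X n i))" by (simp add: q_wip w less_imp_le)
    also have "\<dots> \<le> (\<Sum>i\<in>I. w i * d\<^sup>2)"
    proof (intro sum_mono mult_left_mono less_imp_le[OF w])
      fix i assume i: "i \<in> I"
      have C: "X m i - X n i \<in> C" using X i by (simp add: tuples_def)
      have "nrm (X m i - X n i) < d" using N[OF i] N0[OF i] that by simp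
      then show "q (X m i - X n i) \<le> d\<^sup>2"
        using C by (simp add: nrm_sq[symmetric] power_mono)
    qed
    also have "\<dots> < K * d\<^sup>2" using K \<open>d > 0\<close> by (simp flip: sum_distrib_right)
    also have "\<dots> = e\<^sup>2" using K by (simp add: d_def power_divide)
    finally show ?thesis
      unfolding W.nrm_def using \<open>e > 0\<close> by (simp add: real_less_lsqrt)
  qed
  then show "\<exists>N. \<forall>m\<ge>N. \<forall>n\<ge>N. W.nrm (X m - X n) < e" by blast
qed

end

end

section \<open>The group ring with the inner product of a character\<close>

locale char_group = group G for G :: "('a, 'b) monoid_scheme" (structure) +
  fixes \<psi> :: "'a \<Rightarrow> complex"
  assumes char: "character G \<psi>"
begin

definition CG :: "('a \<Rightarrow> complex) set" where "CG = carrier (group_ring G \<psi>)"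

abbreviation cip :: "('a \<Rightarrow> complex) \<Rightarrow> ('a \<Rightarrow> complex) \<Rightarrow> complex" where
  "cip \<equiv> ip (group_ring G \<psi>)"

abbreviation supp :: "('a \<Rightarrow> complex) \<Rightarrow> 'a set" where "supp f \<equiv> {g. f g \<noteq> 0}"

definition csc :: "complex \<Rightarrow> ('a \<Rightarrow> complex) \<Rightarrow> 'a \<Rightarrow> complex" where
  "csc c f = (\<lambda>x. c * f x)"

lemma CG_iff: "f \<in> CG \<longleftrightarrow> finite (supp f) \<and> supp f \<subseteq> carrier G"
  by (simp add: CG_def group_ring_def)

lemma CG_outside: "f \<in> CG \<Longrightarrow> x \<notin> carrier G \<Longrightarrow> f x = 0"
  by (auto simp: CG_iff)

lemma subspace_CG: "subspace CG"
  unfolding subspace_def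
proof (intro conjI ballI allI)
  fix x y :: "'a \<Rightarrow> complex"
  assume x: "x \<in> CG" and y: "y \<in> CG"
  have "supp (x + y) \<subseteq> supp x \<union> supp y" by auto
  then show "x + y \<in> CG"
    using x y unfolding CG_iff by (meson finite_UnI finite_subset le_sup_iff subset_trans)
  show "r *\<^sub>R x \<in> CG" for r
    using x unfolding CG_iff by (auto elim: rev_finite_subset)
qed (simp add: CG_iff)

lemma CG_csc [simp]: "f \<in> CG \<Longrightarrow> csc c f \<in> CG"
  unfolding CG_iff csc_def by (auto elim: rev_finite_subset)

lemma CG_basis [simp]: "g \<in> carrier G \<Longrightarrow> gr_basis g \<in> CG"
  unfolding CG_iff gr_basis_def by auto

text \<open>The form is defined by sums over supports, which change under addition; a common finite
  superset makes such sums comparable.\<close>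

lemma cip_eq_sum:
  assumes "finite A" "supp f \<subseteq> A" "finite A'" "supp h \<subseteq> A'"
  shows "cip f h = (\<Sum>g\<in>A. \<Sum>k\<in>A'. f g * cnj (h k) * \<psi> (inv k \<otimes> g))"
proof -
  have "cip f h = (\<Sum>g\<in>supp f. \<Sum>k\<in>supp h. f g * cnj (h k) * \<psi> (inv k \<otimes> g))"
    by (simp add: group_ring_def)
  also have "\<dots> = (\<Sum>g\<in>supp f. \<Sum>k\<in>A'. f g * cnj (h k) * \<psi> (inv k \<otimes> g))"
    using assms by (intro sum.cong refl sum.mono_neutral_left) auto
  also have "\<dots> = (\<Sum>g\<in>A. \<Sum>k\<in>A'. f g * cnj (h k) * \<psi> (inv k \<otimes> g))"
    using assms by (intro sum.mono_neutral_left) auto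
  finally show ?thesis .
qed

lemma cip_add_left:
  assumes "x \<in> CG" "y \<in> CG" "z \<in> CG"
  shows "cip (x + y) z = cip x z + cip y z"
proof -
  let ?A = "supp x \<union> supp y"
  have A: "finite ?A" "finite (supp z)" using assms by (auto simp: CG_iff)
  have "cip (x + y) z = (\<Sum>g\<in>?A. \<Sum>k\<in>supp z. (x + y) g * cnj (z k) * \<psi> (inv k \<otimes> g))"
    by (rule cip_eq_sum[OF A(1) _ A(2)]) auto
  moreover have "cip x z = (\<Sum>g\<in>?A. \<Sum>k\<in>supp z. x g * cnj (z k) * \<psi> (inv k \<otimes> g))"
    by (rule cip_eq_sum[OF A(1) _ A(2)]) auto
  moreover have "cip y z = (\<Sum>g\<in>?A. \<Sum>k\<in>supp z. y g * cnj (z k) * \<psi> (inv k \<otimes> g))"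
    by (rule cip_eq_sum[OF A(1) _ A(2)]) auto
  ultimately show ?thesis by (simp add: algebra_simps sum.distrib)
qed

lemma cip_csc_left:
  assumes "x \<in> CG" "y \<in> CG"
  shows "cip (csc c x) y = c * cip x y"
proof -
  have A: "finite (supp x)" "finite (supp y)" using assms by (auto simp: CG_iff)
  have "cip (csc c x) y = (\<Sum>g\<in>supp x. \<Sum>k\<in>supp y. csc c x g * cnj (y k) * \<psi> (inv k \<otimes> g))"
    by (rule cip_eq_sum[OF A(1) _ A(2)]) (auto simp: csc_def)
  then show ?thesis by (simp add: group_ring_def csc_def sum_distrib_left algebra_simps)
qed

lemma psi_one: "\<psi> \<one> = 1"
  and psi_conj: "g \<in> carrier G \<Longrightarrow> h \<in> carrier G \<Longrightarrow> \<psi> (h \<otimes> g \<otimes> inv h) = \<psi> g"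
  using char by (auto simp: character_def)

lemma psi_positive:
  fixes n :: nat
  assumes "\<And>i. i < n \<Longrightarrow> g i \<in> carrier G"
  shows "(\<Sum>i<n. \<Sum>j<n. c i * cnj (c j) * \<psi> (inv (g j) \<otimes> g i)) \<in> \<real>\<^sub>\<ge>\<^sub>0"
  using char assms unfolding character_def by blast

text \<open>Positivity for the family \<open>\<one>, x\<close> with coefficients \<open>1, z\<close>
  forces the expression in \<open>*\<close> to be real for every \<open>z\<close>. The values
  \<open>1\<close> and \<open>\<i>\<close> of \<open>z\<close> settle imaginary and real
  part.\<close>

lemma psi_inv:
  assumes "x \<in> carrier G"
  shows "\<psi> (inv x) = cnj (\<psi> x)"
proof -
  have *: "1 + cnj z * \<psi> (inv x) + z * \<psi> x + z * cnj z \<in> \<real>\<^sub>\<ge>\<^sub>0" for z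
    using psi_positive[of 2 "\<lambda>i::nat. if i = 0 then \<one> else x" "\<lambda>i. if i = 0 then 1 else z"] assms
    by (simp add: numeral_2_eq_2 psi_one algebra_simps)
  have "Im (\<psi> (inv x)) + Im (\<psi> x) = 0"
    using *[of 1] by (simp add: complex_nonneg_Reals_iff)
  moreover have "Re (\<psi> x) - Re (\<psi> (inv x)) = 0"
    using *[of \<i>] by (simp add: complex_nonneg_Reals_iff)
  ultimately show ?thesis by (simp add: complex_eq_iff)
qed

lemma psi_inv_mult:
  assumes "g \<in> carrier G" "k \<in> carrier G"
  shows "\<psi> (inv g \<otimes> k) = cnj (\<psi> (inv k \<otimes> g))"
  using psi_inv[of "inv k \<otimes> g"] assms by (simp add: inv_mult_group)

lemma cip_sym:
  assumes "x \<in> CG" "y \<in> CG"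
  shows "cip y x = cnj (cip x y)"
proof -
  have A: "finite (supp x)" "supp x \<subseteq> carrier G" "finite (supp y)" "supp y \<subseteq> carrier G"
    using assms by (auto simp: CG_iff)
  have "cip y x = (\<Sum>g\<in>supp y. \<Sum>k\<in>supp x. y g * cnj (x k) * \<psi> (inv k \<otimes> g))"
    by (simp add: group_ring_def)
  also have "\<dots> = (\<Sum>k\<in>supp x. \<Sum>g\<in>supp y. y g * cnj (x k) * \<psi> (inv k \<otimes> g))"
    by (rule sum.swap)
  also have "\<dots> = (\<Sum>k\<in>supp x. \<Sum>g\<in>supp y. cnj (x k * cnj (y g) * \<psi> (inv g \<otimes> k)))"
  proof (intro sum.cong refl)
    fix k g assume "k \<in> supp x" "g \<in> supp y"
    then have "\<psi> (inv g \<otimes> k) = cnj (\<psi> (inv k \<otimes> g))" using A by (intro psi_inv_mult) auto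
    then show "y g * cnj (x k) * \<psi> (inv k \<otimes> g) = cnj (x k * cnj (y g) * \<psi> (inv g \<otimes> k))" by simp
  qed
  also have "\<dots> = cnj (cip x y)"
    by (simp add: group_ring_def)
  finally show ?thesis .
qed

lemma cip_positive:
  assumes "x \<in> CG"
  shows "cip x x \<in> \<real>\<^sub>\<ge>\<^sub>0"
proof -
  have A: "finite (supp x)" "supp x \<subseteq> carrier G" using assms by (auto simp: CG_iff)
  obtain g where g: "bij_betw g {..<card (supp x)} (supp x)"
    using ex_bij_betw_nat_finite[OF A(1)] by (auto simp: atLeast0LessThan)
  have "cip x x = (\<Sum>u\<in>supp x. \<Sum>v\<in>supp x. x u * cnj (x v) * \<psi> (inv v \<otimes> u))"
    by (simp add: group_ring_def)
  also have "\<dots> = (\<Sum>i<card (supp x). \<Sum>j<card (supp x). x (g i) * cnj (x (g j)) * \<psi> (inv (g j) \<otimes> g i))"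
    by (simp add: sum.reindex_bij_betw[OF g, symmetric])
  also have "\<dots> \<in> \<real>\<^sub>\<ge>\<^sub>0"
    using g A by (intro psi_positive) (auto simp: bij_betw_def)
  finally show ?thesis .
qed

definition rip :: "('a \<Rightarrow> complex) \<Rightarrow> ('a \<Rightarrow> complex) \<Rightarrow> real" where
  "rip f h = Re (cip f h)"

lemma scaleR_eq_csc: "r *\<^sub>R x = csc (of_real r) x"
  by (simp add: fun_eq_iff csc_def scaleR_conv_of_real)

sublocale R: semi_inner CG rip
proof
  show "rip (r *\<^sub>R x) y = r * rip x y" if "x \<in> CG" "y \<in> CG" for r x y
    using that by (simp add: rip_def scaleR_eq_csc cip_csc_left)
  show "rip x y = rip y x" if "x \<in> CG" "y \<in> CG" for x y
    using cip_sym[OF that] by (simp add: rip_def)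
  show "0 \<le> rip x x" if "x \<in> CG" for x
    using cip_positive[OF that] by (simp add: rip_def complex_nonneg_Reals_iff)
qed (simp_all add: subspace_CG rip_def cip_add_left)

lemma cip_csc_right:
  assumes "x \<in> CG" "y \<in> CG"
  shows "cip x (csc c y) = cnj c * cip x y"
  using cip_sym[of "csc c y" x] cip_sym[of y x] assms by (simp add: cip_csc_left)

text \<open>Recovers the complex form from the real one, so that limits of \<open>cip\<close> reduce
  to limits of \<open>rip\<close>.\<close>

lemma Im_cip: "x \<in> CG \<Longrightarrow> y \<in> CG \<Longrightarrow> Im (cip x y) = rip x (csc \<i> y)"
  by (simp add: rip_def cip_csc_right)

lemma rip_csc_left: "x \<in> CG \<Longrightarrow> y \<in> CG \<Longrightarrow> rip (csc c x) y = rip x (csc (cnj c) y)"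
  by (simp add: rip_def cip_csc_right cip_csc_left)

lemma q_csc:
  assumes "x \<in> CG"
  shows "R.q (csc c x) = (cmod c)\<^sup>2 * R.q x"
proof -
  have *: "(cmod c)\<^sup>2 = Re c * Re c + Im c * Im c" by (simp add: cmod_power2) (simp add: power2_eq_square)
  show ?thesis
    unfolding * using assms
    by (simp add: R.q_def rip_def cip_csc_left cip_csc_right algebra_simps)
qed

lemma q_basis_one: "R.q (gr_basis \<one>) = 1"
  by (simp add: R.q_def rip_def group_ring_ip_basis psi_one)

text \<open>Reduces testing against \<open>x\<close> to testing against scalar multiples of group
  elements, for which translations are available.\<close>

lemma csc_basis_expansion:
  assumes "x \<in> CG" "y \<in> CG"
  shows "rip y x = (\<Sum>k\<in>supp x. rip y (csc (x k) (gr_basis k)))"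
proof -
  have "cip y x = (\<Sum>k\<in>supp x. \<Sum>g\<in>supp y. y g * cnj (x k) * \<psi> (inv k \<otimes> g))"
    unfolding group_ring_def ips.simps by (rule sum.swap)
  also have "\<dots> = (\<Sum>k\<in>supp x. cip y (csc (x k) (gr_basis k)))"
  proof (rule sum.cong[OF refl])
    fix k assume "k \<in> supp x"
    then have "supp (csc (x k) (gr_basis k)) = {k}" by (auto simp: csc_def gr_basis_def)
    then show "(\<Sum>g\<in>supp y. y g * cnj (x k) * \<psi> (inv k \<otimes> g)) = cip y (csc (x k) (gr_basis k))"
      by (simp add: group_ring_def) (simp add: csc_def gr_basis_def)
  qed
  finally show ?thesis by (simp add: rip_def)
qed

section \<open>Translations and the involution of the group ring\<close>

definition permute :: "('a \<Rightarrow> 'a) \<Rightarrow> ('a \<Rightarrow> complex) \<Rightarrow> 'a \<Rightarrow> complex" where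
  "permute \<pi> f = (\<lambda>x. if x \<in> carrier G then f (\<pi> x) else 0)"

definition star :: "('a \<Rightarrow> complex) \<Rightarrow> 'a \<Rightarrow> complex" where
  "star f = (\<lambda>x. if x \<in> carrier G then cnj (f (inv x)) else 0)"

definition lt :: "'a \<Rightarrow> ('a \<Rightarrow> complex) \<Rightarrow> 'a \<Rightarrow> complex" where
  "lt g = permute (\<lambda>x. inv g \<otimes> x)"

definition rt :: "'a \<Rightarrow> ('a \<Rightarrow> complex) \<Rightarrow> 'a \<Rightarrow> complex" where
  "rt s = permute (\<lambda>x. x \<otimes> inv s)"

lemma permute_supp:
  assumes "bij_betw \<pi> (carrier G) (carrier G)" "f \<in> CG"
  shows "bij_betw \<pi> (supp (permute \<pi> f)) (supp f)"
proof (rule bij_betw_imageI)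
  show "inj_on \<pi> (supp (permute \<pi> f))"
    using assms(1) by (auto simp: permute_def bij_betw_def inj_on_def split: if_splits)
  show "\<pi> ` supp (permute \<pi> f) = supp f"
  proof
    show "supp f \<subseteq> \<pi> ` supp (permute \<pi> f)"
    proof
      fix y assume y: "y \<in> supp f"
      then have "y \<in> carrier G" using assms(2) by (auto simp: CG_iff)
      then obtain x where "x \<in> carrier G" "y = \<pi> x" using assms(1) by (auto simp: bij_betw_def)
      then show "y \<in> \<pi> ` supp (permute \<pi> f)" using y by (auto simp: permute_def)
    qed
  next
    show "\<pi> ` supp (permute \<pi> f) \<subseteq> supp f"
      by (rule image_subsetI) (simp add: permute_def split: if_splits)
  qed
qed

lemma permute_CG:
  assumes "bij_betw \<pi> (carrier G) (carrier G)" "f \<in> CG"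
  shows "permute \<pi> f \<in> CG"
  using bij_betw_finite[OF permute_supp[OF assms]] assms(2)
  by (auto simp: CG_iff) (auto simp: permute_def split: if_splits)

text \<open>Left and right translations are both substitutions along a bijection of the group; the
  last hypothesis isolates what has to be checked for \<open>\<psi>\<close> in each case.\<close>

lemma cip_permute:
  assumes "bij_betw \<pi> (carrier G) (carrier G)" "f \<in> CG" "h \<in> CG"
    and "\<And>g k. g \<in> carrier G \<Longrightarrow> k \<in> carrier G \<Longrightarrow> \<psi> (inv k \<otimes> g) = \<psi> (inv (\<pi> k) \<otimes> \<pi> g)"
  shows "cip (permute \<pi> f) (permute \<pi> h) = cip f h"
proof -
  note f = permute_supp[OF assms(1,2)] and h = permute_supp[OF assms(1,3)]
  have "cip (permute \<pi> f) (permute \<pi> h) =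
      (\<Sum>g\<in>supp (permute \<pi> f). \<Sum>k\<in>supp (permute \<pi> h). f (\<pi> g) * cnj (h (\<pi> k)) * \<psi> (inv (\<pi> k) \<otimes> \<pi> g))"
    unfolding group_ring_def using assms(4)
    by (simp, intro sum.cong refl) (auto simp: permute_def split: if_splits)
  also have "\<dots> = (\<Sum>g\<in>supp (permute \<pi> f). \<Sum>k\<in>supp h. f (\<pi> g) * cnj (h k) * \<psi> (inv k \<otimes> \<pi> g))"
    by (simp only: sum.reindex_bij_betw[OF h, of "\<lambda>k. f (\<pi> g) * cnj (h k) * \<psi> (inv k \<otimes> \<pi> g)" for g])
  also have "\<dots> = (\<Sum>g\<in>supp f. \<Sum>k\<in>supp h. f g * cnj (h k) * \<psi> (inv k \<otimes> g))"
    by (rule sum.reindex_bij_betw[OF f])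
  also have "\<dots> = cip f h" by (simp add: group_ring_def)
  finally show ?thesis .
qed

lemma bij_left: "g \<in> carrier G \<Longrightarrow> bij_betw (\<lambda>x. inv g \<otimes> x) (carrier G) (carrier G)"
  by (rule bij_betw_byWitness[where f' = "\<lambda>x. g \<otimes> x"]) (auto simp flip: m_assoc)

lemma bij_right: "g \<in> carrier G \<Longrightarrow> bij_betw (\<lambda>x. x \<otimes> inv g) (carrier G) (carrier G)"
  by (rule bij_betw_byWitness[where f' = "\<lambda>x. x \<otimes> g"]) (auto simp: m_assoc)

lemma inv_mult_cancel_left:
  "g \<in> carrier G \<Longrightarrow> x \<in> carrier G \<Longrightarrow> g \<otimes> (inv g \<otimes> x) = x"
  "g \<in> carrier G \<Longrightarrow> x \<in> carrier G \<Longrightarrow> inv g \<otimes> (g \<otimes> x) = x"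
  by (simp_all flip: m_assoc)

lemma inv_mult_eq_iff:
  assumes "g \<in> carrier G" "x \<in> carrier G" "h \<in> carrier G"
  shows "inv g \<otimes> x = h \<longleftrightarrow> x = g \<otimes> h" "x \<otimes> inv g = h \<longleftrightarrow> x = h \<otimes> g"
  using inv_solve_left[of h g x] inv_solve_right[of h x g] assms by auto

lemma lt_CG [simp]: "g \<in> carrier G \<Longrightarrow> f \<in> CG \<Longrightarrow> lt g f \<in> CG"
  unfolding lt_def by (rule permute_CG[OF bij_left])

lemma rt_CG [simp]: "g \<in> carrier G \<Longrightarrow> f \<in> CG \<Longrightarrow> rt g f \<in> CG"
  unfolding rt_def by (rule permute_CG[OF bij_right])

lemma cip_lt: "g \<in> carrier G \<Longrightarrow> x \<in> CG \<Longrightarrow> y \<in> CG \<Longrightarrow> cip (lt g x) (lt g y) = cip x y"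
  unfolding lt_def
proof (rule cip_permute[OF bij_left])
  fix u k assume "g \<in> carrier G" "u \<in> carrier G" "k \<in> carrier G"
  then show "\<psi> (inv k \<otimes> u) = \<psi> (inv (inv g \<otimes> k) \<otimes> (inv g \<otimes> u))"
    by (simp add: inv_mult_group m_assoc inv_mult_cancel_left)
qed auto

text \<open>Here the invariance of \<open>\<psi>\<close> under conjugation enters: translating both
  arguments by \<open>inv g\<close> from the right conjugates \<open>inv k \<otimes> u\<close> by
  \<open>g\<close>.\<close>

lemma cip_rt: "g \<in> carrier G \<Longrightarrow> x \<in> CG \<Longrightarrow> y \<in> CG \<Longrightarrow> cip (rt g x) (rt g y) = cip x y"
  unfolding rt_def
proof (rule cip_permute[OF bij_right])
  fix u k assume *: "g \<in> carrier G" "u \<in> carrier G" "k \<in> carrier G"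
  then have "\<psi> (g \<otimes> (inv k \<otimes> u) \<otimes> inv g) = \<psi> (inv k \<otimes> u)" by (intro psi_conj) auto
  moreover have "inv (k \<otimes> inv g) \<otimes> (u \<otimes> inv g) = g \<otimes> (inv k \<otimes> u) \<otimes> inv g"
    using * by (simp add: inv_mult_group m_assoc)
  ultimately show "\<psi> (inv k \<otimes> u) = \<psi> (inv (k \<otimes> inv g) \<otimes> (u \<otimes> inv g))" by simp
qed auto

lemma lt_lt: "g \<in> carrier G \<Longrightarrow> h \<in> carrier G \<Longrightarrow> lt g (lt h f) = lt (g \<otimes> h) f"
  by (auto simp: lt_def permute_def fun_eq_iff inv_mult_group m_assoc)

lemma rt_rt: "g \<in> carrier G \<Longrightarrow> h \<in> carrier G \<Longrightarrow> rt g (rt h f) = rt (h \<otimes> g) f"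
  by (auto simp: rt_def permute_def fun_eq_iff inv_mult_group m_assoc)

lemma lt_one [simp]: "f \<in> CG \<Longrightarrow> lt \<one> f = f"
  by (auto simp: lt_def permute_def fun_eq_iff CG_outside)

lemma rt_one [simp]: "f \<in> CG \<Longrightarrow> rt \<one> f = f"
  by (auto simp: rt_def permute_def fun_eq_iff CG_outside)

lemma lt_rt: "g \<in> carrier G \<Longrightarrow> s \<in> carrier G \<Longrightarrow> lt g (rt s f) = rt s (lt g f)"
  by (auto simp: lt_def rt_def permute_def fun_eq_iff m_assoc)

lemma rip_lt: "g \<in> carrier G \<Longrightarrow> x \<in> CG \<Longrightarrow> y \<in> CG \<Longrightarrow> rip (lt g x) y = rip x (lt (inv g) y)"
  using cip_lt[of "inv g" "lt g x" y] by (simp add: rip_def lt_lt)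

lemma rip_rt: "g \<in> carrier G \<Longrightarrow> x \<in> CG \<Longrightarrow> y \<in> CG \<Longrightarrow> rip (rt g x) y = rip x (rt (inv g) y)"
  using cip_rt[of "inv g" "rt g x" y] by (simp add: rip_def rt_rt)

lemma q_lt: "g \<in> carrier G \<Longrightarrow> x \<in> CG \<Longrightarrow> R.q (lt g x) = R.q x"
  by (simp add: R.q_def rip_def cip_lt)

lemma q_rt: "g \<in> carrier G \<Longrightarrow> x \<in> CG \<Longrightarrow> R.q (rt g x) = R.q x"
  by (simp add: R.q_def rip_def cip_rt)

lemma lt_basis: "g \<in> carrier G \<Longrightarrow> h \<in> carrier G \<Longrightarrow> lt g (gr_basis h) = gr_basis (g \<otimes> h)"
  by (auto simp: lt_def permute_def gr_basis_def fun_eq_iff inv_mult_eq_iff)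

lemma rt_basis: "g \<in> carrier G \<Longrightarrow> h \<in> carrier G \<Longrightarrow> rt g (gr_basis h) = gr_basis (h \<otimes> g)"
  by (auto simp: rt_def permute_def gr_basis_def fun_eq_iff inv_mult_eq_iff)

lemma permute_linear:
  "permute \<pi> (x + y) = permute \<pi> x + permute \<pi> y"
  "permute \<pi> (x - y) = permute \<pi> x - permute \<pi> y"
  "permute \<pi> (r *\<^sub>R x) = r *\<^sub>R permute \<pi> x"
  "permute \<pi> (csc c x) = csc c (permute \<pi> x)"
  "permute \<pi> 0 = 0"
  by (auto simp: permute_def csc_def fun_eq_iff)

lemmas lt_linear = permute_linear[of "\<lambda>x. inv g \<otimes> x" for g, folded lt_def]
lemmas rt_linear = permute_linear[of "\<lambda>x. x \<otimes> inv s" for s, folded rt_def]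

lemma csc_linear:
  "csc c (x + y) = csc c x + csc c y"
  "csc c (x - y) = csc c x - csc c y"
  "csc c (r *\<^sub>R x) = r *\<^sub>R csc c x"
  "csc c 0 = 0"
  by (auto simp: csc_def fun_eq_iff algebra_simps)

lemma star_eq: "star f = (\<lambda>x. cnj (permute (\<lambda>x. inv x) f x))"
  by (auto simp: star_def permute_def fun_eq_iff)

lemma bij_inv: "bij_betw (\<lambda>x. inv x) (carrier G) (carrier G)"
  by (rule bij_betw_byWitness[where f' = "\<lambda>x. inv x"]) auto

lemma star_CG [simp]: "f \<in> CG \<Longrightarrow> star f \<in> CG"
  using permute_CG[OF bij_inv, of f] by (simp add: star_eq CG_iff)

lemma star_linear:
  "star (x + y) = star x + star y"
  "star (x - y) = star x - star y"
  "star (r *\<^sub>R x) = r *\<^sub>R star x"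
  by (auto simp: star_def fun_eq_iff)

text \<open>Conjugation invariance again: \<open>inv k \<otimes> g\<close> is conjugate to
  \<open>g \<otimes> inv k\<close>. Read as <f, h> = <h*, f*>, this is the trace property.\<close>

lemma cip_star:
  assumes "f \<in> CG" "h \<in> CG"
  shows "cip (star f) (star h) = cnj (cip f h)"
proof -
  let ?\<pi> = "\<lambda>x. inv x"
  note f = permute_supp[OF bij_inv assms(1)] and h = permute_supp[OF bij_inv assms(2)]
  have conj: "\<psi> (inv k \<otimes> g) = cnj (\<psi> (inv (inv k) \<otimes> inv g))" if "g \<in> carrier G" "k \<in> carrier G" for g k
  proof -
    have "\<psi> (inv k \<otimes> g) = \<psi> (k \<otimes> (inv k \<otimes> g) \<otimes> inv k)" using psi_conj[of "inv k \<otimes> g" k] that by simp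
    also have "k \<otimes> (inv k \<otimes> g) \<otimes> inv k = g \<otimes> inv k" using that by (simp add: m_assoc[symmetric])
    also have "\<psi> \<dots> = cnj (\<psi> (inv (g \<otimes> inv k)))" using psi_inv[of "g \<otimes> inv k"] that by simp
    finally show ?thesis using that by (simp add: inv_mult_group)
  qed
  have supp: "supp (star u) = supp (permute ?\<pi> u)" for u by (simp add: star_eq)
  have "cip (star f) (star h) =
      (\<Sum>g\<in>supp (permute ?\<pi> f). \<Sum>k\<in>supp (permute ?\<pi> h). cnj (f (?\<pi> g) * cnj (h (?\<pi> k)) * \<psi> (inv (?\<pi> k) \<otimes> ?\<pi> g)))"
    unfolding group_ring_def supp ips.simps
  proof (intro sum.cong refl)
    fix g k assume "g \<in> supp (permute ?\<pi> f)" "k \<in> supp (permute ?\<pi> h)"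
    then have "g \<in> carrier G" "k \<in> carrier G" by (auto simp: permute_def split: if_splits)
    then show "star f g * cnj (star h k) * \<psi> (inv k \<otimes> g) = cnj (f (?\<pi> g) * cnj (h (?\<pi> k)) * \<psi> (inv (?\<pi> k) \<otimes> ?\<pi> g))"
      using conj[of g k] by (simp add: star_def)
  qed
  also have "\<dots> = (\<Sum>g\<in>supp (permute ?\<pi> f). \<Sum>k\<in>supp h. cnj (f (?\<pi> g) * cnj (h k) * \<psi> (inv k \<otimes> ?\<pi> g)))"
    by (simp only: sum.reindex_bij_betw[OF h, of "\<lambda>k. cnj (f (?\<pi> g) * cnj (h k) * \<psi> (inv k \<otimes> ?\<pi> g))" for g])
  also have "\<dots> = (\<Sum>g\<in>supp f. \<Sum>k\<in>supp h. cnj (f g * cnj (h k) * \<psi> (inv k \<otimes> g)))"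
    by (rule sum.reindex_bij_betw[OF f])
  also have "\<dots> = cnj (cip f h)" by (simp add: group_ring_def)
  finally show ?thesis .
qed

lemma rip_star: "f \<in> CG \<Longrightarrow> h \<in> CG \<Longrightarrow> rip (star f) (star h) = rip f h"
  by (simp add: rip_def cip_star)

lemma q_star: "f \<in> CG \<Longrightarrow> R.q (star f) = R.q f"
  by (simp add: R.q_def rip_star)

lemma nrm_star: "f \<in> CG \<Longrightarrow> R.nrm (star f) = R.nrm f"
  by (simp add: R.nrm_def q_star)

lemma star_csc_basis: "g \<in> carrier G \<Longrightarrow> star (csc c (gr_basis g)) = csc (cnj c) (gr_basis (inv g))"
  by (auto simp: star_def csc_def gr_basis_def fun_eq_iff)

text \<open>Testing \<open>star x\<close> against a group element becomes pairing a left translate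
  of \<open>x\<close> with the unit. In this form the involution meets the left action on invariant
  subspaces.\<close>

lemma rip_star_basis:
  assumes "x \<in> CG" "g \<in> carrier G"
  shows "rip (star x) (csc c (gr_basis g)) = rip (gr_basis \<one>) (csc c (lt g x))"
proof -
  have "rip (star x) (csc c (gr_basis g)) = rip (star x) (star (csc (cnj c) (gr_basis (inv g))))"
    using assms by (simp add: star_csc_basis)
  also have "\<dots> = rip x (csc (cnj c) (gr_basis (inv g)))" using assms by (intro rip_star) auto
  also have "\<dots> = rip (csc c x) (lt (inv g) (gr_basis \<one>))"
    using assms by (simp add: rip_csc_left lt_basis)
  also have "\<dots> = rip (csc c (lt g x)) (gr_basis \<one>)"
    using assms rip_lt[of g "csc c x" "gr_basis \<one>"] by (simp add: lt_linear)
  finally show ?thesis using assms by (simp add: R.sym)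
qed

end

section \<open>Weighted dimensions of invariant subspaces\<close>

context char_group
begin

definition act :: "complex \<Rightarrow> 'a \<Rightarrow> ('i \<Rightarrow> 'a \<Rightarrow> complex) \<Rightarrow> 'i \<Rightarrow> 'a \<Rightarrow> complex" where
  "act c g x = (\<lambda>i. csc c (lt g (x i)))"

text \<open>\<open>subspace\<close> only provides real scalars; the scalar \<open>c\<close> in
  \<open>act\<close> makes the subspace complex.\<close>

definition invariant_subspace :: "'i set \<Rightarrow> ('i \<Rightarrow> 'a \<Rightarrow> complex) set \<Rightarrow> bool" where
  "invariant_subspace I M \<longleftrightarrow> subspace M \<and> M \<subseteq> tuples I CG \<and>
     (\<forall>m\<in>M. \<forall>c. \<forall>g\<in>carrier G. act c g m \<in> M)"

definition unit :: "'i \<Rightarrow> 'i \<Rightarrow> 'a \<Rightarrow> complex" where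
  "unit i = (\<lambda>j. if j = i then gr_basis \<one> else 0)"

lemma unit_tuples [simp]: "unit i \<in> tuples I CG"
  by (simp add: unit_def tuples_def)

lemma act_tuples [simp]: "g \<in> carrier G \<Longrightarrow> x \<in> tuples I CG \<Longrightarrow> act c g x \<in> tuples I CG"
  by (simp add: act_def tuples_def)

lemma act_diff: "act c g (x - y) = act c g x - act c g y"
  by (simp add: act_def lt_linear csc_linear fun_eq_iff)

lemma wip_act:
  assumes "g \<in> carrier G" "x \<in> tuples I CG" "y \<in> tuples I CG"
  shows "wip I w rip (act c g x) y = wip I w rip x (act (cnj c) (inv g) y)"
  unfolding wip_def act_def
proof (intro sum.cong refl arg_cong2[where f = "(*)"])
  fix i assume "i \<in> I"
  then have "x i \<in> CG" "y i \<in> CG" using assms by (auto simp: tuples_def)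
  then show "rip (csc c (lt g (x i))) (y i) = rip (x i) (csc (cnj c) (lt (inv g) (y i)))"
    using assms(1) rip_lt[of g "csc c (x i)" "y i"]
    by (simp add: rip_csc_left lt_linear)
qed

lemma wip_unit:
  assumes "finite I" "i \<in> I" "x \<in> tuples I CG"
  shows "wip I w rip x (unit i) = w i * rip (x i) (gr_basis \<one>)"
proof -
  have "wip I w rip x (unit i) = (\<Sum>j\<in>I. if j = i then w i * rip (x i) (gr_basis \<one>) else 0)"
    unfolding wip_def unit_def using assms by (intro sum.cong) (auto simp: tuples_def)
  then show ?thesis using assms by simp
qed

lemma q_act:
  assumes "g \<in> carrier G" "x \<in> tuples I CG" "\<And>i. i \<in> I \<Longrightarrow> 0 \<le> w i"
  shows "semi_inner.q (wip I w rip) (act c g x) = (cmod c)\<^sup>2 * semi_inner.q (wip I w rip) x"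
  using assms
  by (auto simp: R.q_wip act_def q_csc q_lt tuples_def sum_distrib_left intro!: sum.cong)

end

locale weighted_projections = char_group G \<psi> for G :: "('a, 'b) monoid_scheme" (structure) and \<psi> +
  fixes I :: "'i set" and w :: "'i \<Rightarrow> real" and M :: "('i \<Rightarrow> 'a \<Rightarrow> complex) set"
  assumes I: "finite I" and w: "i \<in> I \<Longrightarrow> 0 < w i" and M: "invariant_subspace I M"
begin

sublocale W: semi_inner "tuples I CG" "wip I w rip"
  by (rule R.semi_inner_wip) (use w in \<open>simp add: less_imp_le\<close>)

lemma subspace_M: "subspace M" and M_tuples: "M \<subseteq> tuples I CG"
  and act_M: "m \<in> M \<Longrightarrow> g \<in> carrier G \<Longrightarrow> act c g m \<in> M"
  using M by (auto simp: invariant_subspace_def)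

lemma M_nonempty: "M \<noteq> {}" using subspace_0[OF subspace_M] by blast

lemma q_unit: "i \<in> I \<Longrightarrow> W.q (unit i) = w i"
  using wip_unit[OF I, of i "unit i" w] q_basis_one
  by (simp add: W.q_def unit_def[of i] R.q_def tuples_def)

text \<open>\<open>pr i n j\<close> approximates, for large \<open>n\<close>, the matrix entry at
  \<open>i\<close>, \<open>j\<close> of the projection onto the closure of \<open>M\<close> that is
  orthogonal for the weights \<open>w\<close>: the coordinate \<open>j\<close> of the image of
  \<open>unit i\<close>.\<close>

definition pr :: "'i \<Rightarrow> nat \<Rightarrow> 'i \<Rightarrow> 'a \<Rightarrow> complex" where
  "pr i = (SOME z. W.proj_seq (unit i) M z)"

lemma pr: "W.proj_seq (unit i) M (pr i)"
  unfolding pr_def by (rule someI_ex[OF W.proj_seq_exists[OF M_nonempty M_tuples unit_tuples]])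

lemmas pr_in_M = W.proj_seq_in_M[OF subspace_M M_tuples unit_tuples pr]
lemmas pr_tuples = W.proj_seq_in_C[OF subspace_M M_tuples unit_tuples pr]
lemmas pr_orth = W.proj_seq_orthogonal[OF subspace_M M_tuples unit_tuples pr]
lemmas pr_cauchy = W.proj_seq_cauchy[OF subspace_M M_tuples unit_tuples pr]

lemma pr_component_cauchy: "j \<in> I \<Longrightarrow> R.cauchy (\<lambda>n. pr i n j)"
  by (rule R.cauchy_component[OF I w pr_cauchy])

lemma pr_CG: "j \<in> I \<Longrightarrow> pr i n j \<in> CG"
  using pr_tuples[of i n] by (simp add: tuples_def)

text \<open>\<open>unit i\<close> has squared norm \<open>w i\<close>, so the diagonal entry of the
  weighted projection Q is <Q e_i, e_i>_w divided by \<open>w i\<close>.\<close>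

lemma pr_diag:
  assumes "i \<in> I"
  shows "(\<lambda>n. rip (pr i n i) (gr_basis \<one>)) \<longlonglongrightarrow> 1 - W.d2 (unit i) M / w i"
proof -
  have "(\<lambda>n. wip I w rip (pr i n) (unit i)) \<longlonglongrightarrow> w i - W.d2 (unit i) M"
    using W.proj_seq_B_e[OF subspace_M M_tuples unit_tuples pr, of i] q_unit[OF assms] by simp
  then have "(\<lambda>n. wip I w rip (pr i n) (unit i) / w i) \<longlonglongrightarrow> (w i - W.d2 (unit i) M) / w i"
    using w[OF assms] by (intro tendsto_intros) auto
  then show ?thesis
    using w[OF assms] assms by (simp add: wip_unit[OF I assms pr_tuples] diff_divide_distrib)
qed

lemma act_pr_bounded:
  assumes "g \<in> carrier G"
  shows "W.nrm_bounded (\<lambda>n. act c g (pr i n))"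
proof -
  obtain K where K: "\<And>n. W.nrm (pr i n) \<le> K"
    using W.nrm_bounded_pos[OF W.cauchy_bounded[OF pr_cauchy[of i]]] by blast
  show ?thesis
  proof (rule W.nrm_boundedI)
    fix n
    show "act c g (pr i n) \<in> tuples I CG" using assms pr_tuples by simp
    have "W.nrm (act c g (pr i n)) = cmod c * W.nrm (pr i n)"
      using assms pr_tuples w by (simp add: W.nrm_def q_act less_imp_le real_sqrt_mult)
    also have "\<dots> \<le> cmod c * K" using K by (intro mult_left_mono) auto
    finally show "W.nrm (act c g (pr i n)) \<le> cmod c * K" .
  qed
qed

text \<open>
  Self-adjointness of the projection with respect to the weighted inner product, read off its
  matrix coefficients.
\<close>

lemma pr_self_adjoint:
  assumes i: "i \<in> I" and j: "j \<in> I"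
  shows "(\<lambda>n. R.nrm (w j *\<^sub>R pr i n j - w i *\<^sub>R star (pr j n i))) \<longlonglongrightarrow> 0"
proof (rule R.cauchy_weakly_null)
  let ?Y = "\<lambda>n. w j *\<^sub>R pr i n j - w i *\<^sub>R star (pr j n i)"
  have "R.cauchy (\<lambda>n. w j *\<^sub>R pr i n j)"
    unfolding R.cauchy_def
  proof
    show "\<forall>n. w j *\<^sub>R pr i n j \<in> CG" using pr_CG[OF j] by simp
    show "\<forall>e>0. \<exists>N. \<forall>m\<ge>N. \<forall>n\<ge>N. R.nrm (w j *\<^sub>R pr i m j - w j *\<^sub>R pr i n j) < e"
      by (rule R.cauchy_of_bound[OF pr_component_cauchy[OF j, of i], where K = "\<bar>w j\<bar>" and
            nrm' = R.nrm and Y = "\<lambda>n. w j *\<^sub>R pr i n j"])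
        (simp add: R.nrm_scale pr_CG[OF j] flip: scaleR_diff_right)
  qed
  moreover have "R.cauchy (\<lambda>n. w i *\<^sub>R star (pr j n i))"
    unfolding R.cauchy_def
  proof
    show "\<forall>n. w i *\<^sub>R star (pr j n i) \<in> CG" using pr_CG[OF i] by simp
    show "\<forall>e>0. \<exists>N. \<forall>m\<ge>N. \<forall>n\<ge>N. R.nrm (w i *\<^sub>R star (pr j m i) - w i *\<^sub>R star (pr j n i)) < e"
      by (rule R.cauchy_of_bound[OF pr_component_cauchy[OF i, of j], where K = "\<bar>w i\<bar>" and
            nrm' = R.nrm and Y = "\<lambda>n. w i *\<^sub>R star (pr j n i)"])
        (simp add: R.nrm_scale nrm_star pr_CG[OF i] flip: scaleR_diff_right star_linear)
  qed
  ultimately show cauchy: "R.cauchy ?Y" by (rule R.cauchy_diff)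
  have basis: "(\<lambda>n. rip (?Y n) (csc c (gr_basis g))) \<longlonglongrightarrow> 0" if g: "g \<in> carrier G" for c g
  proof -
    \<comment> \<open>With Q the projection for \<open>w\<close>, the two parts of
      \<open>?Y n\<close> contribute <Q e_i, c g Q' > type terms: <Q e_i, c g e_j>_w and <e_i, c g Q
      e_j>_w. Subtracting <Q e_i, c g Q e_j>_w from both leaves residuals paired with vectors of
      \<open>M\<close>.\<close>
    have eq: "rip (?Y n) (csc c (gr_basis g)) =
        wip I w rip (unit j - pr j n) (act (cnj c) (inv g) (pr i n)) -
        wip I w rip (unit i - pr i n) (act c g (pr j n))" for n
    proof -
      let ?p = "pr i n" and ?r = "pr j n"
      have P: "?p \<in> tuples I CG" "?r \<in> tuples I CG" by (rule pr_tuples)+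
      have 1: "w j * rip (?p j) (csc c (gr_basis g)) = wip I w rip ?p (act c g (unit j))"
      proof -
        have "wip I w rip ?p (act c g (unit j)) =
            (\<Sum>k\<in>I. if k = j then w j * rip (?p j) (csc c (gr_basis g)) else 0)"
          unfolding wip_def act_def unit_def using P g
          by (intro sum.cong) (auto simp: tuples_def lt_linear csc_linear lt_basis)
        then show ?thesis using I j by simp
      qed
      have 2: "w i * rip (star (?r i)) (csc c (gr_basis g)) = wip I w rip (unit i) (act c g ?r)"
      proof -
        have A: "act c g ?r \<in> tuples I CG" using P g by simp
        then have "act c g ?r i \<in> CG" using i by (simp add: tuples_def)
        then have "rip (star (?r i)) (csc c (gr_basis g)) = rip (act c g ?r i) (gr_basis \<one>)"
          using rip_star_basis[OF pr_CG[OF i] g, of j n c] R.sym[of "act c g ?r i" "gr_basis \<one>"]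
          by (simp add: act_def)
        then show ?thesis using wip_unit[OF I i A] W.sym[OF unit_tuples A] by simp
      qed
      have "rip (?Y n) (csc c (gr_basis g)) =
          w j * rip (?p j) (csc c (gr_basis g)) - w i * rip (star (?r i)) (csc c (gr_basis g))"
        using g i j by (simp add: pr_CG R.bilinear)
      also have "\<dots> = wip I w rip ?p (act c g (unit j - ?r)) - wip I w rip (unit i - ?p) (act c g ?r)"
        using P g by (simp add: 1 2 act_diff W.bilinear)
      also have "wip I w rip ?p (act c g (unit j - ?r)) =
          wip I w rip (unit j - ?r) (act (cnj c) (inv g) ?p)"
        using P g wip_act[of g "unit j - ?r" I ?p w c] by (simp add: W.sym)
      finally show ?thesis .
    qed
    have "(\<lambda>n. rip (?Y n) (csc c (gr_basis g))) \<longlonglongrightarrow> 0 - 0"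
      unfolding eq using g
      by (intro tendsto_diff pr_orth act_M pr_in_M act_pr_bounded) auto
    then show ?thesis by simp
  qed
  fix N
  have N: "?Y N \<in> CG" by (rule R.cauchy_C[OF cauchy])
  \<comment> \<open>\<open>cauchy_weakly_null\<close> tests only against members of the sequence,
    and these are finite combinations of group elements.\<close>
  have "(\<lambda>n. \<Sum>k\<in>supp (?Y N). rip (?Y n) (csc (?Y N k) (gr_basis k))) \<longlonglongrightarrow> (\<Sum>k\<in>supp (?Y N). 0)"
    using N by (intro tendsto_sum basis) (auto simp: CG_iff)
  then show "(\<lambda>n. rip (?Y n) (?Y N)) \<longlonglongrightarrow> 0"
    using csc_basis_expansion[OF N R.cauchy_C[OF cauchy]] by simp
qed

end

section \<open>Independence of the weights\<close>

context char_group
begin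

abbreviation wd2 :: "'i set \<Rightarrow> ('i \<Rightarrow> real) \<Rightarrow> 'i \<Rightarrow> ('i \<Rightarrow> 'a \<Rightarrow> complex) set \<Rightarrow> real" where
  "wd2 I w i M \<equiv> semi_inner.d2 (wip I w rip) (unit i) M"

text \<open>
  Both sides are \<open>card I\<close> minus the trace of an idempotent onto the closure of \<open>M\<close>: \<open>Q\<close> for the
  weights \<open>w\<close> and \<open>P\<close> for the constant weights. Since \<open>PQ = Q\<close> and \<open>QP = P\<close>, the traces agree.
\<close>

theorem sum_weighted_distances:
  assumes I: "finite I" and w: "\<And>i. i \<in> I \<Longrightarrow> 0 < w i" and M: "invariant_subspace I M"
  shows "(\<Sum>i\<in>I. wd2 I w i M / w i) = (\<Sum>i\<in>I. wd2 I (\<lambda>_. 1) i M)"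
proof -
  interpret Q: weighted_projections G \<psi> I w M by unfold_locales (use I w M in auto)
  interpret P: weighted_projections G \<psi> I "\<lambda>_. 1" M by unfold_locales (use I M in auto)
  \<comment> \<open>\<open>S\<close> tends to the trace of Q: as \<open>Q.pr i n\<close> lies in
    \<open>M\<close>, pairing it with \<open>P.pr i n\<close> is asymptotically the same as pairing
    it with \<open>unit i\<close>. In the same way \<open>S'\<close>, built with the weighted
    product, tends to the trace of P.\<close>
  define S where "S n = (\<Sum>i\<in>I. wip I (\<lambda>_. 1) rip (Q.pr i n) (P.pr i n))" for n
  define S' where "S' n = (\<Sum>j\<in>I. 1 / w j * wip I w rip (P.pr j n) (Q.pr j n))" for n
  have P_bounded: "Q.W.nrm_bounded (P.pr i)" for i
    by (rule Q.W.cauchy_bounded, rule R.cauchy_tuples[OF I w])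
      (auto intro: P.pr_component_cauchy)
  have Q_bounded: "P.W.nrm_bounded (Q.pr i)" for i
    by (rule P.W.cauchy_bounded, rule R.cauchy_tuples[OF I])
      (auto intro: Q.pr_component_cauchy)
  have S: "S \<longlonglongrightarrow> (\<Sum>i\<in>I. 1 - wd2 I w i M / w i - 0)"
    unfolding S_def
  proof (rule tendsto_sum)
    fix i assume i: "i \<in> I"
    have "wip I (\<lambda>_. 1) rip (Q.pr i n) (P.pr i n) =
        rip (Q.pr i n i) (gr_basis \<one>) - wip I (\<lambda>_. 1) rip (unit i - P.pr i n) (Q.pr i n)" for n
      using P.pr_tuples[of i n] Q.pr_tuples[of i n] wip_unit[OF I i Q.pr_tuples, of "\<lambda>_. 1" i n]
      by (simp add: P.W.bilinear P.W.sym)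
    then show "(\<lambda>n. wip I (\<lambda>_. 1) rip (Q.pr i n) (P.pr i n)) \<longlonglongrightarrow> 1 - wd2 I w i M / w i - 0"
      by (simp only:) (intro tendsto_diff Q.pr_diag[OF i] P.pr_orth Q.pr_in_M Q_bounded)
  qed
  have S': "S' \<longlonglongrightarrow> (\<Sum>j\<in>I. 1 - wd2 I (\<lambda>_. 1) j M / 1 - 1 / w j * 0)"
    unfolding S'_def
  proof (rule tendsto_sum)
    fix j assume j: "j \<in> I"
    have "1 / w j * wip I w rip (P.pr j n) (Q.pr j n) =
        rip (P.pr j n j) (gr_basis \<one>) - 1 / w j * wip I w rip (unit j - Q.pr j n) (P.pr j n)" for n
      using P.pr_tuples[of j n] Q.pr_tuples[of j n] wip_unit[OF I j P.pr_tuples, of w j n] w[OF j]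
      by (simp add: Q.W.bilinear Q.W.sym field_simps)
    then show "(\<lambda>n. 1 / w j * wip I w rip (P.pr j n) (Q.pr j n)) \<longlonglongrightarrow> 1 - wd2 I (\<lambda>_. 1) j M / 1 - 1 / w j * 0"
      by (simp only:) (intro tendsto_diff tendsto_mult_left P.pr_diag[OF j] Q.pr_orth P.pr_in_M P_bounded)
  qed
  \<comment> \<open>By self-adjointness \<open>P.pr i n j\<close> is asymptotically the star of
    \<open>P.pr j n i\<close>, and \<open>w j\<close> times \<open>Q.pr i n j\<close> that of
    \<open>w i\<close> times \<open>Q.pr j n i\<close>. So the two double sums agree term by term in
    the limit.\<close>
  have "(\<lambda>n. S n - S' n) \<longlonglongrightarrow> (\<Sum>i\<in>I. \<Sum>j\<in>I. - 0 - 1 / w j * 0)"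
  proof -
    have S_eq: "S n = (\<Sum>i\<in>I. \<Sum>j\<in>I. rip (star (P.pr i n j)) (star (Q.pr i n j)))" for n
      unfolding S_def wip_def
      by (intro sum.cong refl) (simp add: rip_star P.pr_CG Q.pr_CG R.sym)
    have S'_eq: "S' n = (\<Sum>i\<in>I. \<Sum>j\<in>I. w i / w j * rip (P.pr j n i) (Q.pr j n i))" for n
      unfolding S'_def wip_def by (subst sum.swap) (simp add: sum_distrib_left)
    have term_eq: "rip (star (P.pr i n j)) (star (Q.pr i n j)) - w i / w j * rip (P.pr j n i) (Q.pr j n i) =
        - rip (1 *\<^sub>R P.pr j n i - 1 *\<^sub>R star (P.pr i n j)) (star (Q.pr i n j)) -
        1 / w j * rip (w i *\<^sub>R Q.pr j n i - w j *\<^sub>R star (Q.pr i n j)) (P.pr j n i)"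
      if "i \<in> I" "j \<in> I" for i j n
      using that w[OF that(2)] P.pr_CG Q.pr_CG
      by (simp add: R.bilinear R.sym[of "Q.pr j n i"] R.sym[of "star (Q.pr i n j)" "P.pr j n i"] field_simps)
    have eq: "S n - S' n = (\<Sum>i\<in>I. \<Sum>j\<in>I.
        - rip (1 *\<^sub>R P.pr j n i - 1 *\<^sub>R star (P.pr i n j)) (star (Q.pr i n j)) -
        1 / w j * rip (w i *\<^sub>R Q.pr j n i - w j *\<^sub>R star (Q.pr i n j)) (P.pr j n i))" for n
      unfolding S_eq S'_eq sum_subtractf[symmetric] using term_eq by (intro sum.cong refl) simp
    show ?thesis
      unfolding eq
    proof (intro tendsto_sum tendsto_diff tendsto_minus tendsto_mult_left)
      fix i j assume i: "i \<in> I" and j: "j \<in> I"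
      obtain K where K: "\<And>n. R.nrm (Q.pr i n j) \<le> K"
        using R.nrm_bounded_pos[OF R.cauchy_bounded[OF Q.pr_component_cauchy[OF j, of i]]] by blast
      show "(\<lambda>n. rip (1 *\<^sub>R P.pr j n i - 1 *\<^sub>R star (P.pr i n j)) (star (Q.pr i n j))) \<longlonglongrightarrow> 0"
        using K by (intro R.tendsto_B_null P.pr_self_adjoint[OF j i] R.nrm_boundedI)
          (auto simp: P.pr_CG Q.pr_CG i j nrm_star)
      show "(\<lambda>n. rip (w i *\<^sub>R Q.pr j n i - w j *\<^sub>R star (Q.pr i n j)) (P.pr j n i)) \<longlonglongrightarrow> 0"
        by (intro R.tendsto_B_null Q.pr_self_adjoint[OF j i] R.cauchy_bounded P.pr_component_cauchy i)
          (auto simp: P.pr_CG Q.pr_CG i j)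
    qed
  qed
  moreover have "(\<lambda>n. S n - S' n) \<longlonglongrightarrow> (\<Sum>i\<in>I. 1 - wd2 I w i M / w i - 0) -
      (\<Sum>j\<in>I. 1 - wd2 I (\<lambda>_. 1) j M / 1 - 1 / w j * 0)"
    by (intro tendsto_diff S S')
  ultimately have "(\<Sum>i\<in>I. \<Sum>j\<in>I. - 0 - 1 / w j * 0) = (\<Sum>i\<in>I. 1 - wd2 I w i M / w i - 0) -
      (\<Sum>j\<in>I. 1 - wd2 I (\<lambda>_. 1) j M / 1 - 1 / w j * 0)"
    by (rule LIMSEQ_unique)
  then show ?thesis by (simp add: sum_subtractf)
qed

end

section \<open>Boundary and coboundary over the group ring\<close>

lemma sum_fun_apply: "(\<Sum>a\<in>A. f a) x = (\<Sum>a\<in>A. f a x)"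
  for f :: "'i \<Rightarrow> 'x \<Rightarrow> 'y::comm_monoid_add"
  by (induction A rule: infinite_finite_induct) auto

text \<open>The form in which weights tend to 0 below: the error is \<open>t\<close> times a
  constant of either sign.\<close>

lemma le_if_le_add_small:
  fixes a b c :: real
  assumes "\<And>t. 0 < t \<Longrightarrow> a \<le> b + t * c"
  shows "a \<le> b"
proof (rule field_le_epsilon)
  fix e :: real
  assume "0 < e"
  show "a \<le> b + e"
  proof (cases "c \<le> 0")
    case True
    then show ?thesis using assms[of e] \<open>0 < e\<close> by (smt (verit) mult_nonneg_nonpos)
  next
    case False
    then show ?thesis using assms[of "e / c"] \<open>0 < e\<close> by simp
  qed
qed

context semi_inner
begin

lemma C_sum: "(\<And>s. s \<in> T \<Longrightarrow> F s \<in> C) \<Longrightarrow> (\<Sum>s\<in>T. F s) \<in> C"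
  by (rule subspace_sum[OF subspace_C])

lemma sum_left:
  assumes "\<And>s. s \<in> T \<Longrightarrow> F s \<in> C" "y \<in> C"
  shows "B (\<Sum>s\<in>T. F s) y = (\<Sum>s\<in>T. B (F s) y)"
  using assms by (induction T rule: infinite_finite_induct) (simp_all add: add_left C_sum)

lemma nrm_sum_le:
  assumes "\<And>s. s \<in> T \<Longrightarrow> F s \<in> C"
  shows "nrm (\<Sum>s\<in>T. F s) \<le> (\<Sum>s\<in>T. nrm (F s))"
  using assms
proof (induction T rule: infinite_finite_induct)
  case (insert x T)
  have "nrm (F x + (\<Sum>s\<in>T. F s)) \<le> nrm (F x) + nrm (\<Sum>s\<in>T. F s)"
    using insert by (intro nrm_triangle C_sum) auto
  then show ?case using insert by simp
qed simp_all

lemma d2_mono: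
  assumes "M \<noteq> {}" "M \<subseteq> M'" "M' \<subseteq> C" "e \<in> C"
  shows "d2 e M' \<le> d2 e M"
  using assms by (intro d2_ge[OF assms(1)] d2_le) auto

end

context char_group
begin

definition single :: "'i \<Rightarrow> ('a \<Rightarrow> complex) \<Rightarrow> 'i \<Rightarrow> 'a \<Rightarrow> complex" where
  "single i h = (\<lambda>j. if j = i then h else 0)"

lemma single_tuples [simp]: "h \<in> CG \<Longrightarrow> single i h \<in> tuples I CG"
  by (simp add: single_def tuples_def)

text \<open>The adjoint of the boundary, see \<open>bd_cobd_adjoint\<close>: right translation by
  \<open>s\<close> has right translation by \<open>inv s\<close> as its adjoint. The generating set
  enters only as the index set of the tuples.\<close>

definition cobd :: "('a \<Rightarrow> complex) \<Rightarrow> 'a \<Rightarrow> 'a \<Rightarrow> complex" where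
  "cobd h s = rt (inv s) h - h"

lemma cobd_CG [simp]: "s \<in> carrier G \<Longrightarrow> h \<in> CG \<Longrightarrow> cobd h s \<in> CG"
  by (simp add: cobd_def)

lemma cobd_tuples [simp]: "S \<subseteq> carrier G \<Longrightarrow> h \<in> CG \<Longrightarrow> cobd h \<in> tuples S CG"
  by (auto simp: tuples_def)

lemma cobd_linear: "cobd (x + y) = cobd x + cobd y" "cobd (x - y) = cobd x - cobd y"
    "cobd (r *\<^sub>R x) = r *\<^sub>R cobd x" "cobd 0 = 0"
  by (auto simp: cobd_def rt_linear fun_eq_iff algebra_simps)

lemma nrm_rt: "s \<in> carrier G \<Longrightarrow> h \<in> CG \<Longrightarrow> R.nrm (rt s h) = R.nrm h"
  by (simp add: R.nrm_def q_rt)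

lemma nrm_rt_diff_le: "s \<in> carrier G \<Longrightarrow> h \<in> CG \<Longrightarrow> R.nrm (rt s h - h) \<le> 2 * R.nrm h"
  using R.nrm_triangle_diff[of "rt s h" h] by (simp add: nrm_rt)

abbreviation wip1 :: "'i set \<Rightarrow> ('i \<Rightarrow> 'a \<Rightarrow> complex) \<Rightarrow> ('i \<Rightarrow> 'a \<Rightarrow> complex) \<Rightarrow> real" where
  "wip1 I \<equiv> wip I (\<lambda>_. 1) rip"

abbreviation q1 :: "'i set \<Rightarrow> ('i \<Rightarrow> 'a \<Rightarrow> complex) \<Rightarrow> real" where
  "q1 I \<equiv> semi_inner.q (wip1 I)"

lemma semi_inner_wip1: "semi_inner (tuples I CG) (wip1 I)"
  by (rule R.semi_inner_wip) simp

lemma q1_eq: "q1 I f = (\<Sum>i\<in>I. R.q (f i))"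
  by (simp add: R.q_wip)

lemma q1_unit:
  assumes "finite S" "i \<in> S"
  shows "q1 S (unit i) = 1"
proof -
  have "q1 S (unit i) = (\<Sum>s\<in>S. if s = i then 1 else 0)"
    unfolding q1_eq unit_def by (intro sum.cong) (auto simp: q_basis_one)
  then show ?thesis using assms by simp
qed

lemma wip1_single:
  assumes "finite I" "i \<in> I" "h \<in> CG" "f \<in> tuples I CG"
  shows "wip1 I (single i h) f = rip h (f i)"
proof -
  have "wip1 I (single i h) f = (\<Sum>j\<in>I. if j = i then rip h (f i) else 0)"
    unfolding wip_def single_def using assms by (intro sum.cong) (auto simp: tuples_def)
  then show ?thesis using assms by simp
qed

text \<open>The cycles of \<open>gr_cycles\<close>, but with arbitrary values outside
  \<open>S\<close>, as \<open>tuples\<close> has them.\<close>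

definition bd_cycles :: "'a set \<Rightarrow> ('a \<Rightarrow> 'a \<Rightarrow> complex) set" where
  "bd_cycles S = {f \<in> tuples S CG. gr_boundary G S f = 0}"

definition bd_image :: "'a set \<Rightarrow> ('a \<Rightarrow> complex) set" where
  "bd_image S = gr_boundary G S ` tuples S CG"

definition cobd_image :: "('a \<Rightarrow> 'a \<Rightarrow> complex) set" where
  "cobd_image = cobd ` CG"

lemma subspace_cobd_image: "subspace cobd_image"
  unfolding subspace_def cobd_image_def
proof (intro conjI ballI allI)
  show "0 \<in> cobd ` CG" using cobd_linear(4) R.C_zero by (metis imageI)
  show "x + y \<in> cobd ` CG" if "x \<in> cobd ` CG" "y \<in> cobd ` CG" for x y
    using that cobd_linear(1) R.C_add by (smt (verit) imageE imageI)
  show "c *\<^sub>R x \<in> cobd ` CG" if "x \<in> cobd ` CG" for c x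
    using that cobd_linear(3) R.C_scale by (smt (verit) imageE imageI)
qed

context
  fixes S :: "'a set"
  assumes S: "finite S" "S \<subseteq> carrier G"
begin

interpretation W: semi_inner "tuples S CG" "wip1 S" by (rule semi_inner_wip1)

lemma bd_eq:
  assumes "f \<in> tuples S CG"
  shows "gr_boundary G S f = (\<Sum>s\<in>S. rt s (f s) - f s)"
proof
  fix x
  show "gr_boundary G S f x = (\<Sum>s\<in>S. rt s (f s) - f s) x"
  proof (cases "x \<in> carrier G")
    case True
    then show ?thesis by (simp add: gr_boundary_def sum_fun_apply rt_def permute_def)
  next
    case False
    then show ?thesis using assms
      by (auto simp: gr_boundary_def sum_fun_apply rt_def permute_def tuples_def CG_outside)
  qed
qed

lemma bd_CG [simp]: "f \<in> tuples S CG \<Longrightarrow> gr_boundary G S f \<in> CG"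
  unfolding bd_eq using S by (intro subspace_sum subspace_CG R.C_diff rt_CG) (auto simp: tuples_def)

lemma bd_add: "f \<in> tuples S CG \<Longrightarrow> h \<in> tuples S CG \<Longrightarrow>
    gr_boundary G S (f + h) = gr_boundary G S f + gr_boundary G S h"
  by (simp add: bd_eq rt_linear sum.distrib[symmetric] algebra_simps)

lemma bd_diff: "f \<in> tuples S CG \<Longrightarrow> h \<in> tuples S CG \<Longrightarrow>
    gr_boundary G S (f - h) = gr_boundary G S f - gr_boundary G S h"
  by (simp add: bd_eq rt_linear sum_subtractf[symmetric] algebra_simps)

lemma bd_scale: "f \<in> tuples S CG \<Longrightarrow> gr_boundary G S (r *\<^sub>R f) = r *\<^sub>R gr_boundary G S f"
  by (simp add: bd_eq rt_linear scaleR_sum_right scaleR_diff_right)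

lemma bd_zero [simp]: "gr_boundary G S 0 = 0"
  by (simp add: bd_eq rt_linear)

lemma bd_act:
  assumes "f \<in> tuples S CG" "g \<in> carrier G"
  shows "gr_boundary G S (act c g f) = csc c (lt g (gr_boundary G S f))"
proof -
  have lin: "csc c (lt g (\<Sum>s\<in>T. F s)) = (\<Sum>s\<in>T. csc c (lt g (F s)))" for F :: "'a \<Rightarrow> 'a \<Rightarrow> complex" and T
    using sum_comp_morphism[of "\<lambda>x. csc c (lt g x)" F T] by (simp add: lt_linear csc_linear o_def)
  show ?thesis
    using assms S
    by (simp add: bd_eq lin) (intro sum.cong refl, auto simp: act_def lt_linear csc_linear lt_rt rt_linear)
qed

lemma bd_single: "s \<in> S \<Longrightarrow> h \<in> CG \<Longrightarrow> gr_boundary G S (single s h) = rt s h - h"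
proof -
  assume s: "s \<in> S" and h: "h \<in> CG"
  have "gr_boundary G S (single s h) = (\<Sum>t\<in>S. if t = s then rt s h - h else 0)"
    using h by (simp add: bd_eq) (intro sum.cong refl, auto simp: single_def rt_linear)
  then show ?thesis using s S by simp
qed

lemma bd_cobd_adjoint:
  assumes "f \<in> tuples S CG" "h \<in> CG"
  shows "rip (gr_boundary G S f) h = wip1 S f (cobd h)"
proof -
  have f: "f s \<in> CG" "s \<in> carrier G" if "s \<in> S" for s using assms S that by (auto simp: tuples_def)
  have "rip (gr_boundary G S f) h = (\<Sum>s\<in>S. rip (rt s (f s) - f s) h)"
    unfolding bd_eq[OF assms(1)] using f assms by (intro R.sum_left) auto
  also have "\<dots> = wip1 S f (cobd h)"
    unfolding wip_def using f assms
    by (intro sum.cong refl) (simp add: cobd_def R.bilinear rip_rt)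
  finally show ?thesis .
qed

lemma cobd_bounded:
  assumes "h \<in> CG" "s \<in> S"
  shows "R.nrm (cobd h s) \<le> 2 * R.nrm h"
  using nrm_rt_diff_le[of "inv s" h] assms S by (auto simp: cobd_def)

lemma bd_bounded:
  assumes "f \<in> tuples S CG"
  shows "R.nrm (gr_boundary G S f) \<le> 2 * card S * W.nrm f"
proof -
  have f: "f s \<in> CG" "s \<in> carrier G" if "s \<in> S" for s using assms S that by (auto simp: tuples_def)
  have "R.nrm (gr_boundary G S f) \<le> (\<Sum>s\<in>S. R.nrm (rt s (f s) - f s))"
    unfolding bd_eq[OF assms] using f by (intro R.nrm_sum_le) auto
  also have "\<dots> \<le> (\<Sum>s\<in>S. 2 * W.nrm f)"
  proof (rule sum_mono)
    fix s assume s: "s \<in> S"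
    have "R.nrm (rt s (f s) - f s) \<le> 2 * R.nrm (f s)" using f[OF s] by (intro nrm_rt_diff_le)
    also have "R.nrm (f s) \<le> W.nrm f" using R.nrm_component_le[OF S(1) _ assms s, of "\<lambda>_. 1"] by simp
    finally show "R.nrm (rt s (f s) - f s) \<le> 2 * W.nrm f" by simp
  qed
  finally show ?thesis by simp
qed

lemma invariant_bd_cycles: "invariant_subspace S (bd_cycles S)"
  unfolding invariant_subspace_def bd_cycles_def subspace_def
  by (auto simp: bd_add bd_scale bd_act lt_linear csc_linear)

lemma zero_bd_cycles: "0 \<in> bd_cycles S"
  by (simp add: bd_cycles_def)

lemma subspace_bd_image: "subspace (bd_image S)"
  unfolding subspace_def bd_image_def
proof (intro conjI ballI allI)
  show "0 \<in> gr_boundary G S ` tuples S CG" using W.C_zero bd_zero by (metis imageI)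
  fix x y r assume "x \<in> gr_boundary G S ` tuples S CG"
  then obtain f where f: "x = gr_boundary G S f" "f \<in> tuples S CG" by auto
  then show "r *\<^sub>R x \<in> gr_boundary G S ` tuples S CG" using bd_scale W.C_scale by (metis imageI)
  assume "y \<in> gr_boundary G S ` tuples S CG"
  then obtain h where "y = gr_boundary G S h" "h \<in> tuples S CG" by auto
  then show "x + y \<in> gr_boundary G S ` tuples S CG" using f bd_add W.C_add by (metis imageI)
qed

lemma bd_image_CG: "bd_image S \<subseteq> CG" by (auto simp: bd_image_def)

lemma cobd_image_tuples: "cobd_image \<subseteq> tuples S CG"
  using S by (auto simp: cobd_image_def)

text \<open>
  The span of \<open>(h \<cdot> d, h)\<close> with weight \<open>t\<close> on the last coordinate degenerates to the last
  coordinate axis for \<open>t \<longlonglongrightarrow> \<infinity>\<close>, and to the image of \<open>d\<close> plus the right invariant vectors for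
  \<open>t \<longlonglongrightarrow> 0\<close>. Its dimension does not depend on \<open>t\<close>, hence this instance of rank and nullity.
\<close>

lemma sum_distances_cobd_image:
  "(\<Sum>s\<in>S. wd2 S (\<lambda>_. 1) s cobd_image) = real (card S) - 1 + R.d2 (gr_basis \<one>) (bd_image S)"
proof -
  \<comment> \<open>\<open>None\<close> is the extra coordinate that holds \<open>h\<close> itself,
    and \<open>Some s\<close> holds the coordinate of its coboundary at \<open>s\<close>. The weight
    \<open>t\<close> below is put on \<open>None\<close> alone.\<close>
  define graph where "graph h = (\<lambda>i. case i of None \<Rightarrow> h | Some s \<Rightarrow> if s \<in> S then cobd h s else 0)" for h
  define J where "J = insert None (Some ` S)"
  define N where "N = graph ` CG"
  define w where "w t i = (case i of None \<Rightarrow> t | Some s \<Rightarrow> 1)" for t :: real and i :: "'a option"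
  define K where "K = card S"
  have J: "finite J" using S by (simp add: J_def)
  have w: "0 < w t i" if "0 < t" for t i using that by (cases i) (auto simp: w_def)
  have sum_J: "(\<Sum>i\<in>J. F i) = F None + (\<Sum>s\<in>S. F (Some s))" for F :: "'a option \<Rightarrow> real"
    unfolding J_def using S by (subst sum.insert) (auto simp: sum.reindex)
  have one: "gr_basis \<one> \<in> CG" by simp
  have graph_linear: "graph (x + y) = graph x + graph y" "graph (r *\<^sub>R x) = r *\<^sub>R graph x" "graph 0 = 0"
    for x y r
    by (auto simp: graph_def cobd_linear fun_eq_iff split: option.splits)
  have graph_tuples: "graph h \<in> tuples J CG" if "h \<in> CG" for h
    using that S by (auto simp: tuples_def J_def graph_def)
  have N: "invariant_subspace J N"
    unfolding invariant_subspace_def N_def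
  proof (intro conjI ballI allI)
    show "subspace (graph ` CG)"
      unfolding subspace_def
    proof (intro conjI ballI allI)
      show "0 \<in> graph ` CG" using graph_linear(3) R.C_zero by (metis imageI)
      show "x + y \<in> graph ` CG" if "x \<in> graph ` CG" "y \<in> graph ` CG" for x y
        using that graph_linear(1) R.C_add by (smt (verit) imageE imageI)
      show "r *\<^sub>R x \<in> graph ` CG" if "x \<in> graph ` CG" for x r
        using that graph_linear(2) R.C_scale by (smt (verit) imageE imageI)
    qed
    show "graph ` CG \<subseteq> tuples J CG" using graph_tuples by blast
    fix m c g assume "m \<in> graph ` CG" and g: "g \<in> carrier G"
    then obtain h where h: "m = graph h" "h \<in> CG" by auto
    have "act c g m = graph (csc c (lt g h))"
    proof
      fix i
      show "act c g m i = graph (csc c (lt g h)) i"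
      proof (cases i)
        case (Some s)
        show ?thesis
        proof (cases "s \<in> S")
          case True
          then have "s \<in> carrier G" using S by blast
          then show ?thesis using g True
            by (simp add: h act_def graph_def Some cobd_def lt_linear csc_linear lt_rt rt_linear)
        qed (simp add: h act_def graph_def Some lt_linear csc_linear)
      qed (simp add: h act_def graph_def)
    qed
    then show "act c g m \<in> graph ` CG" using h g by simp
  qed
  define d where "d t i = wd2 J (w t) i N" for t i
  have qJ: "semi_inner.q (wip J (w t) rip) f = t * R.q (f None) + (\<Sum>s\<in>S. R.q (f (Some s)))"
    if "0 < t" for t f
    using w[OF that] by (subst R.q_wip) (auto simp: less_imp_le sum_J w_def)
  have q_None: "semi_inner.q (wip J (w t) rip) (unit None - graph h) = t * R.q (gr_basis \<one> - h) + q1 S (cobd h)"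
    if "0 < t" "h \<in> CG" for t h
  proof -
    have "R.q (- cobd h s) = R.q (cobd h s)" if "s \<in> S" for s
      using that S \<open>h \<in> CG\<close> R.q_scale[of "cobd h s" "-1"] by auto
    then show ?thesis unfolding qJ[OF that(1)] q1_eq by (simp add: graph_def unit_def)
  qed
  have q_Some: "semi_inner.q (wip J (w t) rip) (unit (Some s) - graph h) = t * R.q h + q1 S (unit s - cobd h)"
    if "0 < t" "h \<in> CG" for t h s
    using R.q_scale[OF that(2), of "-1"] unfolding qJ[OF that(1)] q1_eq by (simp add: graph_def unit_def)
  have d: "\<lbrakk>h \<in> CG; 0 < t\<rbrakk> \<Longrightarrow> d t i \<le> semi_inner.q (wip J (w t) rip) (unit i - graph h)"
      "\<lbrakk>0 < t; \<And>h. h \<in> CG \<Longrightarrow> c \<le> semi_inner.q (wip J (w t) rip) (unit i - graph h)\<rbrakk> \<Longrightarrow> c \<le> d t i"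
    for h t i c
  proof -
    assume t: "0 < t"
    interpret T: semi_inner "tuples J CG" "wip J (w t) rip"
      by (rule R.semi_inner_wip) (use w[OF t] in \<open>simp add: less_imp_le\<close>)
    show "d t i \<le> T.q (unit i - graph h)" if "h \<in> CG"
      unfolding d_def using N that by (intro T.d2_le) (auto simp: N_def invariant_subspace_def)
    show "c \<le> d t i" if "\<And>h. h \<in> CG \<Longrightarrow> c \<le> T.q (unit i - graph h)"
      unfolding d_def
    proof (rule T.d2_ge)
      show "N \<noteq> {}" unfolding N_def using R.C_zero by blast
    qed (use that in \<open>auto simp: N_def\<close>)
  qed
  have F: "d t None / t + (\<Sum>s\<in>S. d t (Some s)) = d 1 None + (\<Sum>s\<in>S. d 1 (Some s))" if "0 < t" for t
  proof -
    have "(\<Sum>i\<in>J. d t i / w t i) = (\<Sum>i\<in>J. d 1 i / w 1 i)"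
      unfolding d_def using sum_weighted_distances[OF J w[OF that] N]
        sum_weighted_distances[OF J w[of 1] N] by simp
    then show ?thesis by (simp add: sum_J w_def)
  qed
  \<comment> \<open>The sum is constant in \<open>t\<close>; its value is found by letting the
    weight \<open>u = 1 / v\<close> tend to infinity.\<close>
  have F_const: "d t None / t + (\<Sum>s\<in>S. d t (Some s)) = K" if t: "0 < t" for t
  proof (rule antisym)
    have d0: "0 \<le> d u i" if "0 < u" for u i
    proof (rule d(2)[OF that])
      interpret U: semi_inner "tuples J CG" "wip J (w u) rip"
        by (rule R.semi_inner_wip) (use w[OF that] in \<open>simp add: less_imp_le\<close>)
      show "0 \<le> U.q (unit i - graph h)" if "h \<in> CG" for h
        using that graph_tuples by (intro U.q_nonneg U.C_diff) auto
    qed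
    show "d t None / t + (\<Sum>s\<in>S. d t (Some s)) \<le> K"
    proof (rule le_if_le_add_small)
      fix v :: real
      assume v: "0 < v"
      define u where "u = 1 / v"
      have u: "0 < u" "1 / u = v" using v by (auto simp: u_def)
      have "d t None / t + (\<Sum>s\<in>S. d t (Some s)) = d u None / u + (\<Sum>s\<in>S. d u (Some s))"
        using F[OF t] F[OF u(1)] by simp
      \<comment> \<open>Test vectors: \<open>h = gr_basis \<one>\<close> for \<open>None\<close>,
        where only the coboundary remains, and \<open>h = 0\<close> for
        \<open>Some s\<close>.\<close>
      also have "\<dots> \<le> v * q1 S (cobd (gr_basis \<one>)) + (\<Sum>s\<in>S. 1)"
      proof (intro add_mono sum_mono)
        have "d u None / u \<le> q1 S (cobd (gr_basis \<one>)) / u"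
          using d(1)[OF one u(1), of None] q_None[OF u(1) one] u(1) by (intro divide_right_mono) auto
        then show "d u None / u \<le> v * q1 S (cobd (gr_basis \<one>))" using u by (simp add: u_def)
        show "d u (Some s) \<le> 1" if "s \<in> S" for s
          using d(1)[OF R.C_zero u(1), of "Some s"] q_Some[OF u(1) R.C_zero, of s] q1_unit[OF S(1) that]
          by (simp add: cobd_linear)
      qed
      finally show "d t None / t + (\<Sum>s\<in>S. d t (Some s)) \<le> K + v * q1 S (cobd (gr_basis \<one>))"
        by (simp add: K_def)
    qed
    show "K \<le> d t None / t + (\<Sum>s\<in>S. d t (Some s))"
    proof (rule le_if_le_add_small)
      fix v :: real
      assume v: "0 < v"
      define u where "u = 1 / v"
      have u: "0 < u" "1 / u = v" using v by (auto simp: u_def)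
      have "(\<Sum>s\<in>S. 1 - v * R.q (gr_boundary G S (unit s))) \<le> (\<Sum>s\<in>S. d u (Some s))"
      proof (rule sum_mono)
        fix s assume s: "s \<in> S"
        show "1 - v * R.q (gr_boundary G S (unit s)) \<le> d u (Some s)"
        proof (rule d(2)[OF u(1)])
          fix h assume h: "h \<in> CG"
          let ?y = "gr_boundary G S (unit s)"
          have y: "?y \<in> CG" by simp
          \<comment> \<open>Completing the square in \<open>h\<close>: by adjointness the mixed term
            is the pairing of \<open>unit s\<close> with \<open>cobd h\<close>.\<close>
          have "0 \<le> v * R.q (u *\<^sub>R h - ?y)" using v h y by simp
          also have "\<dots> = v * u * u * R.q h - 2 * (v * u) * rip ?y h + v * R.q ?y"
            using h y by (simp add: R.q_diff R.q_scale R.bilinear R.sym[of h] power2_eq_square algebra_simps)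
          also have "v * u = 1" using v by (simp add: u_def)
          also have "rip ?y h = wip1 S (unit s) (cobd h)" using h by (intro bd_cobd_adjoint) auto
          finally have "0 \<le> u * R.q h - 2 * wip1 S (unit s) (cobd h) + v * R.q ?y" by simp
          moreover have "q1 S (unit s - cobd h) = 1 - 2 * wip1 S (unit s) (cobd h) + q1 S (cobd h)"
            using S h q1_unit[OF S(1) s] by (simp add: W.q_diff)
          moreover have "0 \<le> q1 S (cobd h)" using S h by (intro W.q_nonneg) auto
          ultimately show "1 - v * R.q ?y \<le> semi_inner.q (wip J (w u) rip) (unit (Some s) - graph h)"
            unfolding q_Some[OF u(1) h] by simp
        qed
      qed
      then have "real K - v * (\<Sum>s\<in>S. R.q (gr_boundary G S (unit s))) \<le> d u None / u + (\<Sum>s\<in>S. d u (Some s))"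
        using d0[OF u(1), of None] u(1) by (simp add: sum_subtractf K_def sum_distrib_left add_increasing)
      also have "\<dots> = d t None / t + (\<Sum>s\<in>S. d t (Some s))" using F[OF t] F[OF u(1)] by simp
      finally show "K \<le> d t None / t + (\<Sum>s\<in>S. d t (Some s)) + v * (\<Sum>s\<in>S. R.q (gr_boundary G S (unit s)))"
        by simp
    qed
  qed
  define A where "A s = wd2 S (\<lambda>_. 1) s cobd_image" for s
  define \<beta> where "\<beta> = R.d2 (gr_basis \<one>) (bd_image S)"
  have A_le: "h \<in> CG \<Longrightarrow> A s \<le> q1 S (unit s - cobd h)" for s h
    unfolding A_def by (intro W.d2_le cobd_image_tuples) (auto simp: cobd_image_def)
  have "(\<Sum>s\<in>S. A s) = real K - 1 + \<beta>"
  proof (rule antisym)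
    have "(\<Sum>s\<in>S. A s) + 1 - K \<le> \<beta>"
      unfolding \<beta>_def
    proof (rule R.d2_ge)
      show "bd_image S \<noteq> {}" using subspace_0[OF subspace_bd_image] by blast
      fix y assume "y \<in> bd_image S"
      then obtain x where x: "y = gr_boundary G S x" "x \<in> tuples S CG" by (auto simp: bd_image_def)
      have y: "y \<in> CG" using x by simp
      show "(\<Sum>s\<in>S. A s) + 1 - K \<le> R.q (gr_basis \<one> - y)"
      proof (rule le_if_le_add_small)
        fix t :: real
        assume t: "0 < t"
        \<comment> \<open>Now the weight on \<open>None\<close> tends to 0. Again a square is
          completed, with \<open>t *\<^sub>R x\<close> compared to \<open>cobd h\<close>;
          adjointness cancels the mixed terms.\<close>
        have "t * (1 - R.q (gr_basis \<one> - y) - t * q1 S x) \<le> d t None"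
        proof (rule d(2)[OF t])
          fix h assume h: "h \<in> CG"
          have "0 \<le> t * R.q (gr_basis \<one> - h - y) + q1 S (cobd h - t *\<^sub>R x)"
            using t h y x S by (intro add_nonneg_nonneg mult_nonneg_nonneg R.q_nonneg W.q_nonneg) auto
          also have "\<dots> = t * R.q (gr_basis \<one> - h) + q1 S (cobd h) - t * (1 - R.q (gr_basis \<one> - y) - t * q1 S x)
              + 2 * t * (rip h y - wip1 S (cobd h) x)"
          proof -
            have e1: "R.q (gr_basis \<one> - h - y) = R.q (gr_basis \<one> - h) - 2 * (rip (gr_basis \<one>) y - rip h y) + R.q y"
              using R.q_diff[of "gr_basis \<one> - h" y] h y by (simp add: R.bilinear)
            have e2: "R.q (gr_basis \<one> - y) = 1 - 2 * rip (gr_basis \<one>) y + R.q y"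
              using y by (simp add: R.q_diff q_basis_one)
            have e3: "q1 S (cobd h - t *\<^sub>R x) = q1 S (cobd h) - 2 * t * wip1 S (cobd h) x + t * t * q1 S x"
              using h x S by (simp add: W.q_diff W.q_scale W.bilinear power2_eq_square)
            show ?thesis unfolding e1 e2 e3 by (simp add: algebra_simps)
          qed
          also have "rip h y = wip1 S (cobd h) x"
            using bd_cobd_adjoint[OF x(2) h] x h y S by (simp add: R.sym[of h] W.sym[of "cobd h"])
          finally show "t * (1 - R.q (gr_basis \<one> - y) - t * q1 S x) \<le> semi_inner.q (wip J (w t) rip) (unit None - graph h)"
            unfolding q_None[OF t h] diff_self mult_zero_right add_0_right by linarith
        qed
        then have "1 - R.q (gr_basis \<one> - y) - t * q1 S x \<le> d t None / t"
          using t by (simp add: field_simps)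
        moreover have "(\<Sum>s\<in>S. A s) \<le> (\<Sum>s\<in>S. d t (Some s))"
        proof (rule sum_mono)
          fix s
          show "A s \<le> d t (Some s)"
          proof (rule d(2)[OF t])
            fix h assume h: "h \<in> CG"
            have "0 \<le> t * R.q h" using t h by simp
            then show "A s \<le> semi_inner.q (wip J (w t) rip) (unit (Some s) - graph h)"
              using A_le[OF h, of s] unfolding q_Some[OF t h] by linarith
          qed
        qed
        ultimately show "(\<Sum>s\<in>S. A s) + 1 - K \<le> R.q (gr_basis \<one> - y) + t * q1 S x"
          using F_const[OF t] by simp
      qed
    qed
    then show "(\<Sum>s\<in>S. A s) \<le> real K - 1 + \<beta>" by simp
  next
    \<comment> \<open>For the converse, arbitrary \<open>h s\<close> and the vectors
      \<open>gr_basis \<one> - z n\<close> serve as test vectors, where \<open>z\<close> minimizes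
      the distance of the unit to the image of the boundary. Near minimizers are inserted for
      \<open>h s\<close> at the end.\<close>
    have *: "real K - 1 + \<beta> \<le> (\<Sum>s\<in>S. q1 S (unit s - cobd (h s)))" if h: "\<And>s. h s \<in> CG" for h
    proof (rule le_if_le_add_small)
      fix t :: real
      assume t: "0 < t"
      obtain z where z: "R.proj_seq (gr_basis \<one>) (bd_image S) z"
        using R.proj_seq_exists[OF _ bd_image_CG one] subspace_0[OF subspace_bd_image] by blast
      note zz = subspace_bd_image bd_image_CG one z
      have zC: "z n \<in> CG" for n by (rule R.proj_seq_in_C[OF zz])
      \<comment> \<open>The residual of the unit becomes orthogonal to all boundaries. Pairing its
        coboundary with \<open>?u\<close> is pairing the residual with a boundary, so in the limit
        it is invariant under right translation by \<open>s\<close>.\<close>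
      have null: "(\<lambda>n. R.nrm (cobd (gr_basis \<one> - z n) s)) \<longlonglongrightarrow> 0" if s: "s \<in> S" for s
      proof (rule R.cauchy_weakly_null)
        have sG: "s \<in> carrier G" using s S by blast
        show "R.cauchy (\<lambda>n. cobd (gr_basis \<one> - z n) s)"
          unfolding R.cauchy_def
        proof
          show "\<forall>n. cobd (gr_basis \<one> - z n) s \<in> CG" using zC sG by simp
          show "\<forall>e>0. \<exists>N. \<forall>m\<ge>N. \<forall>n\<ge>N. R.nrm (cobd (gr_basis \<one> - z m) s - cobd (gr_basis \<one> - z n) s) < e"
          proof (rule R.cauchy_of_bound[OF R.proj_seq_cauchy[OF zz], where K = 2
                and nrm' = R.nrm and Y = "\<lambda>n. cobd (gr_basis \<one> - z n) s"])
            fix m n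
            have eq: "cobd (gr_basis \<one> - z m) s - cobd (gr_basis \<one> - z n) s = cobd (z n - z m) s"
              by (simp add: cobd_linear)
            have "R.nrm (cobd (z n - z m) s) \<le> 2 * R.nrm (z n - z m)" using zC s by (intro cobd_bounded) auto
            then show "R.nrm (cobd (gr_basis \<one> - z m) s - cobd (gr_basis \<one> - z n) s) \<le> 2 * R.nrm (z m - z n)"
              unfolding eq using R.nrm_diff_commute[OF zC zC, of m n] by linarith
          qed
        qed
        fix N
        let ?u = "cobd (gr_basis \<one> - z N) s"
        have u: "?u \<in> CG" using zC sG by simp
        have "(\<lambda>n. rip (gr_basis \<one> - z n) (gr_boundary G S (single s ?u))) \<longlonglongrightarrow> 0"
        proof (rule R.proj_seq_orthogonal[OF zz])
          show "gr_boundary G S (single s ?u) \<in> bd_image S" using u by (simp add: bd_image_def)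
          show "R.nrm_bounded (\<lambda>n. gr_boundary G S (single s ?u))"
            using u by (intro R.nrm_boundedI[OF _ order_refl]) simp
        qed
        moreover have "rip (gr_basis \<one> - z n) (gr_boundary G S (single s ?u)) = rip (cobd (gr_basis \<one> - z n) s) ?u" for n
        proof -
          have C: "gr_basis \<one> - z n \<in> CG" using zC by simp
          have "rip (gr_basis \<one> - z n) (gr_boundary G S (single s ?u)) = wip1 S (single s ?u) (cobd (gr_basis \<one> - z n))"
            using bd_cobd_adjoint[OF single_tuples[OF u] C] C u by (simp add: R.sym)
          also have "\<dots> = rip ?u (cobd (gr_basis \<one> - z n) s)"
            using C u S s by (intro wip1_single) auto
          finally show ?thesis using u sG C by (simp add: R.sym)
        qed
        ultimately show "(\<lambda>n. rip (cobd (gr_basis \<one> - z n) s) ?u) \<longlonglongrightarrow> 0" by simp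
      qed
      have cobd0: "(\<lambda>n. q1 S (cobd (gr_basis \<one> - z n))) \<longlonglongrightarrow> (\<Sum>s\<in>S. 0\<^sup>2)"
      proof -
        have "R.q (cobd (gr_basis \<one> - z n) s) = (R.nrm (cobd (gr_basis \<one> - z n) s))\<^sup>2" if "s \<in> S" for n s
          using that zC S by (auto simp: R.nrm_sq)
        then have "q1 S (cobd (gr_basis \<one> - z n)) = (\<Sum>s\<in>S. (R.nrm (cobd (gr_basis \<one> - z n) s))\<^sup>2)" for n
          unfolding q1_eq by (intro sum.cong) auto
        then show ?thesis by (simp only:) (intro tendsto_sum tendsto_power null)
      qed
      define E where "E = (\<Sum>s\<in>S. t * R.q (h s) + q1 S (unit s - cobd (h s)))"
      have le: "K \<le> R.q (z n) + q1 S (cobd (gr_basis \<one> - z n)) / t + E" for n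
      proof -
        have C: "gr_basis \<one> - z n \<in> CG" using zC by simp
        have "d t None / t \<le> (t * R.q (z n) + q1 S (cobd (gr_basis \<one> - z n))) / t"
          using d(1)[OF C t, of None] q_None[OF t C] t by (intro divide_right_mono) auto
        also have "\<dots> = R.q (z n) + q1 S (cobd (gr_basis \<one> - z n)) / t"
          using t by (simp add: add_divide_distrib)
        finally have "d t None / t \<le> R.q (z n) + q1 S (cobd (gr_basis \<one> - z n)) / t" .
        moreover have "(\<Sum>s\<in>S. d t (Some s)) \<le> E"
          unfolding E_def
        proof (rule sum_mono)
          fix s
          show "d t (Some s) \<le> t * R.q (h s) + q1 S (unit s - cobd (h s))"
            using d(1)[OF h t, of "Some s" s] q_Some[OF t h, of s s] by simp
        qed
        ultimately show ?thesis using F_const[OF t] by simp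
      qed
      have "real K \<le> (1 - \<beta>) + (\<Sum>s\<in>S. 0\<^sup>2) / t + E"
      proof (rule LIMSEQ_le_const)
        show "(\<lambda>n. R.q (z n) + q1 S (cobd (gr_basis \<one> - z n)) / t + E) \<longlonglongrightarrow> (1 - \<beta>) + (\<Sum>s\<in>S. 0\<^sup>2) / t + E"
          using R.proj_seq_q[OF zz] t unfolding \<beta>_def q_basis_one by (intro tendsto_intros cobd0) auto
      qed (use le in blast)
      then show "real K - 1 + \<beta> \<le> (\<Sum>s\<in>S. q1 S (unit s - cobd (h s))) + t * (\<Sum>s\<in>S. R.q (h s))"
        by (simp add: E_def sum.distrib sum_distrib_left)
    qed
    show "real K - 1 + \<beta> \<le> (\<Sum>s\<in>S. A s)"
    proof (rule le_if_le_add_small)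
      fix t :: real
      assume t: "0 < t"
      have "\<exists>h\<in>CG. q1 S (unit s - cobd h) < A s + t" for s
      proof -
        have "\<exists>m\<in>cobd_image. q1 S (unit s - m) < A s + t"
        proof (rule W.d2_less_witness)
          show "cobd_image \<noteq> {}" unfolding cobd_image_def using R.C_zero by blast
        qed (use t in \<open>simp add: A_def\<close>)
        then show ?thesis by (auto simp: cobd_image_def)
      qed
      then obtain h where h: "\<And>s. h s \<in> CG" "\<And>s. q1 S (unit s - cobd (h s)) < A s + t" by metis
      have "real K - 1 + \<beta> \<le> (\<Sum>s\<in>S. q1 S (unit s - cobd (h s)))" by (rule *[OF h(1)])
      also have "\<dots> \<le> (\<Sum>s\<in>S. A s + t)" using h(2) by (intro sum_mono less_imp_le)
      finally show "real K - 1 + \<beta> \<le> (\<Sum>s\<in>S. A s) + t * K" by (simp add: sum.distrib K_def mult.commute)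
    qed
  qed
  then show ?thesis by (simp add: A_def \<beta>_def K_def)
qed

end

end

section \<open>Dependence on the generators\<close>

context char_group
begin

text \<open>Induction on the word \<open>t\<close>. For a product, h t u - h is split as (h t u - h
  t) + (h t - h); for an inverse letter, minus the chain at \<open>s\<close> with coefficient
  \<open>rt (inv s) h\<close> works. The constant \<open>K\<close> depends on the word but not on
  \<open>h\<close>, which gives the control needed in \<open>cocycle_dim_le_insert\<close>.\<close>

lemma bounded_fill_generate:
  assumes S: "finite S" "S \<subseteq> carrier G" and t: "t \<in> generate G S"
  shows "\<exists>y K. 0 \<le> K \<and> (\<forall>h\<in>CG. y h \<in> tuples S CG \<and> gr_boundary G S (y h) = rt t h - h \<and>
           semi_inner.nrm (wip1 S) (y h) \<le> K * R.nrm h)"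
proof -
  interpret W: semi_inner "tuples S CG" "wip1 S" by (rule semi_inner_wip1)
  have nrm_single: "W.nrm (single s h) = R.nrm h" if "s \<in> S" "h \<in> CG" for s h
    unfolding W.nrm_def R.nrm_def W.q_def R.q_def using that S
    by (simp add: wip1_single) (simp add: single_def)
  show ?thesis
    using t
  proof (induction t)
    case one
    have "(0 :: 'a \<Rightarrow> 'a \<Rightarrow> complex) \<in> tuples S CG \<and> gr_boundary G S 0 = rt \<one> h - h \<and>
        W.nrm 0 \<le> 0 * R.nrm h" if "h \<in> CG" for h
      using that bd_zero[OF S] by simp
    then show ?case by (intro exI[of _ "\<lambda>_. 0 :: 'a \<Rightarrow> 'a \<Rightarrow> complex"] exI[of _ 0]) blast
  next
    case (incl s)
    then show ?case
      using S by (intro exI[of _ "single s"] exI[of _ 1]) (auto simp: bd_single nrm_single)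
  next
    case (inv s)
    then have s: "s \<in> S" "s \<in> carrier G" using S by auto
    have "- single s (rt (inv s) h) \<in> tuples S CG \<and>
        gr_boundary G S (- single s (rt (inv s) h)) = rt (inv s) h - h \<and>
        W.nrm (- single s (rt (inv s) h)) \<le> 1 * R.nrm h"
      if h: "h \<in> CG" for h
    proof (intro conjI)
      have x: "single s (rt (inv s) h) \<in> tuples S CG" using s h by simp
      then show "- single s (rt (inv s) h) \<in> tuples S CG" by (rule W.C_minus)
      show "W.nrm (- single s (rt (inv s) h)) \<le> 1 * R.nrm h"
        using W.nrm_minus[OF x] s h by (simp add: nrm_single nrm_rt)
      have "gr_boundary G S (- single s (rt (inv s) h)) = - (rt s (rt (inv s) h) - rt (inv s) h)"
        using bd_scale[OF S x, of "-1"] bd_single[OF S s(1), of "rt (inv s) h"] s h by simp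
      also have "\<dots> = rt (inv s) h - h" using s h by (simp add: rt_rt)
      finally show "gr_boundary G S (- single s (rt (inv s) h)) = rt (inv s) h - h" .
    qed
    then show ?case
      using zero_le_one by (intro exI[of _ "\<lambda>h. - single s (rt (inv s) h)"] exI[of _ 1]) blast
  next
    case (eng t u)
    have G: "t \<in> carrier G" "u \<in> carrier G"
      using eng.hyps generate_in_carrier[OF S(2)] by auto
    obtain y K where y: "0 \<le> K" "\<And>h. h \<in> CG \<Longrightarrow> y h \<in> tuples S CG"
        "\<And>h. h \<in> CG \<Longrightarrow> gr_boundary G S (y h) = rt t h - h" "\<And>h. h \<in> CG \<Longrightarrow> W.nrm (y h) \<le> K * R.nrm h"
      using eng.IH(1) by blast
    obtain y' K' where y': "0 \<le> K'" "\<And>h. h \<in> CG \<Longrightarrow> y' h \<in> tuples S CG"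
        "\<And>h. h \<in> CG \<Longrightarrow> gr_boundary G S (y' h) = rt u h - h" "\<And>h. h \<in> CG \<Longrightarrow> W.nrm (y' h) \<le> K' * R.nrm h"
      using eng.IH(2) by blast
    have "y h + y' (rt t h) \<in> tuples S CG \<and>
        gr_boundary G S (y h + y' (rt t h)) = rt (t \<otimes> u) h - h \<and>
        W.nrm (y h + y' (rt t h)) \<le> (K + K') * R.nrm h" if h: "h \<in> CG" for h
    proof (intro conjI)
      have C: "y h \<in> tuples S CG" "y' (rt t h) \<in> tuples S CG" using y(2) y'(2) h G by auto
      then show "y h + y' (rt t h) \<in> tuples S CG" by (rule W.C_add)
      show "gr_boundary G S (y h + y' (rt t h)) = rt (t \<otimes> u) h - h"
        unfolding bd_add[OF S C] using y(3)[OF h] y'(3)[of "rt t h"] h G by (simp add: rt_rt)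
      have "W.nrm (y h + y' (rt t h)) \<le> W.nrm (y h) + W.nrm (y' (rt t h))" by (rule W.nrm_triangle[OF C])
      also have "\<dots> \<le> K * R.nrm h + K' * R.nrm (rt t h)"
        using y(4)[OF h] y'(4)[of "rt t h"] h G by (intro add_mono) auto
      finally show "W.nrm (y h + y' (rt t h)) \<le> (K + K') * R.nrm h"
        using h G by (simp add: nrm_rt algebra_simps)
    qed
    moreover have "0 \<le> K + K'" using y(1) y'(1) by simp
    ultimately show ?case
      by (intro exI[of _ "\<lambda>h. y h + y' (rt t h)"] exI[of _ "K + K'"]) blast
  qed
qed

lemma fill_basis:
  assumes "finite S" "S \<subseteq> carrier G" "t \<in> generate G S" "g \<in> carrier G"
  obtains y where "y \<in> tuples S CG" "gr_boundary G S y = gr_basis (g \<otimes> t) - gr_basis g"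
  using bounded_fill_generate[OF assms(1-3)] assms(4) generate_in_carrier[OF assms(2,3)]
  by (metis CG_basis rt_basis)

lemma bd_image_mono:
  assumes S: "finite S" "S \<subseteq> carrier G" and T: "finite T" "T \<subseteq> generate G S"
  shows "bd_image T \<subseteq> bd_image S"
proof
  fix x assume "x \<in> bd_image T"
  then obtain f where f: "x = gr_boundary G T f" "f \<in> tuples T CG" by (auto simp: bd_image_def)
  have TG: "T \<subseteq> carrier G" using T generate_in_carrier[OF S(2)] by blast
  have "rt t (f t) - f t \<in> bd_image S" if "t \<in> T" for t
    using bounded_fill_generate[OF S, of t] that T(2) f(2) unfolding bd_image_def tuples_def
    by (smt (verit) image_eqI mem_Collect_eq subsetD)
  then show "x \<in> bd_image S"
    unfolding f(1) bd_eq[OF T(1) TG f(2)] by (intro subspace_sum subspace_bd_image[OF S])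
qed

text \<open>
  As \<open>1 - \<langle>P e\<^sub>s, e\<^sub>s\<rangle>\<close> is the squared distance of \<open>e\<^sub>s\<close> to the cycles, this is the dimension
  of their orthogonal complement.
\<close>

definition cocycle_dim :: "'a set \<Rightarrow> real" where
  "cocycle_dim S = (\<Sum>s\<in>S. wd2 S (\<lambda>_. 1) s (bd_cycles S))"

section \<open>The complement of the cycles under a change of generators\<close>

lemma bd_insert:
  assumes "finite S" "S \<subseteq> carrier G" "a \<in> carrier G" "a \<notin> S" "f \<in> tuples (insert a S) CG"
  shows "gr_boundary G (insert a S) f = (rt a (f a) - f a) + gr_boundary G S f"
proof -
  have "f \<in> tuples S CG" using assms(5) by (auto simp: tuples_def)
  then show ?thesis using assms by (simp add: bd_eq)
qed

text \<open>
  The weight \<open>t\<close> on the coordinates in \<open>S\<close> makes the component \<open>x\<close> of the cycle \<open>(x, b)\<close>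
  negligible for small \<open>t\<close>.
\<close>

lemma cocycle_dim_insert_le:
  assumes S: "finite S" "S \<subseteq> carrier G" and a: "a \<in> carrier G" "a \<notin> S"
    and M: "M \<noteq> {}" "M \<subseteq> bd_cycles S"
    and x: "x \<in> tuples S CG" and b: "b \<in> CG" and cycle: "gr_boundary G S x + (rt a b - b) = 0"
  shows "cocycle_dim (insert a S) \<le> (\<Sum>s\<in>S. wd2 S (\<lambda>_. 1) s M) + R.q (gr_basis \<one> - b)"
proof -
  interpret W: semi_inner "tuples S CG" "wip1 S" by (rule semi_inner_wip1)
  let ?S = "insert a S"
  have S': "finite ?S" "?S \<subseteq> carrier G" using S a by auto
  define w where "w t s = (if s = a then 1 else t)" for t :: real and s :: 'a
  have w: "0 < w t s" if "0 < t" for t s using that by (simp add: w_def)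
  have M_tuples: "M \<subseteq> tuples S CG" using M by (auto simp: bd_cycles_def)
  have q: "semi_inner.q (wip ?S (w t) rip) f = R.q (f a) + t * q1 S f" if "0 < t" for t f
  proof -
    have "semi_inner.q (wip ?S (w t) rip) f = (\<Sum>s\<in>?S. w t s * R.q (f s))"
      using w[OF that] by (intro R.q_wip) (simp add: less_imp_le)
    also have "\<dots> = R.q (f a) + (\<Sum>s\<in>S. t * R.q (f s))"
      using S a by (subst sum.insert) (auto simp: w_def intro!: sum.cong)
    finally show ?thesis by (simp add: q1_eq sum_distrib_left)
  qed
  have d: "wd2 ?S (w t) i (bd_cycles ?S) \<le> R.q (unit i a - f a) + t * q1 S (unit i - f)"
    if "0 < t" "f \<in> bd_cycles ?S" for t i f
  proof -
    interpret T: semi_inner "tuples ?S CG" "wip ?S (w t) rip"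
      by (rule R.semi_inner_wip) (use w[OF that(1)] in \<open>simp add: less_imp_le\<close>)
    have "T.d2 (unit i) (bd_cycles ?S) \<le> T.q (unit i - f)"
      using that by (intro T.d2_le) (auto simp: bd_cycles_def)
    then show ?thesis using q[OF that(1), of "unit i - f"] by simp
  qed
  have cong: "q1 S f = q1 S f'" if "\<And>s. s \<in> S \<Longrightarrow> f s = f' s" for f f'
    unfolding q1_eq using that by (intro sum.cong) auto
  have bd_cong: "gr_boundary G S f = gr_boundary G S f'" if "\<And>s. s \<in> S \<Longrightarrow> f s = f' s" for f f'
    unfolding gr_boundary_def using that by (intro ext if_cong sum.cong refl) auto
  have upd: "f(a := h) \<in> tuples ?S CG" if "f \<in> tuples S CG" "h \<in> CG" for f h
    using that by (auto simp: tuples_def)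
  have bd_upd: "gr_boundary G ?S (f(a := h)) = (rt a h - h) + gr_boundary G S f"
    if "f \<in> tuples S CG" "h \<in> CG" for f h
  proof -
    have "gr_boundary G S (f(a := h)) = gr_boundary G S f" using a by (intro bd_cong) auto
    then show ?thesis using bd_insert[OF S a upd[OF that]] by simp
  qed
  have main: "cocycle_dim ?S \<le> (\<Sum>s\<in>S. q1 S (unit s - m s)) + R.q (gr_basis \<one> - b)"
    if m: "\<And>s. m s \<in> M" for m
  proof (rule le_if_le_add_small)
    fix t :: real
    assume t: "0 < t"
    have "cocycle_dim ?S = (\<Sum>s\<in>?S. wd2 ?S (w t) s (bd_cycles ?S) / w t s)"
      unfolding cocycle_dim_def
      by (rule sum_weighted_distances[OF S'(1) w[OF t] invariant_bd_cycles[OF S'], symmetric])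
    also have "\<dots> = wd2 ?S (w t) a (bd_cycles ?S) + (\<Sum>s\<in>S. wd2 ?S (w t) s (bd_cycles ?S) / t)"
      using S a by (subst sum.insert) (auto simp: w_def intro!: sum.cong)
    \<comment> \<open>The cycle \<open>x(a := b)\<close> serves for the new coordinate, whose weight
      is 1, and elements of \<open>M\<close> extended by 0 serve for the old ones, where the weight
      \<open>t\<close> cancels against the division by \<open>t\<close>.\<close>
    also have "\<dots> \<le> (R.q (gr_basis \<one> - b) + t * q1 S (unit a - x)) + (\<Sum>s\<in>S. q1 S (unit s - m s))"
    proof (intro add_mono sum_mono)
      have c: "x(a := b) \<in> bd_cycles ?S"
        unfolding bd_cycles_def using upd[OF x b] bd_upd[OF x b] cycle by (simp add: add.commute)
      have "q1 S (unit a - x(a := b)) = q1 S (unit a - x)" using a by (intro cong) auto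
      moreover have "unit a a - (x(a := b)) a = gr_basis \<one> - b" by (simp add: unit_def)
      ultimately show "wd2 ?S (w t) a (bd_cycles ?S) \<le> R.q (gr_basis \<one> - b) + t * q1 S (unit a - x)"
        using d[OF t c, of a] by simp
      fix s assume s: "s \<in> S"
      have ms: "m s \<in> tuples S CG" "gr_boundary G S (m s) = 0" using m[of s] M by (auto simp: bd_cycles_def)
      have "(m s)(a := 0) \<in> bd_cycles ?S"
        unfolding bd_cycles_def using upd[OF ms(1)] bd_upd[OF ms(1)] ms(2) by (simp add: rt_linear)
      from d[OF t this, of s] have "wd2 ?S (w t) s (bd_cycles ?S) \<le>
          R.q (unit s a - ((m s)(a := 0)) a) + t * q1 S (unit s - (m s)(a := 0))" .
      moreover have "unit s a - ((m s)(a := 0)) a = 0" using a s by (auto simp: unit_def)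
      moreover have "q1 S (unit s - (m s)(a := 0)) = q1 S (unit s - m s)" using a by (intro cong) auto
      ultimately have "wd2 ?S (w t) s (bd_cycles ?S) \<le> t * q1 S (unit s - m s)" by simp
      then show "wd2 ?S (w t) s (bd_cycles ?S) / t \<le> q1 S (unit s - m s)"
        using t by (simp add: field_simps)
    qed
    finally show "cocycle_dim ?S \<le> (\<Sum>s\<in>S. q1 S (unit s - m s)) + R.q (gr_basis \<one> - b) + t * q1 S (unit a - x)"
      by simp
  qed
  show ?thesis
  proof (rule le_if_le_add_small)
    fix t :: real
    assume t: "0 < t"
    have "\<exists>m\<in>M. q1 S (unit s - m) < wd2 S (\<lambda>_. 1) s M + t" for s
      using t by (intro W.d2_less_witness M) simp
    then obtain m where m: "\<And>s. m s \<in> M" "\<And>s. q1 S (unit s - m s) < wd2 S (\<lambda>_. 1) s M + t" by metis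
    have "cocycle_dim ?S \<le> (\<Sum>s\<in>S. q1 S (unit s - m s)) + R.q (gr_basis \<one> - b)" by (rule main[OF m(1)])
    also have "\<dots> \<le> (\<Sum>s\<in>S. wd2 S (\<lambda>_. 1) s M + t) + R.q (gr_basis \<one> - b)"
      using m(2) by (intro add_right_mono sum_mono less_imp_le)
    finally show "cocycle_dim ?S \<le> (\<Sum>s\<in>S. wd2 S (\<lambda>_. 1) s M) + R.q (gr_basis \<one> - b) + t * card S"
      by (simp add: sum.distrib mult.commute)
  qed
qed

text \<open>Filling the coordinate at \<open>a\<close> by a chain over \<open>S\<close> sends a
  cycle \<open>m\<close> over \<open>insert a S\<close> to the cycle \<open>m + y (m a)\<close> over
  \<open>S\<close>. With a small weight on the old coordinates, the filling costs at most a factor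
  \<open>1 + K * t\<close> in the distance to \<open>unit s\<close>, and this factor disappears as
  \<open>t\<close> tends to 0.\<close>

lemma cocycle_dim_le_insert:
  assumes S: "finite S" "S \<subseteq> carrier G" and a: "a \<in> generate G S" "a \<notin> S"
  shows "cocycle_dim S \<le> cocycle_dim (insert a S)"
proof -
  interpret W: semi_inner "tuples S CG" "wip1 S" by (rule semi_inner_wip1)
  let ?S = "insert a S"
  have aG: "a \<in> carrier G" using generate_in_carrier[OF S(2) a(1)] .
  have S': "finite ?S" "?S \<subseteq> carrier G" using S aG by auto
  obtain y K where K: "0 \<le> K" and y: "\<And>h. h \<in> CG \<Longrightarrow> y h \<in> tuples S CG"
    "\<And>h. h \<in> CG \<Longrightarrow> gr_boundary G S (y h) = rt a h - h" "\<And>h. h \<in> CG \<Longrightarrow> W.nrm (y h) \<le> K * R.nrm h"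
    using bounded_fill_generate[OF S a(1)] by blast
  \<comment> \<open>With the square, the old coordinates enter the seminorm itself with the factor
    \<open>t\<close>.\<close>
  define w where "w t s = (if s = a then 1 else t\<^sup>2)" for t :: real and s :: 'a
  have w: "0 < w t s" if "0 < t" for t s using that by (simp add: w_def)
  have bd_cycles_S: "bd_cycles S \<subseteq> tuples S CG" by (auto simp: bd_cycles_def)
  have q: "semi_inner.q (wip ?S (w t) rip) f = R.q (f a) + t\<^sup>2 * q1 S f" if "0 < t" for t f
  proof -
    have "semi_inner.q (wip ?S (w t) rip) f = (\<Sum>s\<in>?S. w t s * R.q (f s))"
      using w[OF that] by (intro R.q_wip) (simp add: less_imp_le)
    also have "\<dots> = R.q (f a) + (\<Sum>s\<in>S. t\<^sup>2 * R.q (f s))"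
      using S a by (subst sum.insert) (auto simp: w_def intro!: sum.cong)
    finally show ?thesis by (simp add: q1_eq sum_distrib_left)
  qed
  have key: "wd2 S (\<lambda>_. 1) s (bd_cycles S) \<le> (1 + K * t)\<^sup>2 * (wd2 ?S (w t) s (bd_cycles ?S) / t\<^sup>2)"
    if t: "0 < t" and s: "s \<in> S" for t s
  proof -
    interpret T: semi_inner "tuples ?S CG" "wip ?S (w t) rip"
      by (rule R.semi_inner_wip) (use w[OF t] in \<open>simp add: less_imp_le\<close>)
    let ?D = "wd2 S (\<lambda>_. 1) s (bd_cycles S)"
    have "t\<^sup>2 * ?D / (1 + K * t)\<^sup>2 \<le> T.d2 (unit s) (bd_cycles ?S)"
    proof (rule T.d2_ge)
      show "bd_cycles ?S \<noteq> {}" using zero_bd_cycles[OF S'] by blast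
      fix m assume "m \<in> bd_cycles ?S"
      then have m: "m \<in> tuples ?S CG" "gr_boundary G ?S m = 0" by (auto simp: bd_cycles_def)
      have ma: "m a \<in> CG" and mS: "m \<in> tuples S CG" using m(1) by (auto simp: tuples_def)
      let ?z = "m + y (m a)"
      have yC: "y (m a) \<in> tuples S CG" by (rule y(1)[OF ma])
      have "gr_boundary G S ?z = 0"
        unfolding bd_add[OF S mS yC] y(2)[OF ma]
        using bd_insert[OF S aG a(2) m(1)] m(2) by (simp add: add.commute)
      then have z: "?z \<in> bd_cycles S" unfolding bd_cycles_def using W.C_add[OF mS yC] by simp
      \<comment> \<open>The weighted norm of \<open>unit s - m\<close>. It bounds the coordinate at
        \<open>a\<close>, where \<open>unit s\<close> vanishes, as well as \<open>t\<close> times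
        the norm over \<open>S\<close>.\<close>
      define A where "A = sqrt (T.q (unit s - m))"
      have "q1 S (unit s - m) \<ge> 0" using W.C_diff[OF unit_tuples mS] by (rule W.q_nonneg)
      moreover have "R.q ((unit s - m) a) \<ge> 0" using ma s a by (auto simp: unit_def intro!: R.q_nonneg)
      ultimately have A2: "A\<^sup>2 = R.q ((unit s - m) a) + t\<^sup>2 * q1 S (unit s - m)" "A \<ge> 0"
        unfolding A_def q[OF t] by auto
      have "(unit s - m) a = - m a" using s a by (auto simp: unit_def)
      then have qa: "R.q ((unit s - m) a) = R.q (m a)" using R.q_scale[OF ma, of "-1"] by simp
      have "R.nrm (m a) \<le> A"
        unfolding R.nrm_def A_def q[OF t] qa using \<open>q1 S (unit s - m) \<ge> 0\<close> by simp
      moreover have "t * W.nrm (unit s - m) \<le> A"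
        unfolding W.nrm_def A_def q[OF t] using \<open>R.q ((unit s - m) a) \<ge> 0\<close> t
        by (intro real_le_rsqrt) (simp add: power_mult_distrib \<open>q1 S (unit s - m) \<ge> 0\<close>)
      moreover have "W.nrm (unit s - ?z) \<le> W.nrm (unit s - m) + K * R.nrm (m a)"
      proof -
        have "W.nrm (unit s - ?z) \<le> W.nrm (unit s - m) + W.nrm (y (m a))"
          using W.nrm_triangle_diff[OF W.C_diff[OF unit_tuples mS] yC] by (simp add: diff_diff_eq)
        then show ?thesis using y(3)[OF ma] by linarith
      qed
      moreover from this have "t * W.nrm (unit s - ?z) \<le> t * (W.nrm (unit s - m) + K * R.nrm (m a))"
        using t by (intro mult_left_mono) auto
      moreover have "t * (K * R.nrm (m a)) \<le> t * (K * A)"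
        using t K \<open>R.nrm (m a) \<le> A\<close> by (intro mult_left_mono) auto
      ultimately have "t * W.nrm (unit s - ?z) \<le> A + t * (K * A)"
        by (simp only: distrib_left)
      then have "t * W.nrm (unit s - ?z) \<le> A * (1 + K * t)" by (simp add: algebra_simps)
      moreover have "0 \<le> t * W.nrm (unit s - ?z)"
        using t W.nrm_nonneg[OF W.C_diff[OF unit_tuples W.C_add[OF mS yC]]] by simp
      ultimately have "(t * W.nrm (unit s - ?z))\<^sup>2 \<le> (A * (1 + K * t))\<^sup>2" by (rule power_mono)
      then have "t\<^sup>2 * q1 S (unit s - ?z) \<le> A\<^sup>2 * (1 + K * t)\<^sup>2"
        by (simp only: power_mult_distrib W.nrm_sq[OF W.C_diff[OF unit_tuples W.C_add[OF mS yC]]])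
      moreover have "t\<^sup>2 * ?D \<le> t\<^sup>2 * q1 S (unit s - ?z)"
        using z bd_cycles_S by (intro mult_left_mono W.d2_le) auto
      ultimately have "t\<^sup>2 * ?D \<le> A\<^sup>2 * (1 + K * t)\<^sup>2" by linarith
      moreover have "0 < (1 + K * t)\<^sup>2"
        using K t by (intro zero_less_power add_pos_nonneg mult_nonneg_nonneg) auto
      moreover have "A\<^sup>2 = T.q (unit s - m)" using A2 q[OF t, of "unit s - m"] by simp
      ultimately show "t\<^sup>2 * ?D / (1 + K * t)\<^sup>2 \<le> T.q (unit s - m)" by (simp add: pos_divide_le_eq)
    qed
    moreover have "0 < (1 + K * t)\<^sup>2"
      using K t by (intro zero_less_power add_pos_nonneg mult_nonneg_nonneg) auto
    ultimately show ?thesis using t by (simp add: pos_divide_le_eq pos_le_divide_eq mult.commute)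
  qed
  have ineq: "cocycle_dim S \<le> (1 + K * t)\<^sup>2 * cocycle_dim ?S" if t: "0 < t" for t
  proof -
    interpret T: semi_inner "tuples ?S CG" "wip ?S (w t) rip"
      by (rule R.semi_inner_wip) (use w[OF t] in \<open>simp add: less_imp_le\<close>)
    have "cocycle_dim S \<le> (\<Sum>s\<in>S. (1 + K * t)\<^sup>2 * (wd2 ?S (w t) s (bd_cycles ?S) / t\<^sup>2))"
      unfolding cocycle_dim_def by (intro sum_mono key t)
    also have "\<dots> = (1 + K * t)\<^sup>2 * (\<Sum>s\<in>S. wd2 ?S (w t) s (bd_cycles ?S) / w t s)"
      unfolding sum_distrib_left using a by (intro sum.cong) (auto simp: w_def)
    \<comment> \<open>The summand at \<open>a\<close>, which is nonnegative, is added.\<close>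
    also have "\<dots> \<le> (1 + K * t)\<^sup>2 * (\<Sum>s\<in>?S. wd2 ?S (w t) s (bd_cycles ?S) / w t s)"
    proof (intro mult_left_mono sum_mono2)
      fix s
      have "0 \<le> T.d2 (unit s) (bd_cycles ?S)"
      proof (rule T.d2_nonneg)
        show "bd_cycles ?S \<noteq> {}" using zero_bd_cycles[OF S'] by blast
      qed (auto simp: bd_cycles_def)
      then show "0 \<le> wd2 ?S (w t) s (bd_cycles ?S) / w t s" using w[OF t, of s] by simp
    qed (use S in auto)
    also have "(\<Sum>s\<in>?S. wd2 ?S (w t) s (bd_cycles ?S) / w t s) = cocycle_dim ?S"
      unfolding cocycle_dim_def
      by (rule sum_weighted_distances[OF S'(1) w[OF t] invariant_bd_cycles[OF S']])
    finally show ?thesis .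
  qed
  have "((\<lambda>t. (1 + K * t)\<^sup>2 * cocycle_dim ?S) \<longlongrightarrow> (1 + K * 0)\<^sup>2 * cocycle_dim ?S) (at_right 0)"
    by (intro tendsto_intros)
  then have "cocycle_dim S \<le> (1 + K * 0)\<^sup>2 * cocycle_dim ?S"
    by (rule tendsto_lowerbound) (auto intro!: eventually_at_rightI[of 0 1] ineq)
  then show ?thesis by simp
qed

text \<open>For \<open>\<le>\<close>: as \<open>a\<close> is a word in \<open>S\<close>, there is a
  cycle whose coordinate at \<open>a\<close> is exactly the unit, and the error term of
  \<open>cocycle_dim_insert_le\<close> vanishes.\<close>

lemma cocycle_dim_insert_generate:
  assumes S: "finite S" "S \<subseteq> carrier G" and a: "a \<in> generate G S"
  shows "cocycle_dim (insert a S) = cocycle_dim S"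
proof (cases "a \<in> S")
  case False
  have aG: "a \<in> carrier G" using generate_in_carrier[OF S(2) a] .
  obtain y where y: "y \<in> tuples S CG" "gr_boundary G S y = gr_basis (\<one> \<otimes> a) - gr_basis \<one>"
    using fill_basis[OF S a one_closed] .
  have "cocycle_dim (insert a S) \<le> (\<Sum>s\<in>S. wd2 S (\<lambda>_. 1) s (bd_cycles S)) + R.q (gr_basis \<one> - gr_basis \<one>)"
  proof (rule cocycle_dim_insert_le[OF S aG False])
    interpret W: semi_inner "tuples S CG" "wip1 S" by (rule semi_inner_wip1)
    show "- y \<in> tuples S CG" using y(1) by (rule W.C_minus)
    show "gr_boundary G S (- y) + (rt a (gr_basis \<one>) - gr_basis \<one>) = 0"
      using bd_scale[OF S y(1), of "-1"] y(2) aG by (simp add: rt_basis)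
  qed (use zero_bd_cycles[OF S] in auto)
  then show ?thesis using cocycle_dim_le_insert[OF S a False] by (simp add: cocycle_dim_def)
qed (simp add: insert_absorb)

text \<open>Both sets are compared with their union, which is reached by adding one redundant
  generator at a time.\<close>

lemma cocycle_dim_indep:
  assumes S: "finite S" "S \<subseteq> carrier G" "generate G S = carrier G"
    and T: "finite T" "T \<subseteq> carrier G" "generate G T = carrier G"
  shows "cocycle_dim S = cocycle_dim T"
proof -
  have "cocycle_dim (S \<union> T) = cocycle_dim S"
    if S: "finite S" "S \<subseteq> carrier G" "generate G S = carrier G" and T: "finite T" "T \<subseteq> carrier G" for S T
    using T
  proof (induction T)
    case (insert a T)
    have "a \<in> generate G (S \<union> T)" using mono_generate[of S "S \<union> T"] insert S by auto
    then show ?case using cocycle_dim_insert_generate[of "S \<union> T" a] insert S by auto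
  qed simp
  from this[OF S T(1,2)] this[OF T S(1,2)] show ?thesis by (simp add: Un_commute)
qed

end

section \<open>Computing Betti numbers in the group ring\<close>

context semi_inner
begin

lemma cauchy_add:
  assumes "cauchy X" "cauchy Y"
  shows "cauchy (\<lambda>n. X n + Y n)"
proof -
  have "cauchy (\<lambda>n. 0 - Y n)" by (rule cauchy_diff[OF cauchy_const assms(2)]) simp
  from cauchy_diff[OF assms(1) this] show ?thesis by simp
qed

lemma cauchy_nrm_convergent:
  assumes "cauchy X"
  shows "\<exists>l. (\<lambda>n. nrm (X n)) \<longlonglongrightarrow> l"
proof -
  have "Cauchy (\<lambda>n. nrm (X n))"
  proof (rule metric_CauchyI)
    fix e :: real
    assume "0 < e"
    then obtain N where N: "\<And>m n. m \<ge> N \<Longrightarrow> n \<ge> N \<Longrightarrow> nrm (X m - X n) < e"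
      using assms unfolding cauchy_def by metis
    have "dist (nrm (X m)) (nrm (X n)) < e" if "m \<ge> N" "n \<ge> N" for m n
      using nrm_triangle[of "X m - X n" "X n"] nrm_triangle[of "X n - X m" "X m"]
        N[OF that] N[OF that(2,1)] assms by (simp add: dist_real_def)
    then show "\<exists>N. \<forall>m\<ge>N. \<forall>n\<ge>N. dist (nrm (X m)) (nrm (X n)) < e" by blast
  qed
  then show ?thesis using Cauchy_convergent convergent_def by blast
qed

lemma cauchy_B_convergent:
  assumes "cauchy X" "cauchy Y"
  shows "\<exists>l. (\<lambda>n. B (X n) (Y n)) \<longlonglongrightarrow> l"
proof -
  obtain a b c where lims: "(\<lambda>n. nrm (X n + Y n)) \<longlonglongrightarrow> a" "(\<lambda>n. nrm (X n)) \<longlonglongrightarrow> b" "(\<lambda>n. nrm (Y n)) \<longlonglongrightarrow> c"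
    using cauchy_nrm_convergent cauchy_add assms by metis
  have "(\<lambda>n. ((nrm (X n + Y n))\<^sup>2 - (nrm (X n))\<^sup>2 - (nrm (Y n))\<^sup>2) / 2) \<longlonglongrightarrow> (a\<^sup>2 - b\<^sup>2 - c\<^sup>2) / 2"
    by (intro tendsto_intros lims) simp
  moreover have "((nrm (X n + Y n))\<^sup>2 - (nrm (X n))\<^sup>2 - (nrm (Y n))\<^sup>2) / 2 = B (X n) (Y n)" for n
    using assms by (simp add: nrm_sq q_add)
  ultimately show ?thesis by auto
qed

lemma tendsto_nrm_null_triangle:
  assumes "(\<lambda>n. nrm (X n - Y n)) \<longlonglongrightarrow> 0" "(\<lambda>n. nrm (Y n - Z n)) \<longlonglongrightarrow> 0"
    "\<And>n. X n \<in> C" "\<And>n. Y n \<in> C" "\<And>n. Z n \<in> C"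
  shows "(\<lambda>n. nrm (X n - Z n)) \<longlonglongrightarrow> 0"
proof (rule Lim_null_comparison)
  show "\<forall>\<^sub>F n in sequentially. norm (nrm (X n - Z n)) \<le> nrm (X n - Y n) + nrm (Y n - Z n)"
    using nrm_triangle_via assms(3-5) by (intro always_eventually allI) simp
  show "(\<lambda>n. nrm (X n - Y n) + nrm (Y n - Z n)) \<longlonglongrightarrow> 0"
    using tendsto_add[OF assms(1,2)] by simp
qed

text \<open>The sequence \<open>a\<close> stands for a vector in the closure of \<open>M\<close>:
  some fixed \<open>m\<close> is eventually close to its terms, and
  \<open>proj_seq_orthogonal\<close> applies to that \<open>m\<close>.\<close>

lemma proj_seq_orthogonal_closure:
  assumes "subspace M" "M \<subseteq> C" "e \<in> C" "proj_seq e M z" "\<And>n. a n \<in> C"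
    and approx: "\<And>\<epsilon>. 0 < \<epsilon> \<Longrightarrow> \<exists>m\<in>M. \<forall>\<^sub>F n in sequentially. nrm (a n - m) < \<epsilon>"
  shows "(\<lambda>n. B (e - z n) (a n)) \<longlonglongrightarrow> 0"
proof (rule tendstoI)
  fix \<epsilon> :: real
  assume \<epsilon>: "0 < \<epsilon>"
  note zz = assms(1-4)
  have "cauchy (\<lambda>n. e - z n)" by (rule cauchy_diff[OF cauchy_const[OF assms(3)] proj_seq_cauchy[OF zz]])
  then obtain K where K: "K > 0" "\<And>n. nrm (e - z n) \<le> K"
    using nrm_bounded_pos[OF cauchy_bounded] by blast
  obtain m where m: "m \<in> M" "\<forall>\<^sub>F n in sequentially. nrm (a n - m) < \<epsilon> / (2 * K)"
    using approx[of "\<epsilon> / (2 * K)"] \<epsilon> K by auto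
  have mC: "m \<in> C" using m(1) assms(2) by blast
  have zC: "e - z n \<in> C" for n using proj_seq_in_C[OF zz] assms(3) by simp
  have "(\<lambda>n. B (e - z n) m) \<longlonglongrightarrow> 0"
    by (rule proj_seq_orthogonal[OF zz m(1) nrm_boundedI[OF mC order_refl]])
  then have "\<forall>\<^sub>F n in sequentially. \<bar>B (e - z n) m\<bar> < \<epsilon> / 2"
    using \<epsilon> by (auto dest!: tendstoD[where e = "\<epsilon> / 2"] simp: dist_real_def)
  with m(2) show "\<forall>\<^sub>F n in sequentially. dist (B (e - z n) (a n)) 0 < \<epsilon>"
  proof eventually_elim
    case (elim n)
    have "\<bar>B (e - z n) (a n - m)\<bar> \<le> nrm (e - z n) * nrm (a n - m)"
      using zC mC assms(5) by (intro cauchy_schwarz) auto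
    also have "\<dots> \<le> K * (\<epsilon> / (2 * K))"
      using K elim(1) mC assms(5) zC by (intro mult_mono) auto
    also have "\<dots> = \<epsilon> / 2" using K by simp
    finally have "\<bar>B (e - z n) (a n) - B (e - z n) m\<bar> \<le> \<epsilon> / 2"
      using zC[of n] mC assms(5)[of n] by (simp add: diff_right)
    then show ?case using elim(2) unfolding dist_real_def by linarith
  qed
qed

end

context char_group
begin

abbreviation "GR \<equiv> group_ring G \<psi>"

section \<open>The completion in terms of representing sequences\<close>

definition cls :: "(nat \<Rightarrow> 'a \<Rightarrow> complex) \<Rightarrow> (nat \<Rightarrow> 'a \<Rightarrow> complex) set" where
  "cls X = null_rel GR `` {X}"

lemma vdiff_GR [simp]: "vdiff GR x y = x - y"
  by (simp add: vdiff_def group_ring_def fun_eq_iff)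

lemma vnorm_GR [simp]: "vnorm GR x = R.nrm x"
  by (simp add: vnorm_def R.nrm_def R.q_def rip_def)

lemma cauchy_seqs_GR: "cauchy_seqs GR = {X. R.cauchy X}"
  unfolding cauchy_seqs_def R.cauchy_def CG_def[symmetric] vdiff_GR vnorm_GR ..

lemma null_rel_GR:
  "(X, Y) \<in> null_rel GR \<longleftrightarrow> R.cauchy X \<and> R.cauchy Y \<and> (\<lambda>n. R.nrm (X n - Y n)) \<longlonglongrightarrow> 0"
  by (simp add: null_rel_def cauchy_seqs_GR)

lemma mem_cls: "Y \<in> cls X \<longleftrightarrow> R.cauchy X \<and> R.cauchy Y \<and> (\<lambda>n. R.nrm (X n - Y n)) \<longlonglongrightarrow> 0"
  by (simp add: cls_def null_rel_GR)

lemma cls_self: "R.cauchy X \<Longrightarrow> X \<in> cls X"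
  by (simp add: mem_cls)

lemma cls_eqI:
  assumes "R.cauchy X" "R.cauchy Y" "(\<lambda>n. R.nrm (X n - Y n)) \<longlonglongrightarrow> 0"
  shows "cls X = cls Y"
proof -
  have *: "(\<lambda>n. R.nrm (Y n - X n)) \<longlonglongrightarrow> 0"
    using assms(3) by (simp add: R.nrm_diff_commute[OF R.cauchy_C[OF assms(1)] R.cauchy_C[OF assms(2)]])
  have "R.cauchy Z \<and> (\<lambda>n. R.nrm (X n - Z n)) \<longlonglongrightarrow> 0 \<longleftrightarrow> R.cauchy Z \<and> (\<lambda>n. R.nrm (Y n - Z n)) \<longlonglongrightarrow> 0" for Z
    using R.tendsto_nrm_null_triangle[OF assms(3), of Z] R.tendsto_nrm_null_triangle[OF *, of Z]
      R.cauchy_C[OF assms(1)] R.cauchy_C[OF assms(2)] R.cauchy_C[of Z] by blast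
  then show ?thesis using assms(1,2) unfolding set_eq_iff mem_cls by blast
qed

lemma cls_eq_iff:
  assumes "R.cauchy X" "R.cauchy Y"
  shows "cls X = cls Y \<longleftrightarrow> (\<lambda>n. R.nrm (X n - Y n)) \<longlonglongrightarrow> 0"
proof
  assume "cls X = cls Y"
  then have "Y \<in> cls X" using cls_self[OF assms(2)] by simp
  then show "(\<lambda>n. R.nrm (X n - Y n)) \<longlonglongrightarrow> 0" by (simp add: mem_cls)
qed (rule cls_eqI[OF assms])

lemma carrier_ell: "carrier (ell G \<psi>) = cls ` {X. R.cauchy X}"
  by (auto simp: ell_def completion_def cauchy_seqs_GR quotient_def cls_def)

lemma vzero_ell: "vzero (ell G \<psi>) = cls (\<lambda>_. 0)"
  by (simp add: ell_def completion_def cls_def group_ring_def zero_fun_def)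

lemma embed_eq: "embed GR x = cls (\<lambda>_. x)"
  by (simp add: embed_def cls_def)

lemma cauchy_csc:
  assumes "R.cauchy X"
  shows "R.cauchy (\<lambda>n. csc c (X n))"
  unfolding R.cauchy_def
proof
  show "\<forall>n. csc c (X n) \<in> CG" using assms by simp
  have "R.nrm (csc c x - csc c y) = cmod c * R.nrm (x - y)" if "x \<in> CG" "y \<in> CG" for x y
    using q_csc[of "x - y" c] that by (simp add: R.nrm_def csc_linear real_sqrt_mult)
  then show "\<forall>e>0. \<exists>N. \<forall>m\<ge>N. \<forall>n\<ge>N. R.nrm (csc c (X m) - csc c (X n)) < e"
    using assms by (intro R.cauchy_of_bound[OF assms, where K = "cmod c" and nrm' = R.nrm and
          Y = "\<lambda>n. csc c (X n)"]) simp
qed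

lemma vadd_ell:
  assumes "R.cauchy X" "R.cauchy Y"
  shows "vadd (ell G \<psi>) (cls X) (cls Y) = cls (\<lambda>n. X n + Y n)"
proof -
  have "cls (\<lambda>n. X' n + Y' n) = cls (\<lambda>n. X n + Y n)" if X': "X' \<in> cls X" and Y': "Y' \<in> cls Y" for X' Y'
  proof (rule cls_eqI)
    show "R.cauchy (\<lambda>n. X' n + Y' n)" "R.cauchy (\<lambda>n. X n + Y n)"
      using that assms by (auto simp: mem_cls intro: R.cauchy_add)
    have C: "X n \<in> CG" "Y n \<in> CG" "X' n \<in> CG" "Y' n \<in> CG" for n
      using that assms by (auto simp: mem_cls)
    show "(\<lambda>n. R.nrm (X' n + Y' n - (X n + Y n))) \<longlonglongrightarrow> 0"
    proof (rule Lim_null_comparison)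
      have "R.nrm (X' n + Y' n - (X n + Y n)) \<le> R.nrm (X n - X' n) + R.nrm (Y n - Y' n)" for n
        using R.nrm_triangle[of "X' n - X n" "Y' n - Y n"] C
          R.nrm_diff_commute[of "X n" "X' n"] R.nrm_diff_commute[of "Y n" "Y' n"]
        by (simp add: add_diff_add)
      then show "\<forall>\<^sub>F n in sequentially. norm (R.nrm (X' n + Y' n - (X n + Y n))) \<le> R.nrm (X n - X' n) + R.nrm (Y n - Y' n)"
        using C by (intro always_eventually allI) simp
      show "(\<lambda>n. R.nrm (X n - X' n) + R.nrm (Y n - Y' n)) \<longlonglongrightarrow> 0"
        using that tendsto_add[of "\<lambda>n. R.nrm (X n - X' n)" 0 sequentially "\<lambda>n. R.nrm (Y n - Y' n)" 0]
        by (simp add: mem_cls)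
    qed
  qed
  moreover have "vadd (ell G \<psi>) (cls X) (cls Y) = (\<Union>X'\<in>cls X. \<Union>Y'\<in>cls Y. cls (\<lambda>n. X' n + Y' n))"
    by (simp add: ell_def completion_def cls_def group_ring_def plus_fun_def)
  ultimately show ?thesis using cls_self assms by blast
qed

lemma vscale_ell:
  assumes "R.cauchy X"
  shows "vscale (ell G \<psi>) c (cls X) = cls (\<lambda>n. csc c (X n))"
proof -
  have "cls (\<lambda>n. csc c (X' n)) = cls (\<lambda>n. csc c (X n))" if X': "X' \<in> cls X" for X'
  proof (rule cls_eqI)
    have X'': "R.cauchy X'" using that by (simp add: mem_cls)
    then show "R.cauchy (\<lambda>n. csc c (X' n))" "R.cauchy (\<lambda>n. csc c (X n))"
      using assms by (auto intro: cauchy_csc)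
    have "R.nrm (csc c (X' n) - csc c (X n)) = cmod c * R.nrm (X n - X' n)" for n
      using q_csc[of "X' n - X n" c] R.cauchy_C[OF X'', of n] R.cauchy_C[OF assms, of n]
        R.nrm_diff_commute[of "X n" "X' n"]
      by (simp add: R.nrm_def csc_linear real_sqrt_mult)
    then show "(\<lambda>n. R.nrm (csc c (X' n) - csc c (X n))) \<longlonglongrightarrow> 0"
      using that tendsto_mult_left[of _ 0 sequentially "cmod c"] by (simp add: mem_cls)
  qed
  moreover have "vscale (ell G \<psi>) c (cls X) = (\<Union>X'\<in>cls X. cls (\<lambda>n. csc c (X' n)))"
    by (simp add: ell_def completion_def cls_def group_ring_def csc_def)
  ultimately show ?thesis using cls_self assms by blast
qed

lemma vdiff_ell:
  assumes "R.cauchy X" "R.cauchy Y"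
  shows "vdiff (ell G \<psi>) (cls X) (cls Y) = cls (\<lambda>n. X n - Y n)"
proof -
  have "X n + csc (-1) (Y n) = X n - Y n" for n by (simp add: csc_def fun_eq_iff)
  then show ?thesis
    unfolding vdiff_def vscale_ell[OF assms(2)] vadd_ell[OF assms(1) cauchy_csc[OF assms(2)]] by simp
qed

lemma cip_convergent:
  assumes "R.cauchy X" "R.cauchy Y"
  shows "\<exists>c. (\<lambda>n. cip (X n) (Y n)) \<longlonglongrightarrow> c"
proof -
  obtain a b where "(\<lambda>n. rip (X n) (Y n)) \<longlonglongrightarrow> a" "(\<lambda>n. rip (X n) (csc \<i> (Y n))) \<longlonglongrightarrow> b"
    using R.cauchy_B_convergent assms cauchy_csc by metis
  then have "(\<lambda>n. cip (X n) (Y n)) \<longlonglongrightarrow> Complex a b"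
    using assms by (simp add: tendsto_complex_iff Im_cip rip_def)
  then show ?thesis by blast
qed

lemma cip_diff_null:
  assumes "X' \<in> cls X" "Y' \<in> cls Y"
  shows "(\<lambda>n. cip (X' n) (Y' n) - cip (X n) (Y n)) \<longlonglongrightarrow> 0"
proof -
  have cauchy: "R.cauchy X" "R.cauchy Y" "R.cauchy X'" "R.cauchy Y'"
    and lims: "(\<lambda>n. R.nrm (X n - X' n)) \<longlonglongrightarrow> 0" "(\<lambda>n. R.nrm (Y n - Y' n)) \<longlonglongrightarrow> 0"
    using assms by (auto simp: mem_cls)
  have C: "X n \<in> CG" "Y n \<in> CG" "X' n \<in> CG" "Y' n \<in> CG" for n using cauchy by auto
  have real: "(\<lambda>n. rip (U' n) (V' n) - rip (U n) (V n)) \<longlonglongrightarrow> 0"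
    if "R.cauchy U" "R.cauchy V" "R.cauchy U'" "R.cauchy V'"
      "(\<lambda>n. R.nrm (U n - U' n)) \<longlonglongrightarrow> 0" "(\<lambda>n. R.nrm (V n - V' n)) \<longlonglongrightarrow> 0" for U V U' V'
  proof -
    have C: "U n \<in> CG" "V n \<in> CG" "U' n \<in> CG" "V' n \<in> CG" for n using that by auto
    have 1: "(\<lambda>n. rip (U n - U' n) (V' n)) \<longlonglongrightarrow> 0"
      using that C by (intro R.tendsto_B_null R.cauchy_bounded) auto
    have 2: "(\<lambda>n. rip (V n - V' n) (U n)) \<longlonglongrightarrow> 0"
      using that C by (intro R.tendsto_B_null R.cauchy_bounded) auto
    have "rip (U' n) (V' n) - rip (U n) (V n) = - rip (U n - U' n) (V' n) - rip (V n - V' n) (U n)" for n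
      using C by (simp add: R.bilinear R.sym[of "V n"] R.sym[of "V' n"])
    then show ?thesis using tendsto_diff[OF tendsto_minus[OF 1] 2] by simp
  qed
  have "R.nrm (csc \<i> (Y n) - csc \<i> (Y' n)) = R.nrm (Y n - Y' n)" for n
    using q_csc[of "Y n - Y' n" \<i>] C by (simp add: R.nrm_def csc_linear)
  then have "(\<lambda>n. R.nrm (csc \<i> (Y n) - csc \<i> (Y' n))) \<longlonglongrightarrow> 0" using lims(2) by simp
  then show ?thesis
    using real[OF cauchy lims] real[OF cauchy(1) cauchy_csc[OF cauchy(2)] cauchy(3) cauchy_csc[OF cauchy(4)] lims(1)] C
    by (simp add: tendsto_complex_iff Im_cip) (simp add: rip_def)
qed

text \<open>All pairs of representatives have the same limit by \<open>cip_diff_null\<close>, so a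
  limit found for one pair is the value described by \<open>THE\<close>.\<close>

lemma ip_ell:
  assumes "R.cauchy X" "R.cauchy Y" "(\<lambda>n. cip (X n) (Y n)) \<longlonglongrightarrow> c"
  shows "ip (ell G \<psi>) (cls X) (cls Y) = c"
proof -
  have "ip (ell G \<psi>) (cls X) (cls Y) = (THE c. \<exists>X'\<in>cls X. \<exists>Y'\<in>cls Y. (\<lambda>n. cip (X' n) (Y' n)) \<longlonglongrightarrow> c)"
    by (simp add: ell_def completion_def)
  also have "\<dots> = c"
  proof (rule the_equality)
    show "\<exists>X'\<in>cls X. \<exists>Y'\<in>cls Y. (\<lambda>n. cip (X' n) (Y' n)) \<longlonglongrightarrow> c" using assms cls_self by blast
    fix c' assume "\<exists>X'\<in>cls X. \<exists>Y'\<in>cls Y. (\<lambda>n. cip (X' n) (Y' n)) \<longlonglongrightarrow> c'"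
    then obtain X' Y' where "X' \<in> cls X" "Y' \<in> cls Y" "(\<lambda>n. cip (X' n) (Y' n)) \<longlonglongrightarrow> c'" by blast
    then have "(\<lambda>n. cip (X' n) (Y' n) - (cip (X' n) (Y' n) - cip (X n) (Y n))) \<longlonglongrightarrow> c' - 0"
      by (intro tendsto_diff cip_diff_null)
    then show "c' = c" using assms(3) LIMSEQ_unique by fastforce
  qed
  finally show ?thesis .
qed

section \<open>Finite powers of the completion and projections in them\<close>

context
  fixes S :: "'a set"
  assumes S: "finite S" "S \<subseteq> carrier G"
begin

interpretation W: semi_inner "tuples S CG" "wip1 S" by (rule semi_inner_wip1)

abbreviation "P \<equiv> ell_pow G \<psi> S"

definition tup :: "(nat \<Rightarrow> 'a \<Rightarrow> 'a \<Rightarrow> complex) \<Rightarrow> 'a \<Rightarrow> (nat \<Rightarrow> 'a \<Rightarrow> complex) set" where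
  "tup x = (\<lambda>s\<in>S. cls (\<lambda>n. x n s))"

definition wcip :: "('a \<Rightarrow> 'a \<Rightarrow> complex) \<Rightarrow> ('a \<Rightarrow> 'a \<Rightarrow> complex) \<Rightarrow> complex" where
  "wcip x y = (\<Sum>s\<in>S. cip (x s) (y s))"

lemma Re_wcip: "Re (wcip x y) = wip1 S x y"
  by (simp add: wcip_def wip_def rip_def)

lemma Im_wcip: "x \<in> tuples S CG \<Longrightarrow> y \<in> tuples S CG \<Longrightarrow> Im (wcip x y) = wip1 S x (\<lambda>s. csc \<i> (y s))"
  unfolding wcip_def wip_def Im_sum by (intro sum.cong) (auto simp: Im_cip tuples_def)

lemma component_cauchy: "W.cauchy x \<Longrightarrow> s \<in> S \<Longrightarrow> R.cauchy (\<lambda>n. x n s)"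
  by (rule R.cauchy_component[OF S(1)]) simp_all

lemma carrier_P: "carrier P = tup ` {x. W.cauchy x}"
proof
  show "tup ` {x. W.cauchy x} \<subseteq> carrier P"
    using component_cauchy by (auto simp: ips_power_def carrier_ell tup_def)
  show "carrier P \<subseteq> tup ` {x. W.cauchy x}"
  proof
    fix u assume u: "u \<in> carrier P"
    then have "\<forall>s\<in>S. \<exists>X. R.cauchy X \<and> u s = cls X" by (auto simp: ips_power_def carrier_ell)
    then obtain X where X: "\<And>s. s \<in> S \<Longrightarrow> R.cauchy (X s)" "\<And>s. s \<in> S \<Longrightarrow> u s = cls (X s)" by metis
    define x where "x n s = X s n" for n s
    have "W.cauchy x" using X(1) S by (intro R.cauchy_tuples) (auto simp: x_def)
    moreover have "u = tup x"
      using u X(2) by (auto simp: ips_power_def tup_def x_def PiE_def extensional_def fun_eq_iff)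
    ultimately show "u \<in> tup ` {x. W.cauchy x}" by blast
  qed
qed

lemma vdiff_P:
  assumes "W.cauchy x" "W.cauchy y"
  shows "vdiff P (tup x) (tup y) = tup (\<lambda>n. x n - y n)"
proof -
  have "vdiff P (tup x) (tup y) = (\<lambda>s\<in>S. vdiff (ell G \<psi>) (tup x s) (tup y s))"
    by (auto simp: vdiff_def ips_power_def fun_eq_iff)
  also have "\<dots> = tup (\<lambda>n. x n - y n)"
    using component_cauchy assms by (auto simp: tup_def vdiff_ell fun_eq_iff)
  finally show ?thesis .
qed

lemma wcip_convergent:
  assumes "W.cauchy x" "W.cauchy y"
  shows "\<exists>c. (\<lambda>n. wcip (x n) (y n)) \<longlonglongrightarrow> c"
proof -
  have "\<forall>s\<in>S. \<exists>c. (\<lambda>n. cip (x n s) (y n s)) \<longlonglongrightarrow> c"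
    using cip_convergent component_cauchy assms by blast
  then obtain c where "\<And>s. s \<in> S \<Longrightarrow> (\<lambda>n. cip (x n s) (y n s)) \<longlonglongrightarrow> c s" by metis
  then have "(\<lambda>n. wcip (x n) (y n)) \<longlonglongrightarrow> (\<Sum>s\<in>S. c s)"
    unfolding wcip_def by (intro tendsto_sum)
  then show ?thesis by blast
qed

lemma ip_P:
  assumes "W.cauchy x" "W.cauchy y" "(\<lambda>n. wcip (x n) (y n)) \<longlonglongrightarrow> c"
  shows "ip P (tup x) (tup y) = c"
proof -
  have "\<forall>s\<in>S. \<exists>c. (\<lambda>n. cip (x n s) (y n s)) \<longlonglongrightarrow> c"
    using cip_convergent component_cauchy assms by blast
  then obtain d where d: "\<And>s. s \<in> S \<Longrightarrow> (\<lambda>n. cip (x n s) (y n s)) \<longlonglongrightarrow> d s" by metis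
  have "ip P (tup x) (tup y) = (\<Sum>s\<in>S. ip (ell G \<psi>) (cls (\<lambda>n. x n s)) (cls (\<lambda>n. y n s)))"
    by (simp add: ips_power_def tup_def)
  also have "\<dots> = (\<Sum>s\<in>S. d s)"
    using component_cauchy assms d by (intro sum.cong ip_ell) auto
  also have "\<dots> = c"
  proof (rule LIMSEQ_unique)
    show "(\<lambda>n. wcip (x n) (y n)) \<longlonglongrightarrow> (\<Sum>s\<in>S. d s)" unfolding wcip_def by (intro tendsto_sum d)
  qed (rule assms(3))
  finally show ?thesis .
qed

lemma vnorm_P:
  assumes "W.cauchy x" "(\<lambda>n. W.nrm (x n)) \<longlonglongrightarrow> l"
  shows "vnorm P (tup x) = l"
proof -
  obtain c where c: "(\<lambda>n. wcip (x n) (x n)) \<longlonglongrightarrow> c" using wcip_convergent assms(1) by blast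
  have "(\<lambda>n. sqrt (Re (wcip (x n) (x n)))) \<longlonglongrightarrow> sqrt (Re c)" by (intro tendsto_intros c)
  then have "sqrt (Re c) = l"
    using assms(2) LIMSEQ_unique by (simp add: Re_wcip W.nrm_def W.q_def) blast
  then show ?thesis using ip_P[OF assms(1,1) c] by (simp add: vnorm_def)
qed

lemma tup_eqI:
  assumes "W.cauchy x" "W.cauchy y" "(\<lambda>n. W.nrm (x n - y n)) \<longlonglongrightarrow> 0"
  shows "tup x = tup y"
proof -
  have "cls (\<lambda>n. x n s) = cls (\<lambda>n. y n s)" if s: "s \<in> S" for s
  proof (rule cls_eqI)
    show "(\<lambda>n. R.nrm (x n s - y n s)) \<longlonglongrightarrow> 0"
    proof (rule Lim_null_comparison[OF _ assms(3)])
      have "R.nrm (x n s - y n s) \<le> W.nrm (x n - y n)" for n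
        using R.nrm_component_le[OF S(1) _ _ s, of "\<lambda>_. 1" "x n - y n"] assms by simp
      moreover have "0 \<le> R.nrm (x n s - y n s)" for n
        using component_cauchy[OF assms(1) s] component_cauchy[OF assms(2) s] by (simp add: R.cauchy_def)
      ultimately show "\<forall>\<^sub>F n in sequentially. norm (R.nrm (x n s - y n s)) \<le> W.nrm (x n - y n)" by simp
    qed
  qed (use component_cauchy assms s in auto)
  then show ?thesis unfolding tup_def by (rule restrict_ext)
qed

lemma unit_vec_eq: "unit_vec G \<psi> S i = tup (\<lambda>_. unit i)"
  unfolding unit_vec_def tup_def unit_def embed_eq vzero_ell
  by (intro restrict_ext) (auto simp: zero_fun_def)

lemma cauchy_unit: "W.cauchy (\<lambda>_. unit i)"
  by (rule W.cauchy_const) simp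

lemma wcip_null:
  assumes "W.cauchy x" "W.cauchy y" "ip P (tup x) (tup y) = 0"
  shows "(\<lambda>n. wip1 S (x n) (y n)) \<longlonglongrightarrow> 0"
proof -
  obtain c where c: "(\<lambda>n. wcip (x n) (y n)) \<longlonglongrightarrow> c" using wcip_convergent assms by blast
  then have "c = 0" using ip_P[OF assms(1,2) c] assms(3) by simp
  then show ?thesis using tendsto_Re[OF c] by (simp add: Re_wcip)
qed

text \<open>Reduces \<open>ips_proj\<close> to sequences: its description is met by any class in
  \<open>A\<close> whose residual is orthogonal to \<open>A\<close> in the limit. Uniqueness holds
  because two such classes have distance 0.\<close>

lemma ips_proj_P:
  assumes A: "A \<subseteq> carrier P" and p: "W.cauchy p" "tup p \<in> A"
    and orth: "\<And>a. W.cauchy a \<Longrightarrow> tup a \<in> A \<Longrightarrow> (\<lambda>n. wcip (unit i - p n) (a n)) \<longlonglongrightarrow> 0"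
  shows "ips_proj P A (unit_vec G \<psi> S i) = tup p"
  unfolding ips_proj_def unit_vec_eq
proof (rule the_equality)
  have diff: "W.cauchy (\<lambda>n. unit i - x n)" if "W.cauchy x" for x
    by (rule W.cauchy_diff[OF cauchy_unit that])
  show "tup p \<in> A \<and> (\<forall>a\<in>A. ip P (vdiff P (tup (\<lambda>_. unit i)) (tup p)) a = 0)"
  proof (intro conjI ballI p)
    fix a assume "a \<in> A"
    then obtain x where x: "a = tup x" "W.cauchy x" using A carrier_P by auto
    then show "ip P (vdiff P (tup (\<lambda>_. unit i)) (tup p)) a = 0"
      using orth[of x] \<open>a \<in> A\<close> p by (simp add: vdiff_P cauchy_unit ip_P diff)
  qed
  fix p' assume *: "p' \<in> A \<and> (\<forall>a\<in>A. ip P (vdiff P (tup (\<lambda>_. unit i)) p') a = 0)"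
  then obtain x where x: "p' = tup x" "W.cauchy x" using A carrier_P by auto
  have orth': "(\<lambda>n. wip1 S (unit i - x n) (y n)) \<longlonglongrightarrow> 0" if "W.cauchy y" "tup y \<in> A" for y
    using * that x by (intro wcip_null diff) (auto simp: vdiff_P cauchy_unit)
  have orth1: "(\<lambda>n. wip1 S (unit i - p n) (y n)) \<longlonglongrightarrow> 0" if "W.cauchy y" "tup y \<in> A" for y
    using tendsto_Re[OF orth[OF that]] by (simp add: Re_wcip)
  have xA: "tup x \<in> A" using * x by simp
  \<comment> \<open>The squared distance of the two candidates, written as pairings of their
    residuals with the candidates themselves, which represent elements of \<open>A\<close>.\<close>
  have "W.q (x n - p n) = (wip1 S (unit i - p n) (x n) - wip1 S (unit i - x n) (x n)) -
      (wip1 S (unit i - p n) (p n) - wip1 S (unit i - x n) (p n))" for n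
    using W.cauchy_C[OF x(2), of n] W.cauchy_C[OF p(1), of n] unit_tuples[of i S]
    by (simp add: W.q_def W.bilinear)
  then have "(\<lambda>n. W.q (x n - p n)) \<longlonglongrightarrow> (0 - 0) - (0 - 0)"
    by (simp only:) (intro tendsto_diff orth' orth1 x p xA)
  then have "(\<lambda>n. sqrt (W.q (x n - p n))) \<longlonglongrightarrow> sqrt ((0 - 0) - (0 - 0))" by (rule tendsto_real_sqrt)
  then show "p' = tup p"
    unfolding x(1) by (intro tup_eqI x p) (simp add: W.nrm_def)
qed

lemma Re_ip_unit_vec:
  assumes "W.cauchy p" "(\<lambda>n. wip1 S (p n) (unit i)) \<longlonglongrightarrow> l"
  shows "Re (ip P (tup p) (unit_vec G \<psi> S i)) = l"
proof -
  obtain c where c: "(\<lambda>n. wcip (p n) (unit i)) \<longlonglongrightarrow> c"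
    using wcip_convergent[OF assms(1) cauchy_unit] by blast
  have "Re c = l" using LIMSEQ_unique[OF assms(2)] tendsto_Re[OF c] by (simp add: Re_wcip)
  then show ?thesis using ip_P[OF assms(1) cauchy_unit c] by (simp add: unit_vec_eq)
qed

lemma bd_csc: "f \<in> tuples S CG \<Longrightarrow> gr_boundary G S (\<lambda>s. csc c (f s)) = csc c (gr_boundary G S f)"
  by (auto simp: gr_boundary_def csc_def fun_eq_iff sum_distrib_left algebra_simps)

lemma csc_tuples: "f \<in> tuples S CG \<Longrightarrow> (\<lambda>s. csc c (f s)) \<in> tuples S CG"
  by (simp add: tuples_def)

lemma nrm_csc_tuple:
  assumes "f \<in> tuples S CG"
  shows "W.nrm (\<lambda>s. csc \<i> (f s)) = W.nrm f"
proof -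
  have "q1 S (\<lambda>s. csc \<i> (f s)) = q1 S f"
    unfolding q1_eq using assms by (intro sum.cong) (auto simp: q_csc tuples_def)
  then show ?thesis by (simp add: W.nrm_def)
qed

lemma bd_restrict: "gr_boundary G S (restrict f S) = gr_boundary G S f"
  unfolding gr_boundary_def by (intro ext if_cong sum.cong refl) auto

section \<open>The two dimensions in the Betti number\<close>

lemma dim_closure_cycles:
  "dim_psi G \<psi> S (ips_closure P ((\<lambda>f. \<lambda>s\<in>S. embed GR (f s)) ` gr_cycles G \<psi> S)) =
    card S - cocycle_dim S"
proof -
  let ?E = "(\<lambda>f. \<lambda>s\<in>S. embed GR (f s)) ` gr_cycles G \<psi> S"
  have E: "?E = (\<lambda>f. tup (\<lambda>_. f)) ` bd_cycles S"
  proof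
    show "?E \<subseteq> (\<lambda>f. tup (\<lambda>_. f)) ` bd_cycles S"
    proof (rule image_subsetI)
      fix f assume "f \<in> gr_cycles G \<psi> S"
      then have "f \<in> bd_cycles S"
        by (auto simp: gr_cycles_def bd_cycles_def tuples_def CG_def zero_fun_def)
      then show "(\<lambda>s\<in>S. embed GR (f s)) \<in> (\<lambda>f. tup (\<lambda>_. f)) ` bd_cycles S"
        by (auto simp: tup_def embed_eq)
    qed
    show "(\<lambda>f. tup (\<lambda>_. f)) ` bd_cycles S \<subseteq> ?E"
    proof (rule image_subsetI)
      fix f assume "f \<in> bd_cycles S"
      then have "restrict f S \<in> gr_cycles G \<psi> S"
        using bd_restrict[of f] by (auto simp: gr_cycles_def bd_cycles_def tuples_def CG_def zero_fun_def)
      moreover have "tup (\<lambda>_. f) = (\<lambda>s\<in>S. embed GR (restrict f S s))"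
        unfolding tup_def embed_eq by (intro restrict_ext) simp
      ultimately show "tup (\<lambda>_. f) \<in> ?E" by blast
    qed
  qed
  have M: "subspace (bd_cycles S)" "bd_cycles S \<subseteq> tuples S CG"
    using invariant_bd_cycles[OF S] by (auto simp: invariant_subspace_def)
  have const: "W.cauchy (\<lambda>_. m)" if "m \<in> bd_cycles S" for m
    using that M by (intro W.cauchy_const) auto
  have "Re (ip P (ips_proj P (ips_closure P ?E) (unit_vec G \<psi> S i)) (unit_vec G \<psi> S i)) =
      1 - wd2 S (\<lambda>_. 1) i (bd_cycles S)" if i: "i \<in> S" for i
  proof -
    obtain z where z: "W.proj_seq (unit i) (bd_cycles S) z"
      using W.proj_seq_exists[OF _ M(2) unit_tuples] zero_bd_cycles[OF S] by blast
    note zz = M unit_tuples z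
    have zc: "W.cauchy z" by (rule W.proj_seq_cauchy[OF zz])
    have "ips_proj P (ips_closure P ?E) (unit_vec G \<psi> S i) = tup z"
    proof (rule ips_proj_P[OF _ zc])
      show "ips_closure P ?E \<subseteq> carrier P" by (auto simp: ips_closure_def)
      show "tup z \<in> ips_closure P ?E"
        unfolding ips_closure_def
      proof (intro CollectI conjI allI impI)
        show "tup z \<in> carrier P" using carrier_P zc by blast
        fix e :: real
        assume "0 < e"
        then obtain N where N: "\<And>m n. m \<ge> N \<Longrightarrow> n \<ge> N \<Longrightarrow> W.nrm (z m - z n) < e / 2"
          using zc unfolding W.cauchy_def by (metis half_gt_zero)
        have zN: "z N \<in> bd_cycles S" by (rule W.proj_seq_in_M[OF zz])
        have c: "W.cauchy (\<lambda>n. z n - z N)" by (rule W.cauchy_diff[OF zc const[OF zN]])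
        obtain l where l: "(\<lambda>n. W.nrm (z n - z N)) \<longlonglongrightarrow> l" using W.cauchy_nrm_convergent[OF c] by blast
        have "l \<le> e / 2" using N by (intro LIMSEQ_le_const2[OF l]) (auto intro!: exI[of _ N] less_imp_le)
        then have "vnorm P (vdiff P (tup z) (tup (\<lambda>_. z N))) < e"
          using \<open>0 < e\<close> vnorm_P[OF c l] by (simp add: vdiff_P zc const zN)
        then show "\<exists>y\<in>?E. vnorm P (vdiff P (tup z) y) < e" unfolding E using zN by blast
      qed
      fix a assume a: "W.cauchy a" "tup a \<in> ips_closure P ?E"
      have aC: "a n \<in> tuples S CG" for n using a(1) by simp
      have approx: "\<exists>m\<in>bd_cycles S. \<forall>\<^sub>F n in sequentially. W.nrm (a n - m) < e" if "0 < e" for e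
      proof -
        have "\<exists>y\<in>?E. vnorm P (vdiff P (tup a) y) < e" using a(2) that by (simp add: ips_closure_def)
        then obtain m where m: "m \<in> bd_cycles S" "vnorm P (vdiff P (tup a) (tup (\<lambda>_. m))) < e"
          unfolding E by auto
        have c: "W.cauchy (\<lambda>n. a n - m)" by (rule W.cauchy_diff[OF a(1) const[OF m(1)]])
        obtain l where l: "(\<lambda>n. W.nrm (a n - m)) \<longlonglongrightarrow> l" using W.cauchy_nrm_convergent[OF c] by blast
        then have "l < e" using m(2) vnorm_P[OF c l] by (simp add: vdiff_P a const m)
        then show ?thesis using m(1) order_tendstoD(2)[OF l] by blast
      qed
      \<comment> \<open>The cycles form a complex subspace, so i times \<open>a\<close> is
        approximated by cycles as well. This gives the imaginary part of the orthogonality.\<close>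
      have approx_i: "\<exists>m\<in>bd_cycles S. \<forall>\<^sub>F n in sequentially. W.nrm ((\<lambda>s. csc \<i> (a n s)) - m) < e"
        if e: "0 < e" for e
      proof -
        obtain m where m: "m \<in> bd_cycles S" "\<forall>\<^sub>F n in sequentially. W.nrm (a n - m) < e"
          using approx[OF e] by blast
        have mC: "m \<in> tuples S CG" using m(1) M(2) by blast
        have "(\<lambda>s. csc \<i> (m s)) \<in> bd_cycles S"
          using m(1) bd_csc[OF mC] csc_tuples[OF mC] by (simp add: bd_cycles_def csc_linear)
        moreover have "W.nrm ((\<lambda>s. csc \<i> (a n s)) - (\<lambda>s. csc \<i> (m s))) = W.nrm (a n - m)" for n
        proof -
          have "(\<lambda>s. csc \<i> (a n s)) - (\<lambda>s. csc \<i> (m s)) = (\<lambda>s. csc \<i> ((a n - m) s))"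
            by (simp add: fun_eq_iff csc_linear)
          then show ?thesis using nrm_csc_tuple[OF W.C_diff[OF aC mC]] by simp
        qed
        ultimately show ?thesis using m(2) by (intro bexI[of _ "\<lambda>s. csc \<i> (m s)"]) auto
      qed
      show "(\<lambda>n. wcip (unit i - z n) (a n)) \<longlonglongrightarrow> 0"
        unfolding tendsto_complex_iff Re_wcip Im_wcip[OF W.C_diff[OF unit_tuples W.proj_seq_in_C[OF zz]] aC]
        using W.proj_seq_orthogonal_closure[OF zz aC approx]
          W.proj_seq_orthogonal_closure[OF zz csc_tuples[OF aC] approx_i] by simp
    qed
    then show ?thesis
      using Re_ip_unit_vec[OF zc W.proj_seq_B_e[OF zz]] q1_unit[OF S(1) i] by simp
  qed
  then show ?thesis by (simp add: dim_psi_def cocycle_dim_def sum_subtractf)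
qed

text \<open>The boundary is bounded, so all representatives of the coordinates give the same class,
  and the union in \<open>boundary\<close> is a single class.\<close>

lemma boundary_tup:
  assumes "W.cauchy x"
  shows "R.cauchy (\<lambda>n. gr_boundary G S (x n))"
    and "boundary G \<psi> S (tup x) = cls (\<lambda>n. gr_boundary G S (x n))"
proof -
  have bd_cauchy: "R.cauchy (\<lambda>n. gr_boundary G S (y n))" if "W.cauchy y" for y
    unfolding R.cauchy_def
  proof
    have y: "y n \<in> tuples S CG" for n using that by simp
    then show "\<forall>n. gr_boundary G S (y n) \<in> CG" using bd_CG[OF S] by blast
    show "\<forall>e>0. \<exists>N. \<forall>m\<ge>N. \<forall>n\<ge>N. R.nrm (gr_boundary G S (y m) - gr_boundary G S (y n)) < e"
    proof (rule W.cauchy_of_bound[OF that, where nrm' = R.nrm and K = "2 * card S" and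
          Y = "\<lambda>n. gr_boundary G S (y n)"])
      fix m n
      show "R.nrm (gr_boundary G S (y m) - gr_boundary G S (y n)) \<le> 2 * card S * W.nrm (y m - y n)"
        using bd_bounded[OF S W.C_diff[OF y y]] bd_diff[OF S y y] by simp
    qed
  qed
  then show cauchy: "R.cauchy (\<lambda>n. gr_boundary G S (x n))" using assms by blast
  have "cls (\<lambda>n. gr_boundary G S (\<lambda>s. X s n)) = cls (\<lambda>n. gr_boundary G S (x n))"
    if "X \<in> Pi S (tup x)" for X
  proof -
    let ?y = "\<lambda>n s. X s n"
    have X: "R.cauchy (X s)" "(\<lambda>n. R.nrm (x n s - X s n)) \<longlonglongrightarrow> 0" if "s \<in> S" for s
      using \<open>X \<in> Pi S (tup x)\<close> that by (auto simp: tup_def mem_cls Pi_iff)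
    have y: "W.cauchy ?y" using S X by (intro R.cauchy_tuples) auto
    show ?thesis
    proof (rule cls_eqI[OF bd_cauchy[OF y] cauchy], rule Lim_null_comparison)
      have q: "W.q (?y n - x n) = (\<Sum>s\<in>S. (R.nrm (x n s - X s n))\<^sup>2)" for n
        unfolding q1_eq
      proof (rule sum.cong)
        fix s assume s: "s \<in> S"
        have "x n s \<in> CG" "X s n \<in> CG" using component_cauchy[OF assms s] X(1)[OF s] by (auto simp: R.cauchy_def)
        then show "R.q ((?y n - x n) s) = (R.nrm (x n s - X s n))\<^sup>2"
          using R.nrm_diff_commute[of "x n s" "X s n"] by (simp add: R.nrm_sq)
      qed simp
      have "(\<lambda>n. W.q (?y n - x n)) \<longlonglongrightarrow> (\<Sum>s\<in>S. 0\<^sup>2)"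
        unfolding q by (intro tendsto_sum tendsto_power X)
      then have "(\<lambda>n. 2 * card S * sqrt (W.q (?y n - x n))) \<longlonglongrightarrow> 2 * card S * sqrt (\<Sum>s\<in>S. 0\<^sup>2)"
        by (intro tendsto_intros)
      then show "(\<lambda>n. 2 * card S * W.nrm (?y n - x n)) \<longlonglongrightarrow> 0" by (simp add: W.nrm_def)
      have C: "?y n \<in> tuples S CG" "x n \<in> tuples S CG" for n
        using W.cauchy_C[OF y] W.cauchy_C[OF assms] by auto
      have "R.nrm (gr_boundary G S (?y n) - gr_boundary G S (x n)) \<le> 2 * card S * W.nrm (?y n - x n)" for n
        using bd_bounded[OF S W.C_diff[OF C]] bd_diff[OF S C] by simp
      moreover have "0 \<le> R.nrm (gr_boundary G S (?y n) - gr_boundary G S (x n))" for n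
        using bd_CG[OF S C(1)] bd_CG[OF S C(2)] by simp
      ultimately show "\<forall>\<^sub>F n in sequentially. norm (R.nrm (gr_boundary G S (?y n) - gr_boundary G S (x n)))
          \<le> 2 * card S * W.nrm (?y n - x n)" by simp
    qed
  qed
  moreover have "(\<lambda>s n. x n s) \<in> Pi S (tup x)"
    using component_cauchy[OF assms] by (auto simp: tup_def cls_self)
  ultimately show "boundary G \<psi> S (tup x) = cls (\<lambda>n. gr_boundary G S (x n))"
    unfolding boundary_def cls_def[symmetric] by blast
qed

lemma tup_ker_boundary_iff:
  assumes "W.cauchy x"
  shows "tup x \<in> ker_boundary G \<psi> S \<longleftrightarrow> (\<lambda>n. R.nrm (gr_boundary G S (x n))) \<longlonglongrightarrow> 0"
proof -
  have "tup x \<in> carrier P" using assms carrier_P by blast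
  then show ?thesis
    using boundary_tup[OF assms] cls_eq_iff[OF boundary_tup(1)[OF assms] R.cauchy_const[OF R.C_zero]]
    by (simp add: ker_boundary_def vzero_ell)
qed

text \<open>The residual \<open>unit i - z n\<close> of a minimizing sequence of coboundaries
  represents the projection onto the kernel, so the diagonal entry is a squared distance and not one
  minus it.\<close>

lemma dim_ker_boundary:
  "dim_psi G \<psi> S (ker_boundary G \<psi> S) = (\<Sum>s\<in>S. wd2 S (\<lambda>_. 1) s cobd_image)"
proof -
  note M = subspace_cobd_image cobd_image_tuples[OF S]
  have "Re (ip P (ips_proj P (ker_boundary G \<psi> S) (unit_vec G \<psi> S i)) (unit_vec G \<psi> S i)) =
      wd2 S (\<lambda>_. 1) i cobd_image" if i: "i \<in> S" for i
  proof -
    obtain z where z: "W.proj_seq (unit i) cobd_image z"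
      using W.proj_seq_exists[OF _ M(2) unit_tuples] subspace_0[OF M(1)] by blast
    note zz = M unit_tuples z
    have zc: "W.cauchy z" by (rule W.proj_seq_cauchy[OF zz])
    have zC: "z n \<in> tuples S CG" for n by (rule W.proj_seq_in_C[OF zz])
    define p where "p n = unit i - z n" for n
    have p: "W.cauchy p" unfolding p_def by (rule W.cauchy_diff[OF cauchy_unit zc])
    have pC: "p n \<in> tuples S CG" for n using p by simp
    have "(\<lambda>n. R.nrm (gr_boundary G S (p n))) \<longlonglongrightarrow> 0"
    proof (rule R.cauchy_weakly_null[OF boundary_tup(1)[OF p]])
      fix N
      let ?u = "gr_boundary G S (p N)"
      have u: "?u \<in> CG" by (rule bd_CG[OF S pC])
      \<comment> \<open>Orthogonality of the residual to the coboundary of \<open>?u\<close> makes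
        its boundary weakly null, hence null.\<close>
      have "(\<lambda>n. wip1 S (unit i - z n) (cobd ?u)) \<longlonglongrightarrow> 0"
      proof (rule W.proj_seq_orthogonal[OF zz])
        show "cobd ?u \<in> cobd_image" using u by (simp add: cobd_image_def)
        show "W.nrm_bounded (\<lambda>n. cobd ?u)"
          using u S by (intro W.nrm_boundedI[OF _ order_refl]) simp
      qed
      then show "(\<lambda>n. rip (gr_boundary G S (p n)) ?u) \<longlonglongrightarrow> 0"
        using bd_cobd_adjoint[OF S pC u] by (simp add: p_def)
    qed
    then have pA: "tup p \<in> ker_boundary G \<psi> S" using tup_ker_boundary_iff[OF p] by blast
    have "ips_proj P (ker_boundary G \<psi> S) (unit_vec G \<psi> S i) = tup p"
    proof (rule ips_proj_P[OF _ p pA])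
      show "ker_boundary G \<psi> S \<subseteq> carrier P" by (auto simp: ker_boundary_def)
      fix a assume a: "W.cauchy a" "tup a \<in> ker_boundary G \<psi> S"
      have aC: "a n \<in> tuples S CG" for n using a(1) by simp
      have real: "(\<lambda>n. wip1 S (z n) (b n)) \<longlonglongrightarrow> 0"
        if b: "W.nrm_bounded b" "(\<lambda>n. R.nrm (gr_boundary G S (b n))) \<longlonglongrightarrow> 0" for b
      proof -
        have bC: "b n \<in> tuples S CG" for n using b(1) by (simp add: W.nrm_bounded_def)
        \<comment> \<open>It suffices to pair \<open>b\<close> with a fixed term of
          \<open>z\<close>. That term is a coboundary, and adjointness moves the boundary onto
          \<open>b\<close>.\<close>
        have "(\<lambda>n. wip1 S (b n) (z n)) \<longlonglongrightarrow> 0"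
        proof (rule W.cauchy_pairing_null[OF zc b(1)])
          fix N
          obtain h where h: "h \<in> CG" "z N = cobd h"
            using W.proj_seq_in_M[OF zz, of N] by (auto simp: cobd_image_def)
          have "(\<lambda>n. rip (gr_boundary G S (b n)) h) \<longlonglongrightarrow> 0"
            using b(2) bd_CG[OF S bC] h(1) by (intro R.tendsto_B_null R.nrm_boundedI[OF _ order_refl]) auto
          then show "(\<lambda>n. wip1 S (b n) (z N)) \<longlonglongrightarrow> 0"
            using bd_cobd_adjoint[OF S bC h(1)] h(2) by simp
        qed
        then show ?thesis using W.sym[OF zC bC] by simp
      qed
      have bd0: "(\<lambda>n. R.nrm (gr_boundary G S (a n))) \<longlonglongrightarrow> 0"
        using a tup_ker_boundary_iff by blast
      have bounded: "W.nrm_bounded a" by (rule W.cauchy_bounded[OF a(1)])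
      have bounded_i: "W.nrm_bounded (\<lambda>n s. csc \<i> (a n s))"
        using bounded csc_tuples[OF aC] nrm_csc_tuple[OF aC] by (simp add: W.nrm_bounded_def)
      have "R.nrm (gr_boundary G S (\<lambda>s. csc \<i> (a n s))) = R.nrm (gr_boundary G S (a n))" for n
        using q_csc[OF bd_CG[OF S aC], of \<i> n] bd_csc[OF aC] by (simp add: R.nrm_def)
      then have bd0_i: "(\<lambda>n. R.nrm (gr_boundary G S (\<lambda>s. csc \<i> (a n s)))) \<longlonglongrightarrow> 0" using bd0 by simp
      have "unit i - p n = z n" for n by (simp add: p_def)
      then show "(\<lambda>n. wcip (unit i - p n) (a n)) \<longlonglongrightarrow> 0"
        unfolding tendsto_complex_iff using real[OF bounded bd0] real[OF bounded_i bd0_i]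
        by (simp add: Re_wcip Im_wcip[OF zC aC])
    qed
    moreover have "(\<lambda>n. wip1 S (p n) (unit i)) \<longlonglongrightarrow> wd2 S (\<lambda>_. 1) i cobd_image"
    proof -
      have "(\<lambda>n. 1 - wip1 S (z n) (unit i)) \<longlonglongrightarrow> 1 - (q1 S (unit i) - wd2 S (\<lambda>_. 1) i cobd_image)"
        by (intro tendsto_intros W.proj_seq_B_e[OF zz])
      moreover have "wip1 S (p n) (unit i) = 1 - wip1 S (z n) (unit i)" for n
        using q1_unit[OF S(1) i] zC[of n] by (simp add: p_def W.diff_left W.q_def)
      ultimately show ?thesis using q1_unit[OF S(1) i] by simp
    qed
    ultimately show ?thesis using Re_ip_unit_vec[OF p] by simp
  qed
  then show ?thesis by (simp add: dim_psi_def)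
qed

end

text \<open>What remains of the difference of the two dimensions after \<open>card S\<close> has
  cancelled. The last summand is the squared distance of the unit to the image of the
  boundary.\<close>

definition betti :: "'a set \<Rightarrow> real" where
  "betti S = cocycle_dim S - 1 + R.d2 (gr_basis \<one>) (bd_image S)"

theorem b1_wrt_eq_betti:
  assumes "finite S" "S \<subseteq> carrier G"
  shows "b1_wrt G \<psi> S = betti S"
  unfolding b1_wrt_def dim_ker_boundary[OF assms] dim_closure_cycles[OF assms]
    sum_distances_cobd_image[OF assms] betti_def by simp

lemma betti_indep:
  assumes S: "finite S" "S \<subseteq> carrier G" "generate G S = carrier G"
    and T: "finite T" "T \<subseteq> carrier G" "generate G T = carrier G"
  shows "betti S = betti T"
proof -
  have "bd_image S = bd_image T"
    using bd_image_mono[OF S(1,2), of T] bd_image_mono[OF T(1,2), of S] S T by auto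
  then show ?thesis using cocycle_dim_indep[OF S T] by (simp add: betti_def)
qed

text \<open>Frees \<open>b1\<close> from the generating set picked by \<open>SOME\<close>: any
  finite generating set may be used from here on.\<close>

lemma b1_eq_betti:
  assumes "finite_generating_set G S"
  shows "b1 G \<psi> = betti S"
proof -
  define T where "T = (SOME S. finite_generating_set G S)"
  have T: "finite_generating_set G T" unfolding T_def using assms by (rule someI)
  have "b1 G \<psi> = betti T"
    using T b1_wrt_eq_betti[of T] unfolding b1_def T_def[symmetric] by (simp add: finite_generating_set_def)
  then show ?thesis
    using T assms betti_indep[of T S] by (simp add: finite_generating_set_def)
qed

end

section \<open>Adjoining elements\<close>

context char_group
begin

lemma char_group_subgroup:
  assumes "subgroup H G"
  shows "char_group (G\<lparr>carrier := H\<rparr>) \<psi>"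
proof -
  interpret H: subgroup H G by fact
  interpret K: group "G\<lparr>carrier := H\<rparr>" by (rule subgroup_imp_group[OF assms])
  have inv: "inv\<^bsub>G\<lparr>carrier := H\<rparr>\<^esub> h = inv h" if "h \<in> H" for h
    using m_inv_consistent[OF assms that] .
  have "character (G\<lparr>carrier := H\<rparr>) \<psi>"
    unfolding character_def
  proof (intro conjI allI impI ballI)
    fix n :: nat and c :: "nat \<Rightarrow> complex" and g :: "nat \<Rightarrow> 'a"
    assume g: "\<forall>i<n. g i \<in> carrier (G\<lparr>carrier := H\<rparr>)"
    then have "(\<Sum>i<n. \<Sum>j<n. c i * cnj (c j) * \<psi> (inv (g j) \<otimes> g i)) \<in> \<real>\<^sub>\<ge>\<^sub>0"
      using H.subset by (intro psi_positive) auto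
    then show "(\<Sum>i<n. \<Sum>j<n. c i * cnj (c j) *
        \<psi> (inv\<^bsub>G\<lparr>carrier := H\<rparr>\<^esub> (g j) \<otimes>\<^bsub>G\<lparr>carrier := H\<rparr>\<^esub> g i)) \<in> \<real>\<^sub>\<ge>\<^sub>0"
      using g by (simp add: inv)
  next
    fix g h assume "g \<in> carrier (G\<lparr>carrier := H\<rparr>)" "h \<in> carrier (G\<lparr>carrier := H\<rparr>)"
    then show "\<psi> (h \<otimes>\<^bsub>G\<lparr>carrier := H\<rparr>\<^esub> g \<otimes>\<^bsub>G\<lparr>carrier := H\<rparr>\<^esub> inv\<^bsub>G\<lparr>carrier := H\<rparr>\<^esub> h) = \<psi> g"
      using psi_conj[of g h] H.subset by (auto simp: inv)
  qed (simp add: psi_one)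
  then show ?thesis by unfold_locales
qed

text \<open>Chains over \<open>H\<close> keep their boundaries and norms in \<open>G\<close>. Hence
  the cycles over \<open>H\<close> may play the role of \<open>M\<close> in
  \<open>cocycle_dim_insert_le\<close>, while the image of the boundary grows and the distance of
  the unit to it can only shrink.\<close>

lemma betti_insert_le_subgroup:
  assumes H: "subgroup H G" and S: "finite S" "S \<subseteq> H" and a: "a \<in> carrier G" "a \<notin> S"
    and x: "x \<in> tuples S CG" and b: "b \<in> CG" and cycle: "gr_boundary G S x + (rt a b - b) = 0"
  shows "betti (insert a S) \<le> char_group.betti (G\<lparr>carrier := H\<rparr>) \<psi> S + R.q (gr_basis \<one> - b)"
proof -
  interpret H: subgroup H G by fact
  interpret h: char_group "G\<lparr>carrier := H\<rparr>" \<psi> by (rule char_group_subgroup[OF H])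
  have SG: "S \<subseteq> carrier G" using S(2) H.subset by blast
  have hCG: "f \<in> CG" "supp f \<subseteq> H" if "f \<in> h.CG" for f
    using that H.subset by (auto simp: h.CG_iff CG_iff)
  have htuples: "tuples S h.CG \<subseteq> tuples S CG" using hCG by (auto simp: tuples_def)
  have inv: "inv\<^bsub>G\<lparr>carrier := H\<rparr>\<^esub> k = inv k" if "k \<in> H" for k
    using m_inv_consistent[OF H that] .
  have q: "h.R.q f = R.q f" if "f \<in> h.CG" for f
  proof -
    have "h.cip f f = cip f f"
      unfolding group_ring_def using hCG(2)[OF that] by (simp, intro sum.cong refl) (auto simp: inv)
    then show ?thesis by (simp add: h.R.q_def R.q_def h.rip_def rip_def)
  qed
  have bd: "gr_boundary (G\<lparr>carrier := H\<rparr>) S f = gr_boundary G S f" if f: "f \<in> tuples S h.CG" for f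
  proof
    fix y
    show "gr_boundary (G\<lparr>carrier := H\<rparr>) S f y = gr_boundary G S f y"
    proof (cases "y \<in> H")
      case True
      then show ?thesis
        using S(2) H.subset by (auto simp: gr_boundary_def inv intro!: sum.cong)
    next
      case False
      \<comment> \<open>As \<open>s\<close> lies in \<open>H\<close>, both \<open>y\<close> and
        \<open>y \<otimes> inv s\<close> lie in the same left coset of \<open>H\<close>, which
        misses the support.\<close>
      have "f s (y \<otimes> inv s) - f s y = 0" if y: "y \<in> carrier G" and s: "s \<in> S" for s
      proof -
        have fs: "supp (f s) \<subseteq> H" using f s hCG(2) by (auto simp: tuples_def)
        have sH: "s \<in> H" "s \<in> carrier G" using s S(2) H.subset by auto
        have "y \<otimes> inv s \<notin> H"
        proof
          assume "y \<otimes> inv s \<in> H"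
          then have "y \<otimes> inv s \<otimes> s \<in> H" using sH H.m_closed by blast
          then show False using False y sH by (simp add: m_assoc)
        qed
        then have "f s (y \<otimes> inv s) = 0" "f s y = 0" using fs False by blast+
        then show ?thesis by simp
      qed
      then show ?thesis using False by (simp add: gr_boundary_def)
    qed
  qed
  have unit: "h.unit = unit" by (simp add: h.unit_def unit_def fun_eq_iff)
  have cycles: "h.bd_cycles S \<subseteq> bd_cycles S"
    unfolding h.bd_cycles_def bd_cycles_def using htuples bd by auto
  interpret W: semi_inner "tuples S CG" "wip1 S" by (rule semi_inner_wip1)
  interpret hW: semi_inner "tuples S h.CG" "h.wip1 S" by (rule h.semi_inner_wip1)
  have SH: "S \<subseteq> carrier (G\<lparr>carrier := H\<rparr>)" using S by simp
  have d2: "hW.d2 (h.unit s) (h.bd_cycles S) = W.d2 (unit s) (h.bd_cycles S)" for s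
    unfolding W.d2_def hW.d2_def
  proof (rule INF_cong[OF refl])
    fix m assume "m \<in> h.bd_cycles S"
    then have "h.unit s - m \<in> tuples S h.CG" by (intro hW.C_diff h.unit_tuples) (simp add: h.bd_cycles_def)
    then show "hW.q (h.unit s - m) = W.q (unit s - m)"
      unfolding h.q1_eq q1_eq unit by (intro sum.cong refl q) (simp add: tuples_def)
  qed
  have "h.bd_image S \<subseteq> bd_image S"
    unfolding h.bd_image_def bd_image_def using htuples bd by force
  moreover have "bd_image S \<subseteq> bd_image (insert a S)"
    using SG a S(1) by (intro bd_image_mono) (auto intro: generate.incl)
  ultimately have "R.d2 (gr_basis \<one>) (bd_image (insert a S)) \<le> R.d2 (gr_basis \<one>) (h.bd_image S)"
    using subspace_0[OF h.subspace_bd_image[OF S(1) SH]] bd_image_CG[of "insert a S"] S SG a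
    by (intro R.d2_mono) auto
  also have "\<dots> = h.R.d2 (gr_basis \<one>) (h.bd_image S)"
    unfolding R.d2_def h.R.d2_def
  proof (rule INF_cong[OF refl])
    fix y assume "y \<in> h.bd_image S"
    then have "gr_basis \<one> - y \<in> h.CG"
      using h.bd_image_CG[OF S(1) SH] h.CG_basis[of \<one>] by (intro h.R.C_diff) auto
    then show "R.q (gr_basis \<one> - y) = h.R.q (gr_basis \<one> - y)" by (simp add: q)
  qed
  finally have image: "R.d2 (gr_basis \<one>) (bd_image (insert a S)) \<le> h.R.d2 (gr_basis \<one>) (h.bd_image S)" .
  have "cocycle_dim (insert a S) \<le> (\<Sum>s\<in>S. wd2 S (\<lambda>_. 1) s (h.bd_cycles S)) + R.q (gr_basis \<one> - b)"
    using h.zero_bd_cycles[OF S(1) SH]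
    by (intro cocycle_dim_insert_le[OF S(1) SG a _ cycles x b cycle]) blast
  also have "(\<Sum>s\<in>S. wd2 S (\<lambda>_. 1) s (h.bd_cycles S)) = h.cocycle_dim S"
    unfolding h.cocycle_dim_def by (intro sum.cong refl d2[symmetric])
  finally have "cocycle_dim (insert a S) \<le> h.cocycle_dim S + R.q (gr_basis \<one> - b)" .
  moreover have one: "\<one>\<^bsub>G\<lparr>carrier := H\<rparr>\<^esub> = \<one>" by simp
  ultimately show ?thesis using image unfolding betti_def h.betti_def one by linarith
qed

text \<open>
  For \<open>k a = a h\<close> one has \<open>(k - 1)(a - 1) + (k - 1) - a (h - 1) = 0\<close>, and the last two terms are
  boundaries over \<open>S\<close>.
\<close>

lemma cycle_of_conjugate:
  assumes S: "finite S" "S \<subseteq> carrier G" and a: "a \<in> carrier G"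
    and k: "k \<in> generate G S" "inv a \<otimes> k \<otimes> a \<in> generate G S"
  shows "\<exists>x\<in>tuples S CG. gr_boundary G S x + (rt a (gr_basis k - gr_basis \<one>) - (gr_basis k - gr_basis \<one>)) = 0"
proof -
  interpret W: semi_inner "tuples S CG" "wip1 S" by (rule semi_inner_wip1)
  have kG: "k \<in> carrier G" using generate_in_carrier[OF S(2) k(1)] .
  obtain y where y: "y \<in> tuples S CG" "gr_boundary G S y = gr_basis (\<one> \<otimes> k) - gr_basis \<one>"
    using fill_basis[OF S k(1) one_closed] .
  obtain y' where y': "y' \<in> tuples S CG"
      "gr_boundary G S y' = gr_basis (a \<otimes> (inv a \<otimes> k \<otimes> a)) - gr_basis a"
    using fill_basis[OF S k(2) a] .
  have "a \<otimes> (inv a \<otimes> k \<otimes> a) = k \<otimes> a" using a kG by (simp add: m_assoc inv_mult_cancel_left)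
  then have "gr_boundary G S (y - y') + (rt a (gr_basis k - gr_basis \<one>) - (gr_basis k - gr_basis \<one>)) = 0"
    using bd_diff[OF S y(1) y'(1)] y(2) y'(2) a kG by (simp add: rt_linear rt_basis)
  then show ?thesis using W.C_diff[OF y(1) y'(1)] by blast
qed

text \<open>The coordinates \<open>b\<close> at \<open>a\<close> that can be completed to a cycle
  form a subspace \<open>B\<close>. It contains \<open>k - \<one>\<close> for each \<open>k\<close>
  in \<open>F\<close>, hence also the unit minus the mean of \<open>F\<close>, and the cost of
  adjoining \<open>a\<close> is the squared norm of that mean.\<close>

lemma b1_adjoin_le:
  assumes S: "finite S" "S \<subseteq> carrier G" and a: "a \<in> carrier G" "a \<notin> S"
    and gen: "generate G (insert a S) = carrier G"
    and F: "finite F" "F \<noteq> {}" "F \<subseteq> generate G S" "\<And>k. k \<in> F \<Longrightarrow> inv a \<otimes> k \<otimes> a \<in> generate G S"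
    and orth: "\<And>k k'. k \<in> F \<Longrightarrow> k' \<in> F \<Longrightarrow> k \<noteq> k' \<Longrightarrow> \<psi> (inv k' \<otimes> k) = 0"
  shows "b1 G \<psi> \<le> b1 (G\<lparr>carrier := generate G S\<rparr>) \<psi> + 1 / card F"
proof -
  let ?H = "generate G S"
  have H: "subgroup ?H G" by (rule generate_is_subgroup[OF S(2)])
  have SH: "S \<subseteq> ?H" by (auto intro: generate.incl)
  interpret h: char_group "G\<lparr>carrier := ?H\<rparr>" \<psi> by (rule char_group_subgroup[OF H])
  interpret W: semi_inner "tuples S CG" "wip1 S" by (rule semi_inner_wip1)
  have FG: "F \<subseteq> carrier G" using F(3) generate_in_carrier[OF S(2)] by blast
  define n where "n = card F"
  have n: "n > 0" using F by (simp add: n_def card_gt_0_iff)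
  define B where "B = {b \<in> CG. \<exists>x\<in>tuples S CG. gr_boundary G S x + (rt a b - b) = 0}"
  have B: "subspace B"
    unfolding subspace_def B_def
  proof (intro conjI ballI allI)
    have "gr_boundary G S 0 + (rt a 0 - 0) = 0" using bd_zero[OF S] by (simp add: rt_linear)
    then show "0 \<in> {b \<in> CG. \<exists>x\<in>tuples S CG. gr_boundary G S x + (rt a b - b) = 0}"
      using W.C_zero R.C_zero by blast
    fix b c r assume b: "b \<in> {b \<in> CG. \<exists>x\<in>tuples S CG. gr_boundary G S x + (rt a b - b) = 0}"
    then obtain x where x: "b \<in> CG" "x \<in> tuples S CG" "gr_boundary G S x + (rt a b - b) = 0" by blast
    have "gr_boundary G S (r *\<^sub>R x) + (rt a (r *\<^sub>R b) - r *\<^sub>R b) = r *\<^sub>R (gr_boundary G S x + (rt a b - b))"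
      using bd_scale[OF S x(2)] by (simp add: rt_linear scaleR_add_right scaleR_diff_right)
    then show "r *\<^sub>R b \<in> {b \<in> CG. \<exists>x\<in>tuples S CG. gr_boundary G S x + (rt a b - b) = 0}"
      using x W.C_scale[OF x(2), of r] R.C_scale[OF x(1), of r] by auto
    assume "c \<in> {b \<in> CG. \<exists>x\<in>tuples S CG. gr_boundary G S x + (rt a b - b) = 0}"
    then obtain y where y: "c \<in> CG" "y \<in> tuples S CG" "gr_boundary G S y + (rt a c - c) = 0" by blast
    have "gr_boundary G S (x + y) + (rt a (b + c) - (b + c)) =
        (gr_boundary G S x + (rt a b - b)) + (gr_boundary G S y + (rt a c - c))"
      using bd_add[OF S x(2) y(2)] by (simp add: rt_linear algebra_simps)
    then show "b + c \<in> {b \<in> CG. \<exists>x\<in>tuples S CG. gr_boundary G S x + (rt a b - b) = 0}"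
      using x y W.C_add[OF x(2) y(2)] R.C_add[OF x(1) y(1)] by auto
  qed
  have one: "gr_basis \<one> \<in> CG" by simp
  \<comment> \<open>The elements of \<open>F\<close> are orthonormal; among their combinations with
    coefficients of sum 1 the mean has the smallest norm.\<close>
  define avg where "avg = (1 / real n) *\<^sub>R (\<Sum>k\<in>F. gr_basis k)"
  have "gr_basis k - gr_basis \<one> \<in> B" if "k \<in> F" for k
    using cycle_of_conjugate[OF S a(1), of k] F that FG one by (auto simp: B_def)
  then have "(- 1 / real n) *\<^sub>R (\<Sum>k\<in>F. gr_basis k - gr_basis \<one>) \<in> B"
    by (intro subspace_scale[OF B] subspace_sum[OF B])
  also have "(- 1 / real n) *\<^sub>R (\<Sum>k\<in>F. gr_basis k - gr_basis \<one>) = gr_basis \<one> - avg"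
  proof -
    have "(\<Sum>k\<in>F. gr_basis k - gr_basis \<one>) = (\<Sum>k\<in>F. gr_basis k) - real n *\<^sub>R gr_basis \<one>"
      by (simp only: sum_subtractf sum_constant_scaleR n_def)
    then show ?thesis using n by (simp add: avg_def scaleR_diff_right)
  qed
  finally obtain x where x: "gr_basis \<one> - avg \<in> CG" "x \<in> tuples S CG"
    "gr_boundary G S x + (rt a (gr_basis \<one> - avg) - (gr_basis \<one> - avg)) = 0"
    unfolding B_def by blast
  have "b1 G \<psi> = betti (insert a S)"
    using S a gen by (intro b1_eq_betti) (auto simp: finite_generating_set_def)
  also have "\<dots> \<le> h.betti S + R.q (gr_basis \<one> - (gr_basis \<one> - avg))"
    by (rule betti_insert_le_subgroup[OF H S(1) SH a x(2,1,3)])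
  also have "h.betti S = b1 (G\<lparr>carrier := ?H\<rparr>) \<psi>"
    using S(1) SH generate_consistent[OF SH H] by (intro h.b1_eq_betti[symmetric]) (auto simp: finite_generating_set_def)
  also have "R.q (gr_basis \<one> - (gr_basis \<one> - avg)) = 1 / card F"
  proof -
    have C: "gr_basis k \<in> CG" if "k \<in> F" for k using that FG by auto
    have sC: "(\<Sum>k\<in>F. gr_basis k) \<in> CG" using C by (rule R.C_sum)
    have "rip (\<Sum>k\<in>F. gr_basis k) (\<Sum>k\<in>F. gr_basis k) = (\<Sum>k\<in>F. rip (gr_basis k) (\<Sum>k\<in>F. gr_basis k))"
      by (rule R.sum_left[OF C sC])
    also have "\<dots> = (\<Sum>k\<in>F. \<Sum>k'\<in>F. rip (gr_basis k') (gr_basis k))"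
    proof (rule sum.cong[OF refl])
      fix k assume k: "k \<in> F"
      show "rip (gr_basis k) (\<Sum>k\<in>F. gr_basis k) = (\<Sum>k'\<in>F. rip (gr_basis k') (gr_basis k))"
        using R.sum_left[OF C C[OF k]] R.sym[OF C[OF k] sC] by simp
    qed
    also have "\<dots> = (\<Sum>k\<in>F. \<Sum>k'\<in>F. if k' = k then 1 else 0)"
    proof (intro sum.cong refl)
      fix k k' assume "k \<in> F" "k' \<in> F"
      then show "rip (gr_basis k') (gr_basis k) = (if k' = k then 1 else 0)"
        using orth[of k' k] FG by (auto simp: rip_def group_ring_ip_basis psi_one subset_iff)
    qed
    also have "\<dots> = real n" using F(1) by (simp add: n_def)
    finally have "R.q avg = (1 / real n)\<^sup>2 * real n"
      unfolding avg_def using R.q_scale[OF sC] by (simp add: R.q_def)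
    then show ?thesis using n by (simp add: n_def power2_eq_square)
  qed
  finally show ?thesis .
qed

end

section \<open>Passing to arbitrary groups\<close>

context group
begin

section \<open>Finitely generated subgroups and the limit inferior\<close>

lemma fg_subgroups_iff: "H \<in> fg_subgroups G \<longleftrightarrow> (\<exists>S. finite S \<and> S \<subseteq> carrier G \<and> H = generate G S)"
proof
  assume "H \<in> fg_subgroups G"
  then obtain S where S: "subgroup H G" "finite S" "S \<subseteq> H" "generate (G\<lparr>carrier := H\<rparr>) S = H"
    unfolding fg_subgroups_def finite_generating_set_def by auto
  then show "\<exists>S. finite S \<and> S \<subseteq> carrier G \<and> H = generate G S"
    using generate_consistent[OF S(3,1)] subgroup.subset[OF S(1)] by auto
next
  assume "\<exists>S. finite S \<and> S \<subseteq> carrier G \<and> H = generate G S"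
  then obtain S where S: "finite S" "S \<subseteq> carrier G" "H = generate G S" by blast
  have H: "subgroup H G" unfolding S(3) by (rule generate_is_subgroup[OF S(2)])
  have SH: "S \<subseteq> H" unfolding S(3) by (auto intro: generate.incl)
  show "H \<in> fg_subgroups G"
    unfolding fg_subgroups_def finite_generating_set_def
    using H S(1,3) SH generate_consistent[OF SH H] by auto
qed

lemma fg_subgroups_subgroup:
  assumes "subgroup U G"
  shows "fg_subgroups (G\<lparr>carrier := U\<rparr>) = {H \<in> fg_subgroups G. H \<subseteq> U}"
proof -
  have "subgroup H (G\<lparr>carrier := U\<rparr>) \<longleftrightarrow> subgroup H G \<and> H \<subseteq> U" for H
    using incl_subgroup[OF assms] subgroup_incl[OF _ assms] subgroup.subset[of H "G\<lparr>carrier := U\<rparr>"] by auto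
  then show ?thesis by (auto simp: fg_subgroups_def)
qed

lemma generate_finite_support:
  assumes "x \<in> generate G X"
  shows "\<exists>Y. finite Y \<and> Y \<subseteq> X \<and> x \<in> generate G Y"
  using assms
proof (induction x)
  case one
  then show ?case by (intro exI[of _ "{}"]) (auto intro: generate.one)
next
  case (incl h)
  then show ?case by (intro exI[of _ "{h}"]) (auto intro: generate.incl)
next
  case (inv h)
  then show ?case by (intro exI[of _ "{h}"]) (auto intro: generate.inv)
next
  case (eng g h)
  then obtain Y Z where "finite Y" "Y \<subseteq> X" "g \<in> generate G Y" "finite Z" "Z \<subseteq> X" "h \<in> generate G Z"
    by blast
  then show ?case
    using mono_generate[of Y "Y \<union> Z"] mono_generate[of Z "Y \<union> Z"]
    by (intro exI[of _ "Y \<union> Z"]) (auto intro: generate.eng)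
qed

lemma finite_subset_generate:
  assumes "finite T" "T \<subseteq> generate G X"
  shows "\<exists>Y. finite Y \<and> Y \<subseteq> X \<and> T \<subseteq> generate G Y"
  using assms
proof (induction T)
  case empty
  then show ?case by (intro exI[of _ "{}"]) auto
next
  case (insert t T)
  then obtain Y Z where "finite Y" "Y \<subseteq> X" "T \<subseteq> generate G Y" "finite Z" "Z \<subseteq> X" "t \<in> generate G Z"
    using generate_finite_support[of t X] by auto
  then show ?case
    using mono_generate[of Y "Y \<union> Z"] mono_generate[of Z "Y \<union> Z"]
    by (intro exI[of _ "Y \<union> Z"]) auto
qed

text \<open>The form in which the limit inferior is estimated: for an upper bound it is enough to
  find one good group \<open>L\<close> above each \<open>K\<close>, with an arbitrarily small
  loss.\<close>

lemma bar_b1_le_iff: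
  "bar_b1 G \<psi> \<le> c \<longleftrightarrow> (\<forall>K\<in>fg_subgroups G. \<forall>c'>c. \<exists>L\<in>fg_subgroups G. K \<subseteq> L \<and> ereal (b1 (G\<lparr>carrier := L\<rparr>) \<psi>) < c')"
  unfolding bar_b1_eq_SUP_INF[OF is_group] SUP_le_iff INF_le_iff by blast

lemma bar_b1_less_witness:
  assumes "bar_b1 G \<psi> < c" "K \<in> fg_subgroups G"
  obtains L where "L \<in> fg_subgroups G" "K \<subseteq> L" "ereal (b1 (G\<lparr>carrier := L\<rparr>) \<psi>) < c"
  using bar_b1_le_iff[of \<psi> "bar_b1 G \<psi>"] assms by blast

end

context char_group
begin

text \<open>\<open>b1_adjoin_le\<close> is applied inside \<open>generate G (insert a H)\<close>,
  which is generated by \<open>a\<close> and a finite generating set \<open>S\<close> of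
  \<open>H\<close>. If \<open>a\<close> is in \<open>S\<close> already, the group does not
  change.\<close>

lemma b1_adjoin_subgroup_le:
  assumes H: "H \<in> fg_subgroups G" and a: "a \<in> carrier G"
    and F: "finite F" "F \<noteq> {}" "F \<subseteq> H" "\<And>k. k \<in> F \<Longrightarrow> inv a \<otimes> k \<otimes> a \<in> H"
    and orth: "\<And>k k'. k \<in> F \<Longrightarrow> k' \<in> F \<Longrightarrow> k \<noteq> k' \<Longrightarrow> \<psi> (inv k' \<otimes> k) = 0"
  shows "b1 (G\<lparr>carrier := generate G (insert a H)\<rparr>) \<psi> \<le> b1 (G\<lparr>carrier := H\<rparr>) \<psi> + 1 / card F"
proof -
  obtain S where S: "finite S" "S \<subseteq> carrier G" "H = generate G S" using H fg_subgroups_iff by blast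
  have subH: "subgroup H G" unfolding S(3) by (rule generate_is_subgroup[OF S(2)])
  have SH: "S \<subseteq> H" unfolding S(3) by (auto intro: generate.incl)
  show ?thesis
  proof (cases "a \<in> S")
    case True
    then have "generate G (insert a H) = H"
      using SH generate_subgroup_incl[of "insert a H" H, OF _ subH] by (auto intro: generate.incl)
    then show ?thesis by simp
  next
    case False
    let ?L = "generate G (insert a S)"
    have aS: "insert a S \<subseteq> carrier G" using S(2) a by simp
    have L: "subgroup ?L G" by (rule generate_is_subgroup[OF aS])
    have aL: "insert a S \<subseteq> ?L" by (auto intro: generate.incl)
    have HL: "H \<subseteq> ?L" unfolding S(3) by (rule mono_generate) auto
    have eq: "generate G (insert a H) = ?L"
    proof
      show "generate G (insert a H) \<subseteq> ?L" using aL HL by (intro generate_subgroup_incl L) auto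
      show "?L \<subseteq> generate G (insert a H)" using SH by (intro mono_generate) auto
    qed
    interpret L: char_group "G\<lparr>carrier := ?L\<rparr>" \<psi> by (rule char_group_subgroup[OF L])
    have genS: "generate (G\<lparr>carrier := ?L\<rparr>) S = H"
      using generate_consistent[OF _ L, of S] aL S(3) by simp
    have inv: "inv\<^bsub>G\<lparr>carrier := ?L\<rparr>\<^esub> k = inv k" if "k \<in> ?L" for k
      using m_inv_consistent[OF L that] .
    have "b1 (G\<lparr>carrier := ?L\<rparr>) \<psi> \<le>
        b1 (G\<lparr>carrier := ?L\<rparr>\<lparr>carrier := generate (G\<lparr>carrier := ?L\<rparr>) S\<rparr>) \<psi> + 1 / card F"
    proof (rule L.b1_adjoin_le[OF S(1) _ _ False _ F(1,2)])
      show "generate (G\<lparr>carrier := ?L\<rparr>) (insert a S) = carrier (G\<lparr>carrier := ?L\<rparr>)"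
        using generate_consistent[OF aL L] by simp
      show "F \<subseteq> generate (G\<lparr>carrier := ?L\<rparr>) S" using F(3) genS by simp
      show "inv\<^bsub>G\<lparr>carrier := ?L\<rparr>\<^esub> a \<otimes>\<^bsub>G\<lparr>carrier := ?L\<rparr>\<^esub> k \<otimes>\<^bsub>G\<lparr>carrier := ?L\<rparr>\<^esub> a \<in> generate (G\<lparr>carrier := ?L\<rparr>) S"
        if "k \<in> F" for k using F(4)[OF that] aL by (simp add: genS inv)
      show "\<psi> (inv\<^bsub>G\<lparr>carrier := ?L\<rparr>\<^esub> k' \<otimes>\<^bsub>G\<lparr>carrier := ?L\<rparr>\<^esub> k) = 0"
        if "k \<in> F" "k' \<in> F" "k \<noteq> k'" for k k'
      proof -
        have "k' \<in> ?L" using that F(3) HL by blast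
        then show ?thesis using orth[OF that] by (simp add: inv)
      qed
    qed (use aL in auto)
    then show ?thesis by (simp add: genS eq)
  qed
qed

text \<open>The elements of \<open>A\<close> are adjoined one by one, at a cost of at most
  \<open>1 / n\<close> each. The sets \<open>F\<close> and their conjugates lie in the initial group
  \<open>H\<close>, so they serve at every stage.\<close>

lemma b1_adjoin_finite_le:
  assumes H: "H \<in> fg_subgroups G" and A: "finite A" "A \<subseteq> carrier G" and n: "0 < n"
    and F: "\<And>a. a \<in> A \<Longrightarrow> \<exists>F. finite F \<and> card F = n \<and> F \<subseteq> H \<and> (\<forall>k\<in>F. inv a \<otimes> k \<otimes> a \<in> H) \<and>
      (\<forall>k\<in>F. \<forall>k'\<in>F. k \<noteq> k' \<longrightarrow> \<psi> (inv k' \<otimes> k) = 0)"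
  shows "generate G (H \<union> A) \<in> fg_subgroups G \<and>
    b1 (G\<lparr>carrier := generate G (H \<union> A)\<rparr>) \<psi> \<le> b1 (G\<lparr>carrier := H\<rparr>) \<psi> + card A / n"
  using A F
proof (induction A)
  case empty
  have "subgroup H G" using H by (simp add: fg_subgroups_def)
  then have "generate G H = H"
    using generate_subgroup_incl[of H H] by (auto intro: generate.incl)
  then show ?case using H by simp
next
  case (insert a A)
  let ?L = "generate G (H \<union> A)"
  have HG: "H \<subseteq> carrier G" using H subgroup.subset by (auto simp: fg_subgroups_def)
  have HAG: "H \<union> A \<subseteq> carrier G" "insert a (H \<union> A) \<subseteq> carrier G" using HG insert by auto
  have IH: "?L \<in> fg_subgroups G" "b1 (G\<lparr>carrier := ?L\<rparr>) \<psi> \<le> b1 (G\<lparr>carrier := H\<rparr>) \<psi> + card A / n"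
    using insert by auto
  have HL: "H \<subseteq> ?L" by (auto intro: generate.incl)
  obtain F where "finite F \<and> card F = n \<and> F \<subseteq> H \<and> (\<forall>k\<in>F. inv a \<otimes> k \<otimes> a \<in> H) \<and>
      (\<forall>k\<in>F. \<forall>k'\<in>F. k \<noteq> k' \<longrightarrow> \<psi> (inv k' \<otimes> k) = 0)"
    using insert.prems(2)[OF insertI1] by (elim exE)
  then have F: "finite F" "card F = n" "F \<subseteq> H" "\<And>k. k \<in> F \<Longrightarrow> inv a \<otimes> k \<otimes> a \<in> H"
    "\<And>k k'. k \<in> F \<Longrightarrow> k' \<in> F \<Longrightarrow> k \<noteq> k' \<Longrightarrow> \<psi> (inv k' \<otimes> k) = 0"
    by auto
  have eq: "generate G (insert a ?L) = generate G (H \<union> insert a A)"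
  proof
    have sub: "subgroup (generate G (H \<union> insert a A)) G"
      using HAG by (intro generate_is_subgroup) auto
    have "?L \<subseteq> generate G (H \<union> insert a A)" by (rule mono_generate) auto
    then show "generate G (insert a ?L) \<subseteq> generate G (H \<union> insert a A)"
      by (intro generate_subgroup_incl sub) (auto intro: generate.incl)
    show "generate G (H \<union> insert a A) \<subseteq> generate G (insert a ?L)"
      by (rule mono_generate) (auto intro: generate.incl)
  qed
  have "b1 (G\<lparr>carrier := generate G (insert a ?L)\<rparr>) \<psi> \<le> b1 (G\<lparr>carrier := ?L\<rparr>) \<psi> + 1 / card F"
    using F n HL insert.prems(1) by (intro b1_adjoin_subgroup_le IH) auto
  moreover have "generate G (insert a ?L) \<in> fg_subgroups G"
  proof -
    obtain S where S: "finite S" "S \<subseteq> carrier G" "?L = generate G S" using IH(1) fg_subgroups_iff by blast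
    have "generate G (insert a ?L) = generate G (insert a S)"
    proof
      have sub: "subgroup (generate G (insert a S)) G"
        using S(2) insert.prems(1) by (intro generate_is_subgroup) auto
      have "?L \<subseteq> generate G (insert a S)" unfolding S(3) by (rule mono_generate) auto
      then show "generate G (insert a ?L) \<subseteq> generate G (insert a S)"
        by (intro generate_subgroup_incl sub) (auto intro: generate.incl)
      show "generate G (insert a S) \<subseteq> generate G (insert a ?L)"
        unfolding S(3) by (rule mono_generate) (auto intro: generate.incl)
    qed
    then show ?thesis using S insert.prems(1) fg_subgroups_iff by (metis finite_insert insert_subset)
  qed
  ultimately show ?case
    using IH(2) insert.hyps F(2) unfolding eq by (simp add: add_divide_distrib)
qed

text \<open>A finitely generated \<open>K\<close> involves only finitely many elements
  \<open>A'\<close> of \<open>A\<close>. The sets \<open>F a\<close> for these, with their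
  conjugates, are put into a finitely generated subgroup of \<open>U\<close> beforehand; a group
  \<open>L\<close> above it with small Betti number then contains them when \<open>A'\<close> is
  adjoined.\<close>

theorem bar_b1_q_psi_normal:
  assumes "q_psi_normal G \<psi> U"
  shows "bar_b1 G \<psi> \<le> bar_b1 (G\<lparr>carrier := U\<rparr>) \<psi>"
  unfolding bar_b1_le_iff
proof (intro ballI allI impI)
  fix K c
  assume K: "K \<in> fg_subgroups G" and c: "bar_b1 (G\<lparr>carrier := U\<rparr>) \<psi> < c"
  obtain A where U: "subgroup U G" and A: "A \<subseteq> carrier G" "generate G (U \<union> A) = carrier G"
    and reg: "\<And>a. a \<in> A \<Longrightarrow> \<exists>K. psi_regular G \<psi> K \<and> infinite K \<and> K \<subseteq> U \<inter> (a <# U #> inv a)"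
    using assms unfolding q_psi_normal_def by blast
  have UG: "U \<subseteq> carrier G" using U subgroup.subset by blast
  interpret U: group "G\<lparr>carrier := U\<rparr>" by (rule subgroup_imp_group[OF U])
  obtain T where T: "finite T" "T \<subseteq> carrier G" "K = generate G T" using K fg_subgroups_iff by blast
  obtain Y where Y: "finite Y" "Y \<subseteq> U \<union> A" "T \<subseteq> generate G Y"
    using finite_subset_generate[OF T(1), of "U \<union> A"] T(2) A(2) by auto
  define A' where "A' = Y \<inter> A"
  have A': "finite A'" "A' \<subseteq> A" "A' \<subseteq> carrier G" using Y(1) A(1) by (auto simp: A'_def)
  \<comment> \<open>\<open>r\<close> bounds the Betti number of \<open>L\<close>, and
    \<open>r' - r\<close> is the budget for adjoining all of \<open>A'\<close>; \<open>c\<close>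
    itself may be infinite.\<close>
  obtain r where r: "bar_b1 (G\<lparr>carrier := U\<rparr>) \<psi> < ereal r" "ereal r < c"
    using ereal_dense2[OF c] by blast
  obtain r' where r': "ereal r < ereal r'" "ereal r' < c" using ereal_dense2[OF r(2)] by blast
  obtain n where n: "0 < n" "real (card A') / real n \<le> r' - r"
  proof -
    obtain n :: nat where n: "real (card A') / (r' - r) \<le> real n" using real_arch_simple by blast
    \<comment> \<open>The successor keeps the denominator positive: for empty \<open>A'\<close> the
      number \<open>n\<close> may be 0.\<close>
    have "real (card A') / (r' - r) \<le> real (Suc n)" using n by simp
    then have "real (card A') / real (Suc n) \<le> r' - r" using r'(1) by (simp add: field_simps)
    then show ?thesis using that[of "Suc n"] by simp
  qed
  have "\<exists>F. finite F \<and> card F = n \<and> F \<subseteq> U \<and> (\<forall>k\<in>F. inv a \<otimes> k \<otimes> a \<in> U) \<and>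
      (\<forall>k\<in>F. \<forall>k'\<in>F. k \<noteq> k' \<longrightarrow> \<psi> (inv k' \<otimes> k) = 0)" if "a \<in> A'" for a
  proof -
    have a: "a \<in> A" "a \<in> carrier G" using that A' by auto
    obtain R where R: "psi_regular G \<psi> R" "infinite R" "R \<subseteq> U" "R \<subseteq> a <# U #> inv a"
      using reg[OF a(1)] by blast
    obtain F where F: "F \<subseteq> R" "finite F" "card F = n"
      using infinite_arbitrarily_large[OF R(2), of n] by blast
    have sub: "subgroup R G" using R(1) by (simp add: psi_regular_def)
    have RG: "R \<subseteq> carrier G" using sub subgroup.subset by blast
    have "inv a \<otimes> k \<otimes> a \<in> U" if "k \<in> F" for k
    proof -
      have "k \<in> (\<Union>x\<in>U. {a \<otimes> x \<otimes> inv a})"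
        using that F(1) R(4) by (auto simp: l_coset_def r_coset_def)
      then obtain u where u: "u \<in> U" "k = a \<otimes> u \<otimes> inv a" by blast
      then have "inv a \<otimes> k \<otimes> a = u"
        using a UG by (simp add: m_assoc inv_mult_cancel_left subset_iff)
      then show ?thesis using u by simp
    qed
    \<comment> \<open>Distinct elements of the regular subgroup \<open>R\<close> have a nontrivial
      quotient in \<open>R\<close>, where \<open>\<psi>\<close> vanishes.\<close>
    moreover have "\<psi> (inv k' \<otimes> k) = 0" if "k \<in> F" "k' \<in> F" "k \<noteq> k'" for k k'
    proof -
      have k: "k \<in> R" "k' \<in> R" "k \<in> carrier G" "k' \<in> carrier G" using that F(1) RG by auto
      then have "inv k' \<otimes> k \<in> R" using sub by (simp add: subgroup.m_closed subgroup.m_inv_closed)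
      moreover have "inv k' \<otimes> k \<noteq> \<one>" using that(3) k by (metis inv_equality inv_inv inv_closed)
      ultimately show ?thesis using R(1) by (auto simp: psi_regular_def)
    qed
    ultimately show ?thesis using F R(3) by blast
  qed
  then have "\<forall>a\<in>A'. \<exists>F. finite F \<and> card F = n \<and> F \<subseteq> U \<and> (\<forall>k\<in>F. inv a \<otimes> k \<otimes> a \<in> U) \<and>
      (\<forall>k\<in>F. \<forall>k'\<in>F. k \<noteq> k' \<longrightarrow> \<psi> (inv k' \<otimes> k) = 0)"
    by (rule ballI)
  from bchoice[OF this] obtain F where "\<forall>a\<in>A'. finite (F a) \<and> card (F a) = n \<and> F a \<subseteq> U \<and>
      (\<forall>k\<in>F a. inv a \<otimes> k \<otimes> a \<in> U) \<and> (\<forall>k\<in>F a. \<forall>k'\<in>F a. k \<noteq> k' \<longrightarrow> \<psi> (inv k' \<otimes> k) = 0)"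
    by (elim exE)
  then have F: "\<And>a. a \<in> A' \<Longrightarrow> finite (F a)" "\<And>a. a \<in> A' \<Longrightarrow> card (F a) = n"
    "\<And>a. a \<in> A' \<Longrightarrow> F a \<subseteq> U" "\<And>a k. a \<in> A' \<Longrightarrow> k \<in> F a \<Longrightarrow> inv a \<otimes> k \<otimes> a \<in> U"
    "\<And>a k k'. a \<in> A' \<Longrightarrow> k \<in> F a \<Longrightarrow> k' \<in> F a \<Longrightarrow> k \<noteq> k' \<Longrightarrow> \<psi> (inv k' \<otimes> k) = 0"
    by simp_all
  \<comment> \<open>Everything that \<open>L\<close> has to contain: the part of \<open>Y\<close> in
    \<open>U\<close>, and for each \<open>a\<close> the set \<open>F a\<close> with its
    conjugates.\<close>
  define X where "X = (Y \<inter> U) \<union> (\<Union>a\<in>A'. F a \<union> (\<lambda>k. inv a \<otimes> k \<otimes> a) ` F a)"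
  have X: "finite X" "X \<subseteq> U" using Y(1) A'(1) F(1,3,4) by (auto simp: X_def)
  have "generate G X \<in> fg_subgroups (G\<lparr>carrier := U\<rparr>)"
    unfolding fg_subgroups_subgroup[OF U] using X UG fg_subgroups_iff generate_subgroup_incl[OF X(2) U] by blast
  then obtain L where L: "L \<in> fg_subgroups (G\<lparr>carrier := U\<rparr>)" "generate G X \<subseteq> L"
      "ereal (b1 (G\<lparr>carrier := U\<rparr>\<lparr>carrier := L\<rparr>) \<psi>) < ereal r"
    using U.bar_b1_less_witness[OF r(1)] by blast
  have LG: "L \<in> fg_subgroups G" using L(1) fg_subgroups_subgroup[OF U] by blast
  have XL: "X \<subseteq> L" using L(2) by (auto intro: generate.incl)
  let ?L = "generate G (L \<union> A')"
  have "?L \<in> fg_subgroups G \<and> b1 (G\<lparr>carrier := ?L\<rparr>) \<psi> \<le> b1 (G\<lparr>carrier := L\<rparr>) \<psi> + card A' / n"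
  proof (rule b1_adjoin_finite_le[OF LG A'(1,3) n(1)])
    fix a assume a: "a \<in> A'"
    show "\<exists>F. finite F \<and> card F = n \<and> F \<subseteq> L \<and> (\<forall>k\<in>F. inv a \<otimes> k \<otimes> a \<in> L) \<and>
        (\<forall>k\<in>F. \<forall>k'\<in>F. k \<noteq> k' \<longrightarrow> \<psi> (inv k' \<otimes> k) = 0)"
    proof (intro exI[of _ "F a"] conjI ballI impI)
      show "F a \<subseteq> L" using XL a by (auto simp: X_def)
      show "inv a \<otimes> k \<otimes> a \<in> L" if "k \<in> F a" for k using XL a that by (auto simp: X_def)
    qed (use F a in auto)
  qed
  moreover have "b1 (G\<lparr>carrier := L\<rparr>) \<psi> < r" using L(3) by simp
  ultimately have L': "?L \<in> fg_subgroups G" "b1 (G\<lparr>carrier := ?L\<rparr>) \<psi> < r'" using n(2) by auto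
  have "K \<subseteq> ?L"
  proof -
    have "Y \<subseteq> L \<union> A'" using Y(2) XL by (auto simp: X_def A'_def)
    then have "T \<subseteq> ?L" using Y(3) mono_generate[of Y "L \<union> A'"] by blast
    moreover have "subgroup ?L G" using L'(1) by (simp add: fg_subgroups_def)
    ultimately show ?thesis unfolding T(3) by (rule generate_subgroup_incl)
  qed
  moreover have "ereal (b1 (G\<lparr>carrier := ?L\<rparr>) \<psi>) < c"
    using L'(2) r'(2) by (meson ereal_less_eq(3) less_imp_le less_le_trans order_le_less_trans)
  ultimately show "\<exists>L\<in>fg_subgroups G. K \<subseteq> L \<and> ereal (b1 (G\<lparr>carrier := L\<rparr>) \<psi>) < c"
    using L'(1) by blast
qed

text \<open>Finitely many generators of \<open>K\<close> lie in one member \<open>B\<close> of the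
  chain, and the group \<open>L\<close> found in \<open>B\<close> is also a subgroup of the
  union.\<close>

lemma bar_b1_chain_union_le:
  assumes "\<B> \<noteq> {}" "\<And>B. B \<in> \<B> \<Longrightarrow> subgroup B G" "\<And>B B'. B \<in> \<B> \<Longrightarrow> B' \<in> \<B> \<Longrightarrow> B \<subseteq> B' \<or> B' \<subseteq> B"
    and U: "subgroup (\<Union>\<B>) G" and c: "\<And>B. B \<in> \<B> \<Longrightarrow> bar_b1 (G\<lparr>carrier := B\<rparr>) \<psi> \<le> c"
  shows "bar_b1 (G\<lparr>carrier := \<Union>\<B>\<rparr>) \<psi> \<le> c"
proof -
  interpret U: group "G\<lparr>carrier := \<Union>\<B>\<rparr>" by (rule subgroup_imp_group[OF U])
  show ?thesis
    unfolding U.bar_b1_le_iff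
  proof (intro ballI allI impI)
    fix K c'
    assume K: "K \<in> fg_subgroups (G\<lparr>carrier := \<Union>\<B>\<rparr>)" and c': "c < c'"
    then have KG: "K \<in> fg_subgroups G" "K \<subseteq> \<Union>\<B>" using fg_subgroups_subgroup[OF U] by auto
    from KG(1) obtain T where T: "finite T" "T \<subseteq> carrier G" "K = generate G T"
      unfolding fg_subgroups_iff by (elim exE conjE)
    have "T \<subseteq> \<Union>\<B>" using KG(2) unfolding T(3) by (auto intro: generate.incl)
    moreover have "subset.chain \<B> \<B>" using assms(3) by (auto simp: subset.chain_def)
    ultimately obtain B where B: "B \<in> \<B>" "T \<subseteq> B"
      using finite_subset_Union_chain[OF T(1) _ assms(1)] by metis
    interpret B: group "G\<lparr>carrier := B\<rparr>" by (rule subgroup_imp_group[OF assms(2)[OF B(1)]])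
    have "K \<subseteq> B" unfolding T(3) by (rule generate_subgroup_incl[OF B(2) assms(2)[OF B(1)]])
    then have "K \<in> fg_subgroups (G\<lparr>carrier := B\<rparr>)" using KG fg_subgroups_subgroup[OF assms(2)[OF B(1)]] by simp
    moreover have "bar_b1 (G\<lparr>carrier := B\<rparr>) \<psi> < c'" using c[OF B(1)] c' by simp
    ultimately obtain L where "L \<in> fg_subgroups (G\<lparr>carrier := B\<rparr>)" "K \<subseteq> L"
        "ereal (b1 (G\<lparr>carrier := L\<rparr>) \<psi>) < c'"
      using B.bar_b1_less_witness[of \<psi> c' K] by auto
    moreover from this have "L \<in> fg_subgroups (G\<lparr>carrier := \<Union>\<B>\<rparr>)"
      using B(1) unfolding fg_subgroups_subgroup[OF U] fg_subgroups_subgroup[OF assms(2)[OF B(1)]] by blast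
    ultimately show "\<exists>L\<in>fg_subgroups (G\<lparr>carrier := \<Union>\<B>\<rparr>). K \<subseteq> L \<and>
        ereal (b1 (G\<lparr>carrier := \<Union>\<B>\<rparr>\<lparr>carrier := L\<rparr>) \<psi>) < c'"
      by auto
  qed
qed

end

theorem corollary3p3:
  fixes G :: "('a, 'b) monoid_scheme" and \<psi> :: "'a \<Rightarrow> complex" and H :: "'a set"
  assumes "group G"
    and "character G \<psi>"
    and "subgroup H G"
    and "weakly_q_psi_normal TYPE('i) G \<psi> H"
  shows "bar_b1 G \<psi> \<le> bar_b1 (G\<lparr>carrier := H\<rparr>) \<psi>"
proof -
  interpret char_group G \<psi> using assms(1,2) by (simp add: char_group_def char_group_axioms_def)
  obtain r :: "'i rel" and z \<alpha> C where r: "Well_order r" and z: "z \<in> Field r" and \<alpha>: "\<alpha> \<in> Field r"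
    and least: "\<And>\<gamma>. \<gamma> \<in> Field r \<Longrightarrow> (z, \<gamma>) \<in> r" and C: "\<And>\<gamma>. \<gamma> \<in> Field r \<Longrightarrow> subgroup (C \<gamma>) G"
    and mono: "\<And>\<beta> \<gamma>. (\<beta>, \<gamma>) \<in> r \<Longrightarrow> C \<beta> \<subseteq> C \<gamma>" and Cz: "C z = H" and C\<alpha>: "C \<alpha> = carrier G"
    and normal: "\<And>\<gamma>. \<gamma> \<in> Field r \<Longrightarrow> \<gamma> \<noteq> z \<Longrightarrow>
      q_psi_normal (G\<lparr>carrier := C \<gamma>\<rparr>) \<psi> (\<Union>\<beta>\<in>underS r \<gamma>. C \<beta>)"
  proof -
    from assms(4)[unfolded weakly_q_psi_normal_def, THEN conjunct2]
    obtain r :: "'i rel" and z \<alpha> C where "Well_order r \<and> z \<in> Field r \<and> \<alpha> \<in> Field r \<and>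
        (\<forall>\<gamma>\<in>Field r. (z, \<gamma>) \<in> r \<and> (\<gamma>, \<alpha>) \<in> r) \<and>
        (\<forall>\<gamma>\<in>Field r. subgroup (C \<gamma>) G) \<and>
        (\<forall>\<beta> \<gamma>. (\<beta>, \<gamma>) \<in> r \<longrightarrow> C \<beta> \<subseteq> C \<gamma>) \<and>
        C z = H \<and> C \<alpha> = carrier G \<and>
        (\<forall>\<gamma>\<in>Field r - {z}. q_psi_normal (G\<lparr>carrier := C \<gamma>\<rparr>) \<psi> (\<Union>\<beta>\<in>underS r \<gamma>. C \<beta>))"
      by (elim exE)
    then show ?thesis by (intro that[of r z \<alpha> C]) auto
  qed
  have wf: "wf (r - Id)" and total: "\<And>\<beta> \<gamma>. \<beta> \<in> Field r \<Longrightarrow> \<gamma> \<in> Field r \<Longrightarrow> \<beta> \<noteq> \<gamma> \<Longrightarrow> (\<beta>, \<gamma>) \<in> r \<or> (\<gamma>, \<beta>) \<in> r"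
    using r by (auto simp: well_order_on_def linear_order_on_def total_on_def)
  \<comment> \<open>Successor and limit stages are treated alike, since q-normality always refers to
    the union of the earlier stages.\<close>
  have "\<gamma> \<in> Field r \<longrightarrow> bar_b1 (G\<lparr>carrier := C \<gamma>\<rparr>) \<psi> \<le> bar_b1 (G\<lparr>carrier := H\<rparr>) \<psi>" for \<gamma>
  proof (induction \<gamma> rule: wf_induct_rule[OF wf])
    case (1 \<gamma>)
    show ?case
    proof (intro impI)
      assume \<gamma>: "\<gamma> \<in> Field r"
      show "bar_b1 (G\<lparr>carrier := C \<gamma>\<rparr>) \<psi> \<le> bar_b1 (G\<lparr>carrier := H\<rparr>) \<psi>"
      proof (cases "\<gamma> = z")
        case False
        let ?\<B> = "C ` underS r \<gamma>"
        interpret \<gamma>: char_group "G\<lparr>carrier := C \<gamma>\<rparr>" \<psi> by (rule char_group_subgroup[OF C[OF \<gamma>]])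
        have under: "\<beta> \<in> Field r" if "\<beta> \<in> underS r \<gamma>" for \<beta>
          using that by (auto simp: underS_def Field_def)
        \<comment> \<open>Part of the q-normality of the union in \<open>C \<gamma>\<close>.\<close>
        have "subgroup (\<Union>?\<B>) G"
          using normal[OF \<gamma> False] incl_subgroup[OF C[OF \<gamma>]] by (simp add: q_psi_normal_def)
        have "bar_b1 (G\<lparr>carrier := C \<gamma>\<rparr>) \<psi> \<le> bar_b1 (G\<lparr>carrier := \<Union>?\<B>\<rparr>) \<psi>"
          using \<gamma>.bar_b1_q_psi_normal[OF normal[OF \<gamma> False]] by simp
        also have "\<dots> \<le> bar_b1 (G\<lparr>carrier := H\<rparr>) \<psi>"
        proof (rule bar_b1_chain_union_le)
          \<comment> \<open>The least element \<open>z\<close> is strictly below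
            \<open>\<gamma>\<close>.\<close>
          show "?\<B> \<noteq> {}" using least[OF \<gamma>] False by (auto simp: underS_def)
          show "B \<subseteq> B' \<or> B' \<subseteq> B" if "B \<in> ?\<B>" "B' \<in> ?\<B>" for B B'
          proof -
          obtain \<beta> \<beta>' where "B = C \<beta>" "B' = C \<beta>'" "\<beta> \<in> Field r" "\<beta>' \<in> Field r"
            using \<open>B \<in> ?\<B>\<close> \<open>B' \<in> ?\<B>\<close> under by blast
          then show ?thesis using total[of \<beta> \<beta>'] mono by (cases "\<beta> = \<beta>'") auto
        qed
          show "bar_b1 (G\<lparr>carrier := B\<rparr>) \<psi> \<le> bar_b1 (G\<lparr>carrier := H\<rparr>) \<psi>" if "B \<in> ?\<B>" for B
            using that 1 under by (auto simp: underS_def)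
        qed (use C under \<open>subgroup (\<Union>?\<B>) G\<close> in auto)
        finally show ?thesis .
      qed (simp add: Cz)
    qed
  qed
  from this[of \<alpha>] show ?thesis using \<alpha> C\<alpha> by simp
qed

end
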